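(* Every infinite introreducible set $A\subseteq\omega$ has an infinite uniformly introreducible subset.
   Context: $\omega=\{0,1,2,\dots\}$. For $B\subseteq\omega$, $[B]^\omega$ is the collection of all infinite subsets of $B$. An infinite set $A$ is introreducible if $A\leq_T D$ for every $D\in[A]^\omega$ (the reduction may depend on $D$). An infinite set $R$ is uniformly introreducible if there is a single Turing functional $\Phi$ such that, for every $D\in[R]^\omega$, $\Phi^D$ is total and equals the characteristic function of $R$. *)

theory Defs
  imports Main
begin

text \<open>
  Turing functionals are rendered by Kleene's definition of relative computability: a functional
  is a term built from the initial functions and the characteristic function of an unspecified
  oracle by composition, primitive recursion and minimisation.
\<close>

datatype functional =
    Zero
  | Succ
  | Proj nat
  | Oracle
  | Comp functional "functional list"
  | PrimRec functional functional
  | Mu functional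

definition char_fun :: "nat set \<Rightarrow> nat \<Rightarrow> nat" where
  "char_fun A n = (if n \<in> A then 1 else 0)"

text \<open>
  \<open>eval D \<Phi> xs y\<close> says that the computation of \<open>\<Phi>\<close> with oracle \<open>D\<close> on the argument tuple \<open>xs\<close>
  converges with output \<open>y\<close>.  Terms carry no arities: where no rule fits the length of the tuple,
  the computation simply has no value.  Every argument of a composition must converge, and
  minimisation requires \<open>f\<close> to converge to a nonzero value at every smaller candidate.
\<close>

inductive eval :: "nat set \<Rightarrow> functional \<Rightarrow> nat list \<Rightarrow> nat \<Rightarrow> bool" for D :: "nat set" where
  Zero: "eval D Zero xs 0"
| Succ: "eval D Succ [x] (Suc x)"
| Proj: "i < length xs \<Longrightarrow> eval D (Proj i) xs (xs ! i)"
| Oracle: "eval D Oracle [x] (char_fun D x)"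
| Comp: "list_all2 (\<lambda>g y. eval D g xs y) gs ys \<Longrightarrow> eval D f ys z
    \<Longrightarrow> eval D (Comp f gs) xs z"
| PrimRec_0: "eval D f xs y \<Longrightarrow> eval D (PrimRec f g) (0 # xs) y"
| PrimRec_Suc: "eval D (PrimRec f g) (n # xs) r \<Longrightarrow> eval D g (n # r # xs) y
    \<Longrightarrow> eval D (PrimRec f g) (Suc n # xs) y"
| Mu: "eval D f (n # xs) 0 \<Longrightarrow> (\<forall>i<n. \<exists>y. y \<noteq> 0 \<and> eval D f (i # xs) y)
    \<Longrightarrow> eval D (Mu f) xs n"

inductive_cases eval_CompE: "eval D (Comp f gs) xs y"
inductive_cases eval_MuE: "eval D (Mu f) xs y"
inductive_cases eval_ZeroE: "eval D Zero xs y"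
inductive_cases eval_SuccE: "eval D Succ xs y"
inductive_cases eval_ProjE: "eval D (Proj i) xs y"
inductive_cases eval_OracleE: "eval D Oracle xs y"
inductive_cases eval_PrimRec_0E: "eval D (PrimRec f g) (0 # xs) y"
inductive_cases eval_PrimRec_SucE: "eval D (PrimRec f g) (Suc n # xs) y"

lemma eval_deterministic: "eval D \<Phi> xs y \<Longrightarrow> eval D \<Phi> xs z \<Longrightarrow> y = z"
proof (induction arbitrary: z rule: eval.induct)
  case (Zero xs)
  then show ?case by (rule eval_ZeroE) simp
next
  case (Succ x)
  then show ?case by (rule eval_SuccE) simp
next
  case (Proj i xs)
  from Proj.prems show ?case by (rule eval_ProjE) simp
next
  case (Oracle x)
  then show ?case by (rule eval_OracleE) simp
next
  case (Comp xs gs ys f w)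
  from Comp.prems obtain ys' where
    ys': "list_all2 (\<lambda>g y. eval D g xs y) gs ys'" "eval D f ys' z"
    by (rule eval_CompE)
  have "ys = ys'"
  proof (rule nth_equalityI)
    show "length ys = length ys'"
      using Comp.IH(1) ys'(1) by (simp add: list_all2_conv_all_nth)
    show "ys ! i = ys' ! i" if "i < length ys" for i
      using Comp.IH(1) ys'(1) that by (simp add: list_all2_conv_all_nth)
  qed
  with Comp.IH(2) ys'(2) show ?case by simp
next
  case (PrimRec_0 f xs y g)
  from PrimRec_0.prems have "eval D f xs z" by (rule eval_PrimRec_0E)
  then show ?case by (rule PrimRec_0.IH)
next
  case (PrimRec_Suc f g n xs r y)
  from PrimRec_Suc.prems obtain r' where
    r': "eval D (PrimRec f g) (n # xs) r'" "eval D g (n # r' # xs) z"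
    by (rule eval_PrimRec_SucE)
  from PrimRec_Suc.IH(1)[OF r'(1)] r'(2) show ?case by (simp add: PrimRec_Suc.IH(2))
next
  case (Mu f n xs)
  from Mu.prems have z: "eval D f (z # xs) 0" "\<forall>i<z. \<exists>y. y \<noteq> 0 \<and> eval D f (i # xs) y"
    by (auto elim: eval_MuE)
  have "\<not> n < z"
  proof
    assume "n < z"
    with z(2) obtain y where "y \<noteq> 0" "eval D f (n # xs) y" by blast
    with Mu.IH(1) show False by fastforce
  qed
  moreover have "\<not> z < n"
  proof
    assume "z < n"
    with Mu.IH(2) obtain y where "y \<noteq> 0" "\<forall>w. eval D f (z # xs) w \<longrightarrow> y = w" by blast
    with z(1) show False by blast
  qed
  ultimately show ?case by simp
qed

text \<open>
  \<open>computes \<Phi> D A\<close>: the unary function computed by \<open>\<Phi>\<close> from the oracle \<open>D\<close> (a partial function, by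
  \<open>eval_deterministic\<close>) is total and equals the characteristic function of \<open>A\<close>.
\<close>

definition computes :: "functional \<Rightarrow> nat set \<Rightarrow> nat set \<Rightarrow> bool" where
  "computes \<Phi> D A \<longleftrightarrow> (\<forall>n. eval D \<Phi> [n] (char_fun A n))"

definition turing_le :: "nat set \<Rightarrow> nat set \<Rightarrow> bool" (infix "\<le>\<^sub>T" 50) where
  "A \<le>\<^sub>T D \<longleftrightarrow> (\<exists>\<Phi>. computes \<Phi> D A)"

definition inf_subsets :: "nat set \<Rightarrow> nat set set" where
  "inf_subsets B = {D. D \<subseteq> B \<and> infinite D}"

definition introreducible :: "nat set \<Rightarrow> bool" where
  "introreducible A \<longleftrightarrow> infinite A \<and> (\<forall>D \<in> inf_subsets A. A \<le>\<^sub>T D)"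

definition uniformly_introreducible :: "nat set \<Rightarrow> bool" where
  "uniformly_introreducible R \<longleftrightarrow>
     infinite R \<and> (\<exists>\<Phi>. \<forall>D \<in> inf_subsets R. computes \<Phi> D R)"

end

theory Submission
  imports Defs "HOL-Library.Nat_Bijection" "HOL-Library.Countable" "HOL-Library.Infinite_Set"
begin

text \<open>The subset is found by a forcing argument with infinite subsets of \<open>A\<close>, carried out inside the
  class of sets that are hyperarithmetic in \<open>A\<close>, and then thinned out.

  The class is handled through one game.  \<open>W A p\<close> says that the first player wins, in finitely many
  moves, from the position \<open>p\<close> of a game with natural numbers as positions and moves, whose rules
  are computable from \<open>A\<close>.  The predicates \<open>\<lambda>x. W A (pr e x)\<close>, the class \<open>Pi A\<close>, are
  the \<open>\<Pi>\<^sup>1\<^sub>1\<close> predicates relative to \<open>A\<close>; a reservoir is an infinite subset of \<open>A\<close> that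
  is in the class together with its complement.  Three properties of the class matter.  Since a
  convergent computation uses only finitely much of its oracle, that \<open>\<Phi>\<close> computes \<open>A m\<close>
  from \<open>s \<union> D\<close> for every infinite \<open>D \<subseteq> Y\<close> above \<open>s\<close> is a statement about
  bars, hence in the class, uniformly in an index of the reservoir \<open>Y\<close> (\<open>land_index\<close>).  Since
  positions can be compared by the time they take to win, relations in the class have
  uniformizations in the class (\<open>Pi_uniformization\<close>), so a choice of a descending sequence of
  reservoirs can be made canonically and its diagonal is again a reservoir (\<open>dependent_choice\<close>).
  Finally, given \<open>A\<close>, membership in a reservoir is decidable from every function that
  dominates \<open>escape A\<close>, which bounds a defence of the second player (\<open>dec_by_W\<close>).

  Now run Mathias forcing with conditions \<open>(s, Y)\<close>, where \<open>Y\<close> is a reservoir.  Suppose that below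
  some condition \<open>(s, Y)\<close> no value of \<open>\<Phi>\<close> can be rejected: each \<open>m\<close> and each smaller reservoir leave
  room for a still smaller one all of whose infinite subsets above \<open>s\<close>, joined to \<open>s\<close>, compute \<open>A m\<close>
  through \<open>\<Phi>\<close>.  Diagonalizing yields a reservoir \<open>Z = {z 0 < z 1 < \<dots>}\<close> such that \<open>\<Phi>\<close> computes \<open>A n\<close> from \<open>s\<close> and any infinite set of
  elements \<open>z k\<close> with \<open>k > n\<close>.  Dropping the first \<open>n + 1\<close> elements of an oracle shows that \<open>A\<close> is
  computable from the infinite subsets of \<open>Z\<close> by one functional.  If no such condition existed, each
  functional could be rejected at some argument, and a rejection survives all later extensions
  of the stem on a suitable reservoir (\<open>reject_extend\<close>); the union of the stems would be an infinite
  subset of \<open>A\<close> that does not compute \<open>A\<close>, against introreducibility (\<open>success_exists\<close>).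

  The set \<open>Z\<close> need not be uniformly computable from its subsets.  So let \<open>R \<subseteq> Z\<close> have gaps that dominate
  \<open>escape A\<close>, each element of \<open>R\<close> moreover sitting at a place in \<open>Z\<close> whose number codes the list of all
  smaller elements of \<open>R\<close> (\<open>sparse_subset\<close>).  An infinite subset of \<open>R\<close> uniformly computes \<open>A\<close>, has
  gaps that dominate \<open>escape A\<close>, therefore computes \<open>Z\<close>, and reads off from any of its
  elements which smaller numbers are in \<open>R\<close>.\<close>

section \<open>Functions computable uniformly from a class of oracles\<close>

text \<open>Curried forms of the library's pairing, so that they can be composed pointwise.\<close>

definition pr :: "nat \<Rightarrow> nat \<Rightarrow> nat" where "pr a b = prod_encode (a, b)"
definition p1 :: "nat \<Rightarrow> nat" where "p1 z = fst (prod_decode z)"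
definition p2 :: "nat \<Rightarrow> nat" where "p2 z = snd (prod_decode z)"

lemma p1_pr [simp]: "p1 (pr a b) = a" and p2_pr [simp]: "p2 (pr a b) = b"
  by (simp_all add: pr_def p1_def p2_def)

lemma pr_p [simp]: "pr (p1 z) (p2 z) = z"
  by (simp add: pr_def p1_def p2_def)

lemma pr_eq_iff [simp]: "pr a b = pr c d \<longleftrightarrow> a = c \<and> b = d"
  by (simp add: pr_def)

lemma le_pr1: "a \<le> pr a b" and le_pr2: "b \<le> pr a b"
  by (simp_all add: pr_def le_prod_encode_1 le_prod_encode_2)

lemma p1_le: "p1 z \<le> z" and p2_le: "p2 z \<le> z"
  by (metis le_pr1 pr_p, metis le_pr2 pr_p)

lemma add_le_pr: "a + b \<le> pr a b"
proof -
  have "n \<le> triangle n" for n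
    by (induction n) auto
  then show ?thesis by (simp add: pr_def prod_encode_def le_add1 trans_le_add1)
qed

text \<open>The oracle is an argument of the functions, and one functional has to serve all oracles
  in \<open>\<D>\<close>: this is what uniformity means throughout.  Unbounded search is available whenever it
  succeeds for the oracles in \<open>\<D>\<close>.\<close>

definition cmp :: "nat set set \<Rightarrow> (nat set \<Rightarrow> nat \<Rightarrow> nat) \<Rightarrow> bool" where
  "cmp \<D> f \<longleftrightarrow> (\<exists>\<Phi>. \<forall>D\<in>\<D>. \<forall>x. eval D \<Phi> [x] (f D x))"

definition cmp2 :: "nat set set \<Rightarrow> (nat set \<Rightarrow> nat \<Rightarrow> nat \<Rightarrow> nat) \<Rightarrow> bool" where
  "cmp2 \<D> f \<longleftrightarrow> (\<exists>\<Phi>. \<forall>D\<in>\<D>. \<forall>x y. eval D \<Phi> [x, y] (f D x y))"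

definition dec :: "nat set set \<Rightarrow> (nat set \<Rightarrow> nat \<Rightarrow> bool) \<Rightarrow> bool" where
  "dec \<D> P \<longleftrightarrow> cmp \<D> (\<lambda>D x. if P D x then 1 else 0)"

lemma eval_Comp1: "eval D g xs y \<Longrightarrow> eval D f [y] z \<Longrightarrow> eval D (Comp f [g]) xs z"
  by (rule eval.Comp[where ys = "[y]"]) auto

lemma eval_Comp2:
  "eval D g xs y \<Longrightarrow> eval D h xs y' \<Longrightarrow> eval D f [y, y'] z \<Longrightarrow> eval D (Comp f [g, h]) xs z"
  by (rule eval.Comp[where ys = "[y, y']"]) auto

lemma eval_Proj0: "eval D (Proj 0) (x # xs) x"
  using eval.Proj[of 0 "x # xs"] by simp

lemma eval_Proj1: "eval D (Proj (Suc 0)) (x # y # xs) y"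
  using eval.Proj[of "Suc 0" "x # y # xs"] by simp

lemma eval_Proj2: "eval D (Proj 2) (x # y # z # xs) z"
  using eval.Proj[of 2 "x # y # z # xs"] by simp

lemma eval_PrimRec:
  assumes "eval D F xs b" and "\<And>i r. eval D G (i # r # xs) (h i r)"
  shows "eval D (PrimRec F G) (n # xs) (rec_nat b h n)"
  by (induction n) (auto intro: eval.PrimRec_0 eval.PrimRec_Suc assms)

lemma cmp_comp: "cmp \<D> f \<Longrightarrow> cmp \<D> g \<Longrightarrow> cmp \<D> (\<lambda>D x. f D (g D x))"
  unfolding cmp_def by (meson eval_Comp1)

lemma cmp_comp2: "cmp2 \<D> f \<Longrightarrow> cmp \<D> g \<Longrightarrow> cmp \<D> h \<Longrightarrow> cmp \<D> (\<lambda>D x. f D (g D x) (h D x))"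
  unfolding cmp_def cmp2_def by (meson eval_Comp2)

lemma cmp2_comp: "cmp \<D> f \<Longrightarrow> cmp2 \<D> g \<Longrightarrow> cmp2 \<D> (\<lambda>D x y. f D (g D x y))"
  unfolding cmp_def cmp2_def by (meson eval_Comp1)

lemma cmp2_comp2:
  "cmp2 \<D> f \<Longrightarrow> cmp2 \<D> g \<Longrightarrow> cmp2 \<D> h \<Longrightarrow> cmp2 \<D> (\<lambda>D x y. f D (g D x y) (h D x y))"
  unfolding cmp2_def by (meson eval_Comp2)

lemma cmp2_fst: "cmp2 \<D> (\<lambda>D x y. x)" and cmp2_snd: "cmp2 \<D> (\<lambda>D x y. y)"
  unfolding cmp2_def using eval_Proj0 eval_Proj1 by blast+

named_theorems cmp_intros

lemma cmp_id [cmp_intros]: "cmp \<D> (\<lambda>D x. x)"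
  unfolding cmp_def using eval_Proj0 by blast

lemma cmp_Suc_basic: "cmp \<D> (\<lambda>D x. Suc x)"
  unfolding cmp_def using eval.Succ by blast

lemma cmp_Suc [cmp_intros]: "cmp \<D> f \<Longrightarrow> cmp \<D> (\<lambda>D x. Suc (f D x))"
  by (rule cmp_comp[OF cmp_Suc_basic])

lemma cmp_const [cmp_intros]: "cmp \<D> (\<lambda>D x. c)"
proof (induction c)
  case 0
  then show ?case unfolding cmp_def using eval.Zero by blast
next
  case (Suc c)
  then show ?case by (rule cmp_Suc)
qed

lemma cmp_oracle [cmp_intros]: "cmp \<D> f \<Longrightarrow> cmp \<D> (\<lambda>D x. char_fun D (f D x))"
proof (rule cmp_comp[where f = char_fun])
  show "cmp \<D> char_fun" unfolding cmp_def using eval.Oracle by blast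
qed

lemma cmp2_rec:
  assumes "cmp \<D> b" and "cmp2 \<D> h"
  shows "cmp2 \<D> (\<lambda>D n x. rec_nat (b D x) (\<lambda>i r. h D r x) n)"
proof -
  from assms obtain B H where B: "\<And>D x. D \<in> \<D> \<Longrightarrow> eval D B [x] (b D x)"
    and H: "\<And>D r x. D \<in> \<D> \<Longrightarrow> eval D H [r, x] (h D r x)"
    unfolding cmp_def cmp2_def by blast
  have "eval D (PrimRec B (Comp H [Proj (Suc 0), Proj 2])) [n, x] (rec_nat (b D x) (\<lambda>i r. h D r x) n)"
    if "D \<in> \<D>" for D n x
    by (rule eval_PrimRec) (auto intro: B H that eval_Comp2 eval_Proj1 eval_Proj2)
  then show ?thesis unfolding cmp2_def by blast
qed

lemma cmp2_add: "cmp2 \<D> (\<lambda>D x y. x + y)"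
proof -
  have "cmp2 \<D> (\<lambda>D n x. rec_nat x (\<lambda>i r. Suc r) n)"
    by (rule cmp2_rec[OF cmp_id]) (rule cmp2_comp[OF cmp_Suc_basic cmp2_fst])
  moreover have "rec_nat x (\<lambda>i r. Suc r) n = n + x" for n x
    by (induction n) auto
  ultimately show ?thesis by simp
qed

text \<open>The step function sees the counter, but there is no parameter: this much is available before
  pairing is, and it is what predecessor and triangular numbers, hence pairing, need.\<close>

lemma cmp_rec_plain:
  assumes "cmp2 \<D> h"
  shows "cmp \<D> (\<lambda>D n. rec_nat c (\<lambda>i r. h D i r) n)"
proof -
  from assms obtain H where H: "\<And>D r x. D \<in> \<D> \<Longrightarrow> eval D H [r, x] (h D r x)"
    unfolding cmp2_def by blast
  obtain C where C: "\<And>D x. D \<in> \<D> \<Longrightarrow> eval D C [x] c"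
    using cmp_const[of \<D> c] unfolding cmp_def by blast
  have "eval D (Comp (PrimRec C (Comp H [Proj 0, Proj (Suc 0)])) [Proj 0, Proj 0]) [n]
      (rec_nat c (\<lambda>i r. h D i r) n)" if "D \<in> \<D>" for D n
    by (rule eval_Comp2[OF eval_Proj0 eval_Proj0], rule eval_PrimRec)
      (auto intro: C H that eval_Comp2 eval_Proj0 eval_Proj1)
  then show ?thesis unfolding cmp_def by blast
qed

lemma cmp_pred [cmp_intros]: "cmp \<D> f \<Longrightarrow> cmp \<D> (\<lambda>D x. f D x - Suc 0)"
proof (rule cmp_comp[where f = "\<lambda>D x. x - Suc 0"])
  have "cmp \<D> (\<lambda>D n. rec_nat 0 (\<lambda>i r. i) n)"
    by (rule cmp_rec_plain[OF cmp2_fst])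
  moreover have "rec_nat 0 (\<lambda>i r. i) n = n - Suc 0" for n
    by (cases n) auto
  ultimately show "cmp \<D> (\<lambda>D x. x - Suc 0)" by simp
qed

lemma cmp2_minus: "cmp2 \<D> (\<lambda>D x y. y - x)"
proof -
  have "cmp \<D> (\<lambda>D r. r - Suc 0)" by (rule cmp_pred[OF cmp_id])
  then have "cmp2 \<D> (\<lambda>D n x. rec_nat x (\<lambda>i r. r - Suc 0) n)"
    by (intro cmp2_rec[OF cmp_id]) (rule cmp2_comp[OF _ cmp2_fst])
  moreover have "rec_nat x (\<lambda>i r. r - Suc 0) n = x - n" for n x
    by (induction n) auto
  ultimately show ?thesis by simp
qed

lemma cmp_minus [cmp_intros]: "cmp \<D> f \<Longrightarrow> cmp \<D> g \<Longrightarrow> cmp \<D> (\<lambda>D x. f D x - g D x)"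
  by (rule cmp_comp2[OF cmp2_minus])

lemma cmp_triangle: "cmp \<D> f \<Longrightarrow> cmp \<D> (\<lambda>D x. triangle (f D x))"
proof (rule cmp_comp[where f = "\<lambda>D. triangle"])
  have "cmp \<D> (\<lambda>D n. rec_nat 0 (\<lambda>i r. Suc (i + r)) n)"
    by (rule cmp_rec_plain, rule cmp2_comp[OF cmp_Suc_basic cmp2_add])
  moreover have "rec_nat 0 (\<lambda>i r. Suc (i + r)) n = triangle n" for n
    by (induction n) auto
  ultimately show "cmp \<D> (\<lambda>D. triangle)" by simp
qed

lemma cmp2_pr: "cmp2 \<D> (\<lambda>D x y. pr x y)"
  unfolding pr_def prod_encode_def
  by simp (intro cmp2_comp2[OF cmp2_add] cmp2_comp[OF cmp_triangle[OF cmp_id]] cmp2_add cmp2_fst)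

lemma cmp_pr [cmp_intros]: "cmp \<D> f \<Longrightarrow> cmp \<D> g \<Longrightarrow> cmp \<D> (\<lambda>D x. pr (f D x) (g D x))"
  by (rule cmp_comp2[OF cmp2_pr])

lemma cmp_Least_zero:
  assumes "cmp2 \<D> f" and "\<And>D x. D \<in> \<D> \<Longrightarrow> \<exists>n. f D n x = 0"
  shows "cmp \<D> (\<lambda>D x. LEAST n. f D n x = 0)"
proof -
  from assms(1) obtain F where F: "\<And>D n x. D \<in> \<D> \<Longrightarrow> eval D F [n, x] (f D n x)"
    unfolding cmp2_def by blast
  have "eval D (Mu F) [x] (LEAST n. f D n x = 0)" if "D \<in> \<D>" for D x
  proof (rule eval.Mu)
    have "f D (LEAST n. f D n x = 0) x = 0"
      using assms(2)[OF that] by (auto intro: LeastI_ex)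
    then show "eval D F [LEAST n. f D n x = 0, x] 0"
      using F[OF that] by metis
    show "\<forall>i<LEAST n. f D n x = 0. \<exists>y. y \<noteq> 0 \<and> eval D F [i, x] y"
      using F[OF that] not_less_Least by blast
  qed
  then show ?thesis unfolding cmp_def by blast
qed

text \<open>Inverting the pairing needs only the index of the last triangular number below the
  code, which a search finds.\<close>

lemma prod_decode_Least:
  defines "s \<equiv> \<lambda>z. LEAST n. z - (triangle n + n) = 0"
  shows "p1 z = z - triangle (s z)" and "p2 z = s z - p1 z"
proof -
  obtain a b where ab: "z = pr a b" by (metis pr_p)
  have z: "z = triangle (a + b) + a"
    by (simp add: ab pr_def prod_encode_def)
  have mono: "triangle m \<le> triangle n" if "m \<le> n" for m n
    using that by (induction rule: dec_induct) auto
  have "s z = a + b" unfolding s_def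
  proof (rule Least_equality)
    show "z - (triangle (a + b) + (a + b)) = 0" using z by simp
    fix n assume *: "z - (triangle n + n) = 0"
    show "a + b \<le> n"
    proof (rule ccontr)
      assume "\<not> a + b \<le> n"
      then have "triangle (Suc n) \<le> triangle (a + b)" by (intro mono) simp
      with * z show False by simp
    qed
  qed
  moreover have "p1 z = a" "p2 z = b"
    by (simp_all add: ab)
  ultimately show "p1 z = z - triangle (s z)" "p2 z = s z - p1 z"
    using z by simp_all
qed

lemma cmp_decode_aux: "cmp \<D> (\<lambda>D z. LEAST n. z - (triangle n + n) = 0)"
proof (rule cmp_Least_zero)
  show "cmp2 \<D> (\<lambda>D n z. z - (triangle n + n))"
    by (intro cmp2_comp2[OF cmp2_minus] cmp2_comp2[OF cmp2_add]
        cmp2_comp[OF cmp_triangle[OF cmp_id]] cmp2_fst cmp2_snd)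
  show "\<exists>n. z - (triangle n + n) = 0" for z
    by (rule exI[of _ z]) simp
qed

lemma cmp_p1 [cmp_intros]: "cmp \<D> f \<Longrightarrow> cmp \<D> (\<lambda>D x. p1 (f D x))"
proof (rule cmp_comp[where f = "\<lambda>D. p1"])
  show "cmp \<D> (\<lambda>D. p1)"
    unfolding prod_decode_Least(1)[abs_def]
    by (intro cmp_minus cmp_id cmp_triangle cmp_decode_aux)
qed

lemma cmp_p2 [cmp_intros]: "cmp \<D> f \<Longrightarrow> cmp \<D> (\<lambda>D x. p2 (f D x))"
proof (rule cmp_comp[where f = "\<lambda>D. p2"])
  show "cmp \<D> (\<lambda>D. p2)"
    unfolding prod_decode_Least(2)[abs_def]
    by (intro cmp_minus cmp_id cmp_p1 cmp_decode_aux)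
qed

lemma cmp_rec [cmp_intros]:
  assumes "cmp \<D> b" and "cmp \<D> (\<lambda>D z. h D (p1 z) (p1 (p2 z)) (p2 (p2 z)))" and "cmp \<D> t"
  shows "cmp \<D> (\<lambda>D x. rec_nat (b D x) (\<lambda>i r. h D x i r) (t D x))"
proof -
  from assms obtain B H T where B: "\<And>D x. D \<in> \<D> \<Longrightarrow> eval D B [x] (b D x)"
    and T: "\<And>D x. D \<in> \<D> \<Longrightarrow> eval D T [x] (t D x)"
    and H: "\<And>D z. D \<in> \<D> \<Longrightarrow> eval D H [z] (h D (p1 z) (p1 (p2 z)) (p2 (p2 z)))"
    unfolding cmp_def by blast
  obtain Pr where Pr: "\<And>D x y. D \<in> \<D> \<Longrightarrow> eval D Pr [x, y] (pr x y)"
    using cmp2_pr[of \<D>] unfolding cmp2_def by blast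
  have "eval D (Comp (PrimRec B (Comp H [Comp Pr [Proj 2, Comp Pr [Proj 0, Proj (Suc 0)]]])) [T, Proj 0]) [x]
      (rec_nat (b D x) (\<lambda>i r. h D x i r) (t D x))" if D: "D \<in> \<D>" for D x
  proof (rule eval_Comp2[OF T[OF D] eval_Proj0], rule eval_PrimRec[OF B[OF D]])
    fix i r
    show "eval D (Comp H [Comp Pr [Proj 2, Comp Pr [Proj 0, Proj (Suc 0)]]]) [i, r, x] (h D x i r)"
      using H[OF D, of "pr x (pr i r)"]
      by (auto intro!: eval_Comp1 eval_Comp2 Pr[OF D] eval_Proj0 eval_Proj1 eval_Proj2)
  qed
  then show ?thesis unfolding cmp_def by blast
qed

lemma cmp_If [cmp_intros]:
  assumes "dec \<D> P" and "cmp \<D> f" and "cmp \<D> g"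
  shows "cmp \<D> (\<lambda>D x. if P D x then f D x else g D x)"
proof -
  have *: "cmp \<D> (\<lambda>D z. f D (p1 z))" by (intro cmp_comp[OF assms(2)] cmp_intros)
  have "cmp \<D> (\<lambda>D x. rec_nat (g D x) (\<lambda>i r. f D x) (if P D x then 1 else 0))"
    by (rule cmp_rec[OF assms(3) * assms(1)[unfolded dec_def]])
  moreover have "rec_nat a (\<lambda>i r. b) (if Q then 1 else 0) = (if Q then b else a)" for Q and a b :: nat
    by simp
  ultimately show ?thesis by (simp only:)
qed

lemma dec_eq0: "cmp \<D> f \<Longrightarrow> dec \<D> (\<lambda>D x. f D x = 0)"
proof -
  assume "cmp \<D> f"
  then have "cmp \<D> (\<lambda>D x. 1 - f D x)" by (intro cmp_intros)
  moreover have "1 - f D x = (if f D x = 0 then 1 else 0)" for D x by simp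
  ultimately show ?thesis by (simp only: dec_def)
qed

lemma dec_not [cmp_intros]: "dec \<D> P \<Longrightarrow> dec \<D> (\<lambda>D x. \<not> P D x)"
proof -
  assume "dec \<D> P"
  then have "cmp \<D> (\<lambda>D x. if P D x then 0 else 1)" by (intro cmp_intros)
  moreover have "(if P D x then 0 else 1) = (if \<not> P D x then 1 else 0::nat)" for D x by simp
  ultimately show ?thesis by (simp only: dec_def)
qed

lemma dec_If [cmp_intros]: "dec \<D> P \<Longrightarrow> dec \<D> Q \<Longrightarrow> dec \<D> R \<Longrightarrow>
    dec \<D> (\<lambda>D x. if P D x then Q D x else R D x)"
proof -
  assume PQR: "dec \<D> P" "dec \<D> Q" "dec \<D> R"
  have "cmp \<D> (\<lambda>D x. if P D x then (if Q D x then 1 else 0) else (if R D x then 1 else 0))"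
    by (rule cmp_If[OF PQR(1) PQR(2,3)[unfolded dec_def]])
  moreover have "(if P D x then (if Q D x then 1 else 0) else (if R D x then 1 else 0))
      = (if if P D x then Q D x else R D x then 1 else 0::nat)" for D x by simp
  ultimately show ?thesis by (simp only: dec_def)
qed

lemma dec_const [cmp_intros]: "dec \<D> (\<lambda>D x. b)"
  unfolding dec_def by (rule cmp_const)

lemma dec_conj [cmp_intros]: "dec \<D> P \<Longrightarrow> dec \<D> Q \<Longrightarrow> dec \<D> (\<lambda>D x. P D x \<and> Q D x)"
proof -
  assume PQ: "dec \<D> P" "dec \<D> Q"
  have "dec \<D> (\<lambda>D x. if P D x then Q D x else False)"
    by (rule dec_If[OF PQ dec_const])
  moreover have "(if P D x then Q D x else False) = (P D x \<and> Q D x)" for D x by simp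
  ultimately show ?thesis by (simp only:)
qed

lemma dec_disj [cmp_intros]: "dec \<D> P \<Longrightarrow> dec \<D> Q \<Longrightarrow> dec \<D> (\<lambda>D x. P D x \<or> Q D x)"
proof -
  assume "dec \<D> P" "dec \<D> Q"
  then have "dec \<D> (\<lambda>D x. if P D x then True else Q D x)" by (intro dec_If dec_const)
  moreover have "(if P D x then True else Q D x) = (P D x \<or> Q D x)" for D x by simp
  ultimately show ?thesis by (simp only:)
qed

lemma dec_imp [cmp_intros]: "dec \<D> P \<Longrightarrow> dec \<D> Q \<Longrightarrow> dec \<D> (\<lambda>D x. P D x \<longrightarrow> Q D x)"
proof -
  assume "dec \<D> P" "dec \<D> Q"
  then have "dec \<D> (\<lambda>D x. if P D x then Q D x else True)" by (intro dec_If dec_const)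
  moreover have "(if P D x then Q D x else True) = (P D x \<longrightarrow> Q D x)" for D x by simp
  ultimately show ?thesis by (simp only:)
qed

lemma dec_le [cmp_intros]: "cmp \<D> f \<Longrightarrow> cmp \<D> g \<Longrightarrow> dec \<D> (\<lambda>D x. f D x \<le> g D x)"
proof -
  assume "cmp \<D> f" "cmp \<D> g"
  then have "dec \<D> (\<lambda>D x. f D x - g D x = 0)" by (intro dec_eq0 cmp_minus)
  then show ?thesis by simp
qed

lemma dec_less [cmp_intros]: "cmp \<D> f \<Longrightarrow> cmp \<D> g \<Longrightarrow> dec \<D> (\<lambda>D x. f D x < g D x)"
proof -
  assume "cmp \<D> f" "cmp \<D> g"
  then have "dec \<D> (\<lambda>D x. Suc (f D x) \<le> g D x)" by (intro dec_le cmp_Suc)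
  then show ?thesis by (simp only: Suc_le_eq)
qed

lemma dec_eq [cmp_intros]: "cmp \<D> f \<Longrightarrow> cmp \<D> g \<Longrightarrow> dec \<D> (\<lambda>D x. f D x = g D x)"
proof -
  assume "cmp \<D> f" "cmp \<D> g"
  then have "dec \<D> (\<lambda>D x. f D x \<le> g D x \<and> g D x \<le> f D x)" by (intro dec_conj dec_le)
  moreover have "(f D x \<le> g D x \<and> g D x \<le> f D x) = (f D x = g D x)" for D x by auto
  ultimately show ?thesis by (simp only:)
qed

lemma dec_oracle [cmp_intros]: "cmp \<D> f \<Longrightarrow> dec \<D> (\<lambda>D x. f D x \<in> D)"
  unfolding dec_def char_fun_def[symmetric] by (rule cmp_oracle)

lemma dec_comp: "dec \<D> P \<Longrightarrow> cmp \<D> f \<Longrightarrow> dec \<D> (\<lambda>D x. P D (f D x))"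
  unfolding dec_def by (rule cmp_comp)

lemma dec_bex [cmp_intros]:
  assumes "dec \<D> (\<lambda>D z. P D (p1 z) (p2 z))" and "cmp \<D> t"
  shows "dec \<D> (\<lambda>D x. \<exists>i<t D x. P D x i)"
proof -
  have "dec \<D> (\<lambda>D z. P D (p1 z) (p1 (p2 z)))"
  proof -
    have "cmp \<D> (\<lambda>D z. pr (p1 z) (p1 (p2 z)))" by (intro cmp_intros)
    from dec_comp[OF assms(1) this] show ?thesis by simp
  qed
  then have "cmp \<D> (\<lambda>D x. rec_nat 0 (\<lambda>i r. if P D x i then 1 else r) (t D x))"
    by (intro cmp_intros assms)
  moreover have "rec_nat 0 (\<lambda>i r. if P D x i then 1 else r) n = (if \<exists>i<n. P D x i then 1 else 0::nat)"
    for D x n by (induction n) (auto simp: less_Suc_eq)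
  ultimately show ?thesis by (simp only: dec_def)
qed

lemma dec_ball [cmp_intros]:
  assumes "dec \<D> (\<lambda>D z. P D (p1 z) (p2 z))" and "cmp \<D> t"
  shows "dec \<D> (\<lambda>D x. \<forall>i<t D x. P D x i)"
proof -
  have "dec \<D> (\<lambda>D z. \<not> P D (p1 z) (p2 z))"
    by (rule dec_not[OF assms(1)])
  then have "dec \<D> (\<lambda>D x. \<exists>i<t D x. \<not> P D x i)"
    by (rule dec_bex[OF _ assms(2)])
  then have "dec \<D> (\<lambda>D x. \<not> (\<exists>i<t D x. \<not> P D x i))"
    by (rule dec_not)
  then show ?thesis by simp
qed

lemma cmp_Least [cmp_intros]:
  assumes "dec \<D> (\<lambda>D z. P D (p1 z) (p2 z))" and "\<And>D x. D \<in> \<D> \<Longrightarrow> \<exists>n. P D x n"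
  shows "cmp \<D> (\<lambda>D x. LEAST n. P D x n)"
proof -
  have "cmp \<D> (\<lambda>D z. if P D (p1 z) (p2 z) then 0 else 1)"
    by (intro cmp_intros assms)
  then have "cmp2 \<D> (\<lambda>D n x. if P D (p1 (pr x n)) (p2 (pr x n)) then 0 else 1)"
    by (rule cmp2_comp) (intro cmp2_comp2[OF cmp2_pr] cmp2_fst cmp2_snd)
  then have "cmp2 \<D> (\<lambda>D n x. if P D x n then 0 else 1)" by simp
  then have "cmp \<D> (\<lambda>D x. LEAST n. (if P D x n then 0 else 1::nat) = 0)"
    by (rule cmp_Least_zero) (simp add: assms(2))
  moreover have "((if Q then 0 else 1::nat) = 0) = Q" for Q by simp
  ultimately show ?thesis by (simp only:)
qed

lemma cmp_count [cmp_intros]: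
  assumes "dec \<D> (\<lambda>D z. P D (p1 z) (p2 z))" and "cmp \<D> t"
  shows "cmp \<D> (\<lambda>D x. card {i. i < t D x \<and> P D x i})"
proof -
  have "dec \<D> (\<lambda>D z. P D (p1 z) (p1 (p2 z)))"
  proof -
    have "cmp \<D> (\<lambda>D z. pr (p1 z) (p1 (p2 z)))" by (intro cmp_intros)
    from dec_comp[OF assms(1) this] show ?thesis by simp
  qed
  then have "cmp \<D> (\<lambda>D x. rec_nat 0 (\<lambda>i r. if P D x i then Suc r else r) (t D x))"
    by (intro cmp_intros assms)
  moreover have "rec_nat 0 (\<lambda>i r. if P D x i then Suc r else r) n = card {i. i < n \<and> P D x i}"
    for D x n
  proof (induction n)
    case (Suc n)
    have "{i. i < Suc n \<and> P D x i} = (if P D x n then insert n {i. i < n \<and> P D x i} else {i. i < n \<and> P D x i})"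
      by (auto simp: less_Suc_eq)
    then show ?case using Suc by simp
  qed simp
  ultimately show ?thesis by (simp only:)
qed

text \<open>Recursion with one recursive call at a smaller argument: first count the steps of the descent
  to the base case, then unwind it by an ordinary recursion of that length.\<close>

lemma cmp_descent:
  assumes "dec \<D> B" and "cmp \<D> b" and "cmp \<D> k" and "cmp \<D> (\<lambda>D z. h D (p1 z) (p2 z))"
    and less: "\<And>D x. \<not> B D x \<Longrightarrow> k D x < x"
    and f: "\<And>D x. f D x = (if B D x then b D x else h D x (f D (k D x)))"
  shows "cmp \<D> f"
proof -
  define it where "it D x j = rec_nat x (\<lambda>i r. k D r) j" for D x j
  have it_shift: "it D x (Suc j) = it D (k D x) j" for D x j
    by (induction j) (simp_all add: it_def)
  define J where "J D x = (LEAST j. B D (it D x j))" for D x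
  have ex: "\<exists>j. B D (it D x j)" for D x
  proof (induction x rule: less_induct)
    case (less x)
    show ?case
    proof (cases "B D x")
      case True
      then show ?thesis by (intro exI[of _ 0]) (simp add: it_def)
    next
      case False
      then obtain j where "B D (it D (k D x) j)" using less assms(5) by blast
      then show ?thesis by (intro exI[of _ "Suc j"]) (simp add: it_shift)
    qed
  qed
  have unwind: "f D x = rec_nat (b D (it D x (J D x))) (\<lambda>i r. h D (it D x (J D x - Suc i)) r) (J D x)"
    for D x
  proof (induction x rule: less_induct)
    case (less x)
    show ?case
    proof (cases "B D x")
      case True
      then have "J D x = 0" unfolding J_def by (intro Least_eq_0) (simp add: it_def)
      moreover have "f D x = b D x" using f[of D x] True by (simp only: if_True)
      ultimately show ?thesis by (simp add: it_def)
    next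
      case False
      obtain j where j: "B D (it D x j)" using ex by blast
      have J: "J D x = Suc (J D (k D x))"
        unfolding J_def it_shift[symmetric]
        by (rule Least_Suc[of "\<lambda>j. B D (it D x j)", OF j]) (simp add: it_def False)
      have fx: "f D x = h D x (f D (k D x))"
        using f[of D x] False by (simp only: if_False)
      have "rec_nat (b D (it D x (J D x))) (\<lambda>i r. h D (it D x (J D x - Suc i)) r) n
        = rec_nat (b D (it D (k D x) (J D (k D x)))) (\<lambda>i r. h D (it D (k D x) (J D (k D x) - Suc i)) r) n"
        if "n \<le> J D (k D x)" for n
        using that
      proof (induction n)
        case (Suc n)
        then have "J D x - Suc n = Suc (J D (k D x) - Suc n)" using J by simp
        then show ?case using Suc by (simp add: it_shift)
      qed (simp add: J it_shift)
      then have "f D x = h D x (rec_nat (b D (it D x (J D x)))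
          (\<lambda>i r. h D (it D x (J D x - Suc i)) r) (J D (k D x)))"
        using less[OF assms(5)[OF False]] by (simp only: fx)
      then show ?thesis using J by (simp add: it_def)
    qed
  qed
  have it: "cmp \<D> (\<lambda>D z. it D (g D z) (g' D z))" if "cmp \<D> g" "cmp \<D> g'" for g g'
    unfolding it_def by (intro cmp_rec that cmp_comp[OF assms(3)] cmp_p2 cmp_id)
  have J: "cmp \<D> (\<lambda>D x. J D (g D x))" if "cmp \<D> g" for g
    unfolding J_def by (intro cmp_Least dec_comp[OF assms(1)] it ex cmp_comp[OF that] cmp_p1 cmp_p2 cmp_id)
  have h: "cmp \<D> (\<lambda>D x. h D (g D x) (g' D x))" if "cmp \<D> g" "cmp \<D> g'" for g g'
    using cmp_comp[OF assms(4) cmp_pr[OF that]] by simp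
  have "cmp \<D> (\<lambda>D x. rec_nat (b D (it D x (J D x))) (\<lambda>i r. h D (it D x (J D x - Suc i)) r) (J D x))"
    by (intro cmp_rec cmp_comp[OF assms(2)] it h J cmp_minus cmp_Suc cmp_p1 cmp_p2 cmp_id)
  moreover have "(\<lambda>D x. rec_nat (b D (it D x (J D x))) (\<lambda>i r. h D (it D x (J D x - Suc i)) r) (J D x)) = f"
    by (intro ext) (rule unwind[symmetric])
  ultimately show ?thesis by simp
qed

section \<open>Coded lists\<close>

text \<open>Arithmetical versions of the operations on the codes of \<open>list_encode\<close>.  They are defined by
  recursion and search on the code itself, so that they are visibly computable.\<close>

definition drop1 :: "nat \<Rightarrow> nat \<Rightarrow> nat" where "drop1 c i = rec_nat c (\<lambda>j r. p2 (r - Suc 0)) i"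
definition hd1 :: "nat \<Rightarrow> nat" where "hd1 c = p1 (c - Suc 0)"
definition nth1 :: "nat \<Rightarrow> nat \<Rightarrow> nat" where "nth1 c i = hd1 (drop1 c i)"
definition len1 :: "nat \<Rightarrow> nat" where "len1 c = (LEAST i. drop1 c i = 0)"
definition mem1 :: "nat \<Rightarrow> nat \<Rightarrow> bool" where
  "mem1 y c \<longleftrightarrow> (\<exists>i<c. drop1 c i \<noteq> 0 \<and> hd1 (drop1 c i) = y)"
definition cons1 :: "nat \<Rightarrow> nat \<Rightarrow> nat" where "cons1 y c = Suc (pr y c)"

lemma list_encode_Cons: "list_encode (y # xs) = cons1 y (list_encode xs)"
  by (simp add: cons1_def pr_def)

declare list_encode.simps(2) [simp del]

lemma list_encode_eq_0 [simp]: "list_encode xs = 0 \<longleftrightarrow> xs = []"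
  by (cases xs) (auto simp: list_encode_Cons cons1_def)

lemma list_decode_cons1 [simp]: "list_decode (cons1 y c) = y # list_decode c"
  by (simp add: cons1_def pr_def)

lemma hd1_cons1 [simp]: "hd1 (cons1 y c) = y"
  by (simp add: hd1_def cons1_def)

lemma drop1_encode: "drop1 (list_encode xs) i = list_encode (drop i xs)"
proof (induction i)
  case (Suc i)
  have "p2 (list_encode ys - Suc 0) = list_encode (tl ys)" for ys
  proof (cases ys)
    case Nil
    have "prod_decode 0 = (0, 0)"
      by (simp add: prod_decode_def prod_decode_aux.simps)
    then show ?thesis using Nil by (simp add: p2_def)
  qed (simp add: cons1_def list_encode_Cons)
  then show ?case using Suc by (simp add: drop1_def drop_Suc tl_drop)
qed (simp add: drop1_def)

lemma length_le_encode: "length xs \<le> list_encode xs"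
proof (induction xs)
  case (Cons x xs)
  then show ?case using le_pr2[of "list_encode xs" x] by (simp add: list_encode_Cons cons1_def)
qed simp

lemma elem_less_encode: "x \<in> set xs \<Longrightarrow> x < list_encode xs"
proof (induction xs)
  case (Cons y xs)
  then show ?case
    using le_pr1[of y "list_encode xs"] le_pr2[of "list_encode xs" y]
    by (auto simp: list_encode_Cons cons1_def)
qed simp

lemma drop1_decode: "drop1 c i = list_encode (drop i (list_decode c))"
  using drop1_encode[of "list_decode c"] by simp

lemma hd1_encode: "xs \<noteq> [] \<Longrightarrow> hd1 (list_encode xs) = hd xs"
  by (cases xs) (auto simp: list_encode_Cons)

lemma nth1: "i < length (list_decode c) \<Longrightarrow> nth1 c i = list_decode c ! i"
  by (simp add: nth1_def drop1_decode hd1_encode hd_drop_conv_nth)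

lemma len1: "len1 c = length (list_decode c)"
  unfolding len1_def drop1_decode by (intro Least_equality) auto

lemma mem1: "mem1 y c \<longleftrightarrow> y \<in> set (list_decode c)"
proof
  assume "y \<in> set (list_decode c)"
  then obtain i where i: "i < length (list_decode c)" "list_decode c ! i = y"
    by (auto simp: in_set_conv_nth)
  moreover have "i < c" using i(1) length_le_encode[of "list_decode c"] by simp
  ultimately show "mem1 y c"
    unfolding mem1_def drop1_decode by (auto simp: hd1_encode hd_drop_conv_nth)
next
  assume "mem1 y c"
  then obtain i where i: "drop i (list_decode c) \<noteq> []" "hd (drop i (list_decode c)) = y"
    unfolding mem1_def drop1_decode by (auto simp: hd1_encode)
  then have "i < length (list_decode c)" by simp
  then show "y \<in> set (list_decode c)" using i by (auto simp: hd_drop_conv_nth)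
qed

lemma cmp_hd1 [cmp_intros]: "cmp \<D> f \<Longrightarrow> cmp \<D> (\<lambda>D x. hd1 (f D x))"
  unfolding hd1_def by (intro cmp_intros)

lemma cmp_cons1 [cmp_intros]: "cmp \<D> f \<Longrightarrow> cmp \<D> g \<Longrightarrow> cmp \<D> (\<lambda>D x. cons1 (f D x) (g D x))"
  unfolding cons1_def by (intro cmp_intros)

lemma cmp_drop1 [cmp_intros]: "cmp \<D> f \<Longrightarrow> cmp \<D> g \<Longrightarrow> cmp \<D> (\<lambda>D x. drop1 (f D x) (g D x))"
  unfolding drop1_def by (intro cmp_intros)

lemma cmp_nth1 [cmp_intros]: "cmp \<D> f \<Longrightarrow> cmp \<D> g \<Longrightarrow> cmp \<D> (\<lambda>D x. nth1 (f D x) (g D x))"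
  unfolding nth1_def by (intro cmp_intros)

lemma cmp_len1 [cmp_intros]: "cmp \<D> f \<Longrightarrow> cmp \<D> (\<lambda>D x. len1 (f D x))"
proof (rule cmp_comp[where f = "\<lambda>D. len1"])
  have "\<exists>i. drop1 c i = 0" for c
    by (rule exI[of _ "length (list_decode c)"]) (simp add: drop1_decode)
  then show "cmp \<D> (\<lambda>D. len1)"
    unfolding len1_def by (intro cmp_intros)
qed

lemma dec_mem1 [cmp_intros]: "cmp \<D> f \<Longrightarrow> cmp \<D> g \<Longrightarrow> dec \<D> (\<lambda>D x. mem1 (f D x) (g D x))"
proof -
  assume fg: "cmp \<D> f" "cmp \<D> g"
  have "dec \<D> (\<lambda>D z. mem1 (p1 z) (p2 z))"
    unfolding mem1_def by (intro cmp_intros)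
  from dec_comp[OF this cmp_pr[OF fg]] show ?thesis by simp
qed

section \<open>A universal inductive game\<close>

text \<open>Codes list increasing stems with the newest element in front.  A stem settles membership
  below its maximum: the answer to the query \<open>q\<close> is one more than the value of the characteristic
  function, and 0 as long as it is open.\<close>

definition orc :: "nat \<Rightarrow> nat \<Rightarrow> nat" where
  "orc c q = (if mem1 q c then 2 else if \<exists>z<c. mem1 z c \<and> q < z then 1 else 0)"

definition legal :: "nat \<Rightarrow> nat \<Rightarrow> bool" where
  "legal y c \<longleftrightarrow> (\<forall>z<c. mem1 z c \<longrightarrow> z < y)"

lemma legal: "legal y c \<longleftrightarrow> (\<forall>z \<in> set (list_decode c). z < y)"
  unfolding legal_def mem1 using elem_less_encode[of _ "list_decode c"] by auto

lemma orc: "orc c q = (if q \<in> set (list_decode c) then 2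
    else if \<exists>z \<in> set (list_decode c). q < z then 1 else 0)"
proof -
  have "(\<exists>z<c. mem1 z c \<and> q < z) \<longleftrightarrow> (\<exists>z \<in> set (list_decode c). q < z)"
    unfolding mem1 using elem_less_encode[of _ "list_decode c"] by auto
  then show ?thesis unfolding orc_def mem1 by simp
qed

definition b2n :: "bool \<Rightarrow> nat" where "b2n b = (if b then 1 else 0)"

lemma b2n_neq_0 [simp]: "b2n b \<noteq> 0 \<longleftrightarrow> b" by (simp add: b2n_def)

text \<open>The game has to evaluate terms at its positions.  These are the basic functions, applied to
  the top of a stack, and the next definition adds the moves on the stack, which is a nest of
  pairs with its top in the first component.\<close>

definition hs :: "nat set \<Rightarrow> (nat \<Rightarrow> nat) list" where
  "hs A = [p1, p2, Suc, \<lambda>z. 0, char_fun A, \<lambda>z. b2n (p1 z = p2 z), \<lambda>z. b2n (p1 z < p2 z),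
     \<lambda>z. nth1 (p1 z) (p2 z), len1, \<lambda>z. orc (p1 z) (p2 z), \<lambda>z. b2n (legal (p1 z) (p2 z))]"

definition ops :: "nat set \<Rightarrow> (nat \<Rightarrow> nat) list" where
  "ops A = map (\<lambda>h s. pr (h (p1 s)) (p2 s)) (hs A) @
    [\<lambda>x. pr x 0, p1, \<lambda>s. pr (p1 s) s, \<lambda>s. pr (p1 (p2 s)) (pr (p1 s) (p2 (p2 s))),
     \<lambda>s. pr (pr (p1 (p2 (p2 s))) (p1 s)) (pr (p1 (p2 s)) (p2 (p2 (p2 s)))), \<lambda>s. pr (p1 s) (p2 (p2 s))]"

definition sub :: "nat set \<Rightarrow> nat \<Rightarrow> nat \<Rightarrow> nat" where
  "sub A m x = (if m < length (ops A) then (ops A ! m) x else 0)"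

text \<open>A position is \<open>pr e x\<close>, the formula \<open>e = pr tag args\<close> at the argument \<open>x\<close>.  The tags are
  0 for the atom \<open>x \<noteq> 0\<close>, 1 and 2 for conjunction and disjunction, 3 and 4 for \<open>\<exists>\<close> and \<open>\<forall>\<close>,
  5 for applying an operation to \<open>x\<close>, 6 to 8 for the three phases of a bar, 9 for the position \<open>x\<close>
  itself, and 10 and 11 for the comparison of two positions.\<close>

abbreviation tag :: "nat \<Rightarrow> nat" where "tag p \<equiv> p1 (p1 p)"
abbreviation args :: "nat \<Rightarrow> nat" where "args p \<equiv> p2 (p1 p)"

lemma tag_less: "tag p \<noteq> 0 \<Longrightarrow> p2 p < p"
  using add_le_pr[of "p1 p" "p2 p"] p1_le[of "p1 p"] by simp

lemma tag_less_p1: "tag p \<noteq> 0 \<Longrightarrow> p1 (p2 p) < p" and tag_less_p2: "tag p \<noteq> 0 \<Longrightarrow> p2 (p2 p) < p"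
  using tag_less[of p] p1_le[of "p2 p"] p2_le[of "p2 p"] by simp_all

text \<open>Whose turn it is, and what a move does, in the positions that are no comparisons.  A false
  atom has type 2 and only itself as a successor, so the first player cannot win there.\<close>

definition bty :: "nat \<Rightarrow> nat" where
  "bty p = (if tag p = 0 then if p2 p \<noteq> 0 then 0 else 2
     else if tag p = 1 \<or> tag p = 4 \<or> tag p = 5 \<or> tag p = 7 \<or> tag p = 9 then 1 else 2)"

definition bch :: "nat set \<Rightarrow> nat \<Rightarrow> nat \<Rightarrow> nat" where
  "bch A p i =
    (if tag p = 1 \<or> tag p = 2 then pr (if i = 0 then p1 (args p) else p2 (args p)) (p2 p)
     else if tag p = 3 \<or> tag p = 4 then pr (args p) (pr (p2 p) i)
     else if tag p = 5 then pr (p2 (args p)) (sub A (p1 (args p)) (p2 p))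
     else if tag p = 6 then pr (if i = 0 then p1 (args p) else pr 7 (args p)) (p2 p)
     else if tag p = 7 then pr (pr 8 (args p)) (pr (p1 (p2 p)) (cons1 i (p2 (p2 p))))
     else if tag p = 8 then pr (if i = 0 then p2 (args p) else pr 6 (args p)) (p2 p)
     else if tag p = 9 then p2 p else p)"

text \<open>Think of the least ordinal time in which a position is won, infinite if it is not.  \<open>Lp p q\<close> is
  a position that is won iff \<open>p\<close> is won, and no later than \<open>q\<close>; \<open>Sp p q\<close> is won iff \<open>p\<close> is won strictly
  before \<open>q\<close>.  The first player plays \<open>p\<close> himself and answers in \<open>q\<close> for the opponent, the two games
  alternating, so types are dualized on the side of \<open>q\<close>.  If \<open>q\<close> is won at once then \<open>Sp p q\<close> cannot be
  won and is made to loop.\<close>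

definition Lp :: "nat \<Rightarrow> nat \<Rightarrow> nat" where "Lp p q = pr (pr 10 0) (pr p q)"
definition Sp :: "nat \<Rightarrow> nat \<Rightarrow> nat" where "Sp p q = pr (pr 11 0) (pr p q)"

function ty :: "nat \<Rightarrow> nat" where
  "ty p = (if tag p = 10 then ty (p1 (p2 p))
     else if tag p = 11 then if ty (p2 (p2 p)) = 2 then 1 else 2
     else bty p)"
  by auto
termination
  by (relation "measure id") (simp_all add: tag_less_p1 tag_less_p2)

declare ty.simps [simp del]

function ch :: "nat set \<Rightarrow> nat \<Rightarrow> nat \<Rightarrow> nat" where
  "ch A p i = (if tag p = 10 then Sp (ch A (p1 (p2 p)) i) (p2 (p2 p))
     else if tag p = 11 then if ty (p2 (p2 p)) = 0 then p else Lp (p1 (p2 p)) (ch A (p2 (p2 p)) i)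
     else bch A p i)"
  by auto
termination
  by (relation "measure (\<lambda>(A, p, i). p)") (simp_all add: tag_less_p1 tag_less_p2)

declare ch.simps [simp del]

text \<open>The first player owns the positions of type 2, the second those of type 1, and the first
  player has won at positions of type 0.  An infinite play is a loss for the first player.\<close>

inductive W :: "nat set \<Rightarrow> nat \<Rightarrow> bool" for A where
  W_win: "ty p = 0 \<Longrightarrow> W A p"
| W_all: "ty p = 1 \<Longrightarrow> (\<And>i. W A (ch A p i)) \<Longrightarrow> W A p"
| W_ex: "ty p = 2 \<Longrightarrow> W A (ch A p i) \<Longrightarrow> W A p"

lemma ty_cases: "ty p = 0 \<or> ty p = 1 \<or> ty p = 2"
proof (induction p rule: less_induct)
  case (less p)
  have "tag p = 10 \<Longrightarrow> p1 (p2 p) < p"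
    using tag_less[of p] p1_le[of "p2 p"] by simp
  then show ?case using less[of "p1 (p2 p)"] unfolding ty.simps[of p] bty_def by auto
qed

lemma W_0: "ty p = 0 \<Longrightarrow> W A p \<longleftrightarrow> True"
  by (simp add: W_win)

lemma W_1: "ty p = 1 \<Longrightarrow> W A p \<longleftrightarrow> (\<forall>i. W A (ch A p i))"
  by (auto intro: W_all elim: W.cases)

lemma W_2: "ty p = 2 \<Longrightarrow> W A p \<longleftrightarrow> (\<exists>i. W A (ch A p i))"
  by (auto intro: W_ex elim: W.cases)

section \<open>Comparison of stages\<close>

lemma ty_Lp: "ty (Lp p q) = ty p" and ch_Lp: "ch A (Lp p q) i = Sp (ch A p i) q"
  by (simp_all add: Lp_def ty.simps[of "pr (pr 10 0) _"] ch.simps[of A "pr (pr 10 0) _"])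

lemma ty_Sp: "ty (Sp p q) = (if ty q = 2 then 1 else 2)"
  and ch_Sp: "ch A (Sp p q) i = (if ty q = 0 then Sp p q else Lp p (ch A q i))"
  by (simp_all add: Sp_def ty.simps[of "pr (pr 11 0) _"] ch.simps[of A "pr (pr 11 0) _"])

definition L where "L A p q \<longleftrightarrow> W A (Lp p q)"
definition S where "S A p q \<longleftrightarrow> W A (Sp p q)"

lemma L_0: "ty p = 0 \<Longrightarrow> L A p q"
  by (simp add: L_def W_win ty_Lp)

lemma L_1: "ty p = 1 \<Longrightarrow> L A p q \<longleftrightarrow> (\<forall>i. S A (ch A p i) q)"
  by (simp add: L_def S_def W_1 ty_Lp ch_Lp)

lemma L_2: "ty p = 2 \<Longrightarrow> L A p q \<longleftrightarrow> (\<exists>i. S A (ch A p i) q)"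
  by (simp add: L_def S_def W_2 ty_Lp ch_Lp)

lemma not_S_0: assumes "ty q = 0" shows "\<not> S A p q"
proof
  assume "S A p q"
  then have "W A (Sp p q)" by (simp add: S_def)
  moreover have "W A r \<Longrightarrow> r = Sp p q \<Longrightarrow> False" for r
    by (induction r rule: W.induct) (use assms in \<open>auto simp: ty_Sp ch_Sp\<close>)
  ultimately show False by blast
qed

lemma S_1: "ty q = 1 \<Longrightarrow> S A p q \<longleftrightarrow> (\<exists>i. L A p (ch A q i))"
  by (simp add: L_def S_def W_2 ty_Sp ch_Sp)

lemma S_2: "ty q = 2 \<Longrightarrow> S A p q \<longleftrightarrow> (\<forall>i. L A p (ch A q i))"
  by (simp add: L_def S_def W_1 ty_Sp ch_Sp)

text \<open>A comparison that holds is itself a position that is won, so facts about comparisons can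
  be proved by induction on the win, with one invariant for each of the two kinds of comparison.\<close>

lemma LS_induct [consumes 1, case_names win all ex sall sex]:
  assumes "L A p q"
    and "\<And>p q. ty p = 0 \<Longrightarrow> P p q"
    and "\<And>p q. ty p = 1 \<Longrightarrow> (\<And>i. S A (ch A p i) q) \<Longrightarrow> (\<And>i. Q (ch A p i) q) \<Longrightarrow> P p q"
    and "\<And>p q i. ty p = 2 \<Longrightarrow> S A (ch A p i) q \<Longrightarrow> Q (ch A p i) q \<Longrightarrow> P p q"
    and "\<And>p q i. ty q = 1 \<Longrightarrow> L A p (ch A q i) \<Longrightarrow> P p (ch A q i) \<Longrightarrow> Q p q"
    and "\<And>p q. ty q = 2 \<Longrightarrow> (\<And>i. L A p (ch A q i)) \<Longrightarrow> (\<And>i. P p (ch A q i)) \<Longrightarrow> Q p q"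
  shows "P p q"
proof -
  have "W A r \<Longrightarrow> (\<forall>p q. r = Lp p q \<longrightarrow> P p q) \<and> (\<forall>p q. r = Sp p q \<longrightarrow> Q p q)" for r
  proof (induction r rule: W.induct)
    case (W_win r)
    then show ?case using assms(2) by (auto simp: ty_Lp ty_Sp split: if_splits)
  next
    case (W_all r)
    show ?case
    proof (intro conjI allI impI)
      fix p q assume r: "r = Lp p q"
      then have "ty p = 1" "\<And>i. S A (ch A p i) q" "\<And>i. Q (ch A p i) q"
        using W_all by (auto simp: ty_Lp ch_Lp S_def)
      then show "P p q" by (rule assms(3))
    next
      fix p q assume r: "r = Sp p q"
      then have "ty q = 2" "\<And>i. L A p (ch A q i)" "\<And>i. P p (ch A q i)"
        using W_all by (auto simp: ty_Sp ch_Sp L_def split: if_splits)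
      then show "Q p q" by (rule assms(6))
    qed
  next
    case (W_ex r i)
    show ?case
    proof (intro conjI allI impI)
      fix p q assume r: "r = Lp p q"
      then have "ty p = 2" "S A (ch A p i) q" "Q (ch A p i) q"
        using W_ex by (auto simp: ty_Lp ch_Lp S_def)
      then show "P p q" by (rule assms(4))
    next
      fix p q assume r: "r = Sp p q"
      then have "ty q \<noteq> 2" "S A p q"
        using W_ex by (auto simp: ty_Sp S_def intro: W.W_ex split: if_splits)
      then have q: "ty q = 1" using ty_cases[of q] not_S_0 by blast
      then have "L A p (ch A q i)" "P p (ch A q i)"
        using W_ex r by (auto simp: ty_Sp ch_Sp L_def)
      with q show "Q p q" by (rule assms(5))
    qed
  qed
  then show ?thesis using assms(1) by (auto simp: L_def)
qed

lemma L_W: "L A p q \<Longrightarrow> W A p"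
  by (induction p q rule: LS_induct[where Q = "\<lambda>p q. W A p"]) (auto intro: W.intros)

lemma S_cases: "S A p q \<Longrightarrow> (ty q = 1 \<and> (\<exists>i. L A p (ch A q i))) \<or> (ty q = 2 \<and> (\<forall>i. L A p (ch A q i)))"
  using ty_cases[of q] not_S_0 S_1 S_2 by blast

lemma W_before: "W A q \<Longrightarrow> \<not> W A r \<Longrightarrow> L A q r \<and> S A q r"
proof (induction q arbitrary: r rule: W.induct)
  case (W_win p)
  have L: "L A p r" for r using W_win by (simp add: L_0)
  show ?case using L ty_cases[of r] S_1[of r] S_2[of r] W_win W_0 by blast
next
  case (W_all p)
  have L: "L A p r" if "\<not> W A r" for r using W_all that by (simp add: L_1)
  show ?case using L W_all.prems ty_cases[of r] S_1[of r] S_2[of r] W_0 W_1 W_2 by blast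
next
  case (W_ex p i)
  have L: "L A p r" if "\<not> W A r" for r using W_ex that by (auto simp: L_2)
  show ?case using L W_ex.prems ty_cases[of r] S_1[of r] S_2[of r] W_0 W_1 W_2 by blast
qed

lemma S_from_L:
  assumes "\<And>q. L A p q \<or> S A q p"
  shows "S A p q \<or> L A q p"
  using ty_cases[of q]
proof (elim disjE)
  assume "ty q = 0"
  then show ?thesis by (simp add: L_0)
next
  assume "ty q = 1"
  then show ?thesis using assms by (auto simp: S_1 L_1)
next
  assume "ty q = 2"
  then show ?thesis using assms by (auto simp: S_2 L_2)
qed

lemma LS_trans_aux: "L A p q \<Longrightarrow> (\<forall>r. L A q r \<longrightarrow> L A p r) \<and> (\<forall>r. S A q r \<longrightarrow> S A p r)"
proof (induction p q rule: LS_induct[where Q = "\<lambda>p q. \<forall>r. L A q r \<longrightarrow> S A p r"])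
  case (win p q)
  have "L A p r" for r using win by (simp add: L_0)
  then show ?case by (metis S_cases S_1 S_2)
next
  case (all p q)
  then have "\<forall>r. L A q r \<longrightarrow> L A p r" by (simp add: L_1)
  then show ?case by (metis S_cases S_1 S_2)
next
  case (ex p q i)
  then have "\<forall>r. L A q r \<longrightarrow> L A p r" by (auto simp: L_2)
  then show ?case by (metis S_cases S_1 S_2)
next
  case (sall p q i)
  then show ?case by (auto simp: L_1)
next
  case (sex p q)
  then show ?case by (auto simp: L_2)
qed

lemma L_trans: "L A p q \<Longrightarrow> L A q r \<Longrightarrow> L A p r"
  using LS_trans_aux by blast

lemma L_or_S_ex:
  assumes "ty r = 2" and i: "\<And>s. L A (ch A r i) s \<or> S A s (ch A r i)"
    and below: "\<And>s t. L A s (ch A r i) \<Longrightarrow> L A s t \<or> S A t s"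
  shows "L A r s \<or> S A s r"
proof (cases "\<exists>j. S A (ch A r j) s")
  case True
  then show ?thesis using assms(1) by (simp add: L_2)
next
  case False
  then have "L A s (ch A r i)" using S_from_L[of A "ch A r i" s] i by blast
  then have "L A s (ch A r j)" for j using below False by blast
  then show ?thesis using assms(1) by (simp add: S_2)
qed

lemma L_or_S_all:
  assumes "ty r = 1" and i: "\<And>i s. L A (ch A r i) s \<or> S A s (ch A r i)"
  shows "L A r s \<or> S A s r"
  using S_from_L[of A "ch A r _" s] assms by (auto simp: L_1 S_1)

text \<open>Totality of the comparison.  The obvious induction, on the win of \<open>r\<close>, does not close when
  \<open>r\<close> is an existential position, because the comparison of \<open>s\<close> with a winning child of \<open>r\<close> says
  nothing about the other children.  The statement is therefore proved at once for all \<open>r\<close> that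
  are no later than a position \<open>q\<close>, by induction on the win of \<open>q\<close>; the positions no later
  than that child are then covered by the induction hypothesis.\<close>

lemma L_or_S_below: "W A q \<Longrightarrow> L A r q \<or> r = q \<Longrightarrow> L A r s \<or> S A s r"
proof (induction q arbitrary: r s rule: W.induct)
  case (W_win q)
  then show ?case
    using ty_cases[of r] not_S_0[of q] by (auto simp: L_0 L_1 L_2)
next
  case (W_all q)
  have step: "L A t s \<or> S A s t" if "S A t q" for s t
  proof -
    from that obtain j where "L A t (ch A q j)" using S_1[OF W_all.hyps(1)] by blast
    then show ?thesis by (rule W_all.IH[OF disjI1])
  qed
  show ?case
  proof (cases "r = q")
    case True
    show ?thesis unfolding True
      by (rule L_or_S_all[OF W_all.hyps(1)]) (rule W_all.IH, rule disjI2, rule refl)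
  next
    case False
    then have rq: "L A r q" using W_all.prems by blast
    consider "ty r = 0" | "ty r = 1" | "ty r = 2" using ty_cases[of r] by auto
    then show ?thesis
    proof cases
      case 3
      then obtain i where i: "S A (ch A r i) q" using rq by (auto simp: L_2)
      then obtain j where j: "L A (ch A r i) (ch A q j)" using S_1[OF W_all.hyps(1)] by blast
      show ?thesis
      proof (rule L_or_S_ex[OF 3])
        show "L A (ch A r i) s \<or> S A s (ch A r i)" for s
          by (rule step[OF i])
        show "L A s t \<or> S A t s" if "L A s (ch A r i)" for s t
          by (rule W_all.IH[OF disjI1[OF L_trans[OF that j]]])
      qed
    next
      case 1
      then show ?thesis by (simp add: L_0)
    next
      case 2
      have "S A (ch A r i) q" for i using rq L_1[OF 2] by blast
      then show ?thesis by (intro L_or_S_all[OF 2]) (rule step)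
    qed
  qed
next
  case (W_ex q k)
  have step: "L A t s \<or> S A s t" if "S A t q" for s t
  proof -
    from that have "L A t (ch A q k)" using S_2[OF W_ex.hyps(1)] by blast
    then show ?thesis by (rule W_ex.IH[OF disjI1])
  qed
  show ?case
  proof (cases "r = q")
    case True
    show ?thesis unfolding True
    proof (rule L_or_S_ex[OF W_ex.hyps(1)])
      show "L A (ch A q k) s \<or> S A s (ch A q k)" for s
        by (rule W_ex.IH) simp
      show "L A s t \<or> S A t s" if "L A s (ch A q k)" for s t
        by (rule W_ex.IH[OF disjI1[OF that]])
    qed
  next
    case False
    then have rq: "L A r q" using W_ex.prems by blast
    consider "ty r = 0" | "ty r = 1" | "ty r = 2" using ty_cases[of r] by auto
    then show ?thesis
    proof cases
      case 3
      then obtain i where i: "S A (ch A r i) q" using rq by (auto simp: L_2)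
      then have j: "L A (ch A r i) (ch A q k)" using S_2[OF W_ex.hyps(1)] by blast
      show ?thesis
      proof (rule L_or_S_ex[OF 3])
        show "L A (ch A r i) s \<or> S A s (ch A r i)" for s
          by (rule step[OF i])
        show "L A s t \<or> S A t s" if "L A s (ch A r i)" for s t
          by (rule W_ex.IH[OF disjI1[OF L_trans[OF that j]]])
      qed
    next
      case 1
      then show ?thesis by (simp add: L_0)
    next
      case 2
      have "S A (ch A r i) q" for i using rq L_1[OF 2] by blast
      then show ?thesis by (intro L_or_S_all[OF 2]) (rule step)
    qed
  qed
qed

lemma L_or_S: "W A p \<or> W A q \<Longrightarrow> L A p q \<or> S A q p"
  using L_or_S_below[of A p p q] W_before by blast

lemma not_L_S: "L A p q \<Longrightarrow> \<not> S A q p"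
proof (induction p q rule: LS_induct[where Q = "\<lambda>p q. \<not> L A q p"])
  case (win p q)
  then show ?case by (rule not_S_0)
next
  case (all p q)
  then show ?case by (simp add: S_1)
next
  case (ex p q i)
  then show ?case by (auto simp: S_2)
next
  case (sall p q i)
  then show ?case by (auto simp: L_1)
next
  case (sex p q)
  then show ?case by (auto simp: L_2)
qed

text \<open>The comparison is well-founded on positions that are won.  If \<open>p\<close> is not minimal in \<open>T\<close>, some
  \<open>q \<in> T\<close> is no later than a child of \<open>p\<close>; a minimal element of \<open>T\<close> with that child added is in \<open>T\<close> or
  is the child, and then \<open>q\<close> is minimal.\<close>

lemma L_minimal: "W A p \<Longrightarrow> p \<in> T \<Longrightarrow> \<exists>m\<in>T. \<forall>q\<in>T. L A m q"
proof (induction p arbitrary: T rule: W.induct)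
  case (W_win p)
  then show ?case by (intro bexI[of _ p] ballI L_0)
next
  case (W_all p)
  show ?case
  proof (rule ccontr)
    assume no: "\<not> ?thesis"
    then obtain q where q: "q \<in> T" "\<not> L A p q" using W_all.prems by blast
    then obtain i where i: "L A q (ch A p i)"
      using L_or_S[of A p q] W.W_all[OF W_all.hyps] S_1[OF W_all.hyps(1)] by blast
    obtain m where "m \<in> insert (ch A p i) T" "\<forall>x \<in> insert (ch A p i) T. L A m x"
      using W_all.IH[of i "insert (ch A p i) T"] by blast
    then have "(\<forall>x\<in>T. L A m x) \<and> m \<in> T \<or> (\<forall>x\<in>T. L A q x)"
      using L_trans[OF i] by auto
    then show False using no q(1) by blast
  qed
next
  case (W_ex p i)
  show ?case
  proof (rule ccontr)
    assume no: "\<not> ?thesis"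
    then obtain q where q: "q \<in> T" "\<not> L A p q" using W_ex.prems by blast
    then have i: "L A q (ch A p i)"
      using L_or_S[of A p q] W.W_ex[OF W_ex.hyps] S_2[OF W_ex.hyps(1)] by blast
    obtain m where "m \<in> insert (ch A p i) T" "\<forall>x \<in> insert (ch A p i) T. L A m x"
      using W_ex.IH[of "insert (ch A p i) T"] by blast
    then have "(\<forall>x\<in>T. L A m x) \<and> m \<in> T \<or> (\<forall>x\<in>T. L A q x)"
      using L_trans[OF i] by auto
    then show False using no q(1) by blast
  qed
qed

section \<open>The game is semidecidable relative to fast growing functions\<close>

lemma pr_strict_mono: "a < a' \<Longrightarrow> pr a b < pr a' b"
proof -
  assume "a < a'"
  moreover have "triangle m \<le> triangle n" if "m \<le> n" for m n
    using that by (induction rule: dec_induct) auto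
  ultimately have "triangle (a + b) \<le> triangle (a' + b)" by simp
  then show ?thesis using \<open>a < a'\<close> by (simp add: pr_def prod_encode_def)
qed

lemma cmp_b2n [cmp_intros]: "dec \<D> P \<Longrightarrow> cmp \<D> (\<lambda>D x. b2n (P D x))"
  by (simp add: dec_def b2n_def)

lemma cmp_orc [cmp_intros]: "cmp \<D> f \<Longrightarrow> cmp \<D> g \<Longrightarrow> cmp \<D> (\<lambda>D x. orc (f D x) (g D x))"
proof -
  assume fg: "cmp \<D> f" "cmp \<D> g"
  have "cmp \<D> (\<lambda>D z. orc (p1 z) (p2 z))"
    unfolding orc_def by (intro cmp_intros)
  from cmp_comp[OF this cmp_pr[OF fg]] show ?thesis by simp
qed

lemma dec_legal [cmp_intros]: "cmp \<D> f \<Longrightarrow> cmp \<D> g \<Longrightarrow> dec \<D> (\<lambda>D x. legal (f D x) (g D x))"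
proof -
  assume fg: "cmp \<D> f" "cmp \<D> g"
  have "dec \<D> (\<lambda>D z. legal (p1 z) (p2 z))"
    unfolding legal_def by (intro cmp_intros)
  from dec_comp[OF this cmp_pr[OF fg]] show ?thesis by simp
qed

lemma cmp_hs:
  assumes "cmp \<D> (\<lambda>D. char_fun A)" and "h \<in> set (hs A)"
  shows "cmp \<D> (\<lambda>D. h)"
proof -
  have "list_all (\<lambda>h. cmp \<D> (\<lambda>D. h)) (hs A)"
    unfolding hs_def list.pred_inject(2) by (intro conjI list.pred_inject(1) cmp_intros assms(1))
  then show ?thesis using assms(2) by (simp add: list_all_iff)
qed

lemma cmp_ops:
  assumes "cmp \<D> (\<lambda>D. char_fun A)" and "h \<in> set (ops A)"
  shows "cmp \<D> (\<lambda>D. h)"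
proof -
  have "cmp \<D> (\<lambda>D s. pr (h (p1 s)) (p2 s))" if "h \<in> set (hs A)" for h
    by (intro cmp_intros cmp_comp[OF cmp_hs[OF assms(1) that]])
  then have "\<forall>h \<in> set (map (\<lambda>h s. pr (h (p1 s)) (p2 s)) (hs A)). cmp \<D> (\<lambda>D. h)" by simp
  moreover have "list_all (\<lambda>h. cmp \<D> (\<lambda>D. h)) [\<lambda>x. pr x 0, p1, \<lambda>s. pr (p1 s) s,
      \<lambda>s. pr (p1 (p2 s)) (pr (p1 s) (p2 (p2 s))),
      \<lambda>s. pr (pr (p1 (p2 (p2 s))) (p1 s)) (pr (p1 (p2 s)) (p2 (p2 (p2 s)))), \<lambda>s. pr (p1 s) (p2 (p2 s))]"
    unfolding list.pred_inject(2) by (intro conjI list.pred_inject(1) cmp_intros)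
  ultimately show ?thesis using assms(2) unfolding ops_def set_append list_all_iff by blast
qed

text \<open>The list is finite and fixed, so the choice among its functions is a case distinction of fixed
  depth.\<close>

lemma cmp_nth_of:
  assumes "\<And>h. h \<in> set fs \<Longrightarrow> cmp \<D> (\<lambda>D. h)" and "cmp \<D> m" and g: "cmp \<D> g"
  shows "cmp \<D> (\<lambda>D z. if m D z < length fs then (fs ! m D z) (g D z) else 0)"
  using assms(1,2)
proof (induction fs arbitrary: m)
  case Nil
  show ?case using cmp_const[of \<D> 0] by simp
next
  case (Cons f fs)
  have f: "cmp \<D> (\<lambda>D. f)" using Cons.prems(1) by simp
  have rest: "cmp \<D> (\<lambda>D z. if m D z - 1 < length fs then (fs ! (m D z - 1)) (g D z) else 0)"
    using Cons.prems(2) by (intro Cons.IH Cons.prems(1)) (auto intro: cmp_intros)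
  have "cmp \<D> (\<lambda>D z. if m D z = 0 then f (g D z)
      else if m D z - 1 < length fs then (fs ! (m D z - 1)) (g D z) else 0)"
    by (rule cmp_If[OF dec_eq[OF Cons.prems(2) cmp_const] cmp_comp[OF f g] rest])
  moreover have "(if m D z = 0 then f (g D z)
      else if m D z - 1 < length fs then (fs ! (m D z - 1)) (g D z) else 0)
    = (if m D z < length (f # fs) then ((f # fs) ! m D z) (g D z) else 0)" for D z
    by (cases "m D z") auto
  ultimately show ?case by (simp only:)
qed

lemma cmp_bch:
  assumes "cmp \<D> (\<lambda>D. char_fun A)" and "cmp \<D> f" and "cmp \<D> g"
  shows "cmp \<D> (\<lambda>D x. bch A (f D x) (g D x))"
  unfolding bch_def sub_def
  by (intro cmp_intros cmp_nth_of[OF cmp_ops[OF assms(1)]] assms(2,3))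

lemma cmp_bty: "cmp \<D> f \<Longrightarrow> cmp \<D> (\<lambda>D x. bty (f D x))"
  unfolding bty_def by (intro cmp_intros)

text \<open>Types and moves recur through nested comparisons along a single branch, which is the kind
  of recursion that \<open>cmp_descent\<close> covers; the two are computed together because the moves of one
  kind of comparison depend on the type of the component.\<close>

lemma cmp_ty_ch:
  assumes A: "cmp \<D> (\<lambda>D. char_fun A)"
  shows "cmp \<D> (\<lambda>D x. pr (ty (p1 x)) (ch A (p1 x) (p2 x)))"
proof (rule cmp_descent)
  let ?t = "\<lambda>x. tag (p1 x)" and ?a = "\<lambda>x. p2 (p1 x)"
  show "dec \<D> (\<lambda>D x. ?t x \<noteq> 10 \<and> ?t x \<noteq> 11)" by (intro cmp_intros)
  show "cmp \<D> (\<lambda>D x. pr (bty (p1 x)) (bch A (p1 x) (p2 x)))"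
    by (intro cmp_intros cmp_bty cmp_bch[OF A])
  show "cmp \<D> (\<lambda>D x. pr (if ?t x = 10 then p1 (?a x) else p2 (?a x)) (p2 x))"
    by (intro cmp_intros)
  show "cmp \<D> (\<lambda>D z. (\<lambda>D x r. if ?t x = 10 then pr (p1 r) (Sp (p2 r) (p2 (?a x)))
      else pr (if p1 r = 2 then 1 else 2) (if p1 r = 0 then p1 x else Lp (p1 (?a x)) (p2 r))) D (p1 z) (p2 z))"
    unfolding Lp_def Sp_def by (intro cmp_intros)
  show "pr (if ?t x = 10 then p1 (?a x) else p2 (?a x)) (p2 x) < x"
    if "\<not> (?t x \<noteq> 10 \<and> ?t x \<noteq> 11)" for x
  proof -
    have "(if ?t x = 10 then p1 (?a x) else p2 (?a x)) < p1 x"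
      using that tag_less_p1[of "p1 x"] tag_less_p2[of "p1 x"] by auto
    from pr_strict_mono[OF this, of "p2 x"] show ?thesis by simp
  qed
  show "pr (ty (p1 x)) (ch A (p1 x) (p2 x)) =
    (if ?t x \<noteq> 10 \<and> ?t x \<noteq> 11 then pr (bty (p1 x)) (bch A (p1 x) (p2 x))
     else (\<lambda>D x r. if ?t x = 10 then pr (p1 r) (Sp (p2 r) (p2 (?a x)))
      else pr (if p1 r = 2 then 1 else 2) (if p1 r = 0 then p1 x else Lp (p1 (?a x)) (p2 r))) D x
     ((\<lambda>D x. pr (ty (p1 x)) (ch A (p1 x) (p2 x))) D (pr (if ?t x = 10 then p1 (?a x) else p2 (?a x)) (p2 x))))"
    for D x
    by (simp add: ty.simps[of "p1 x"] ch.simps[of A "p1 x"])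
qed

lemma cmp_ty: "cmp \<D> (\<lambda>D. char_fun A) \<Longrightarrow> cmp \<D> f \<Longrightarrow> cmp \<D> (\<lambda>D x. ty (f D x))"
proof -
  assume *: "cmp \<D> (\<lambda>D. char_fun A)" "cmp \<D> f"
  from cmp_p1[OF cmp_comp[OF cmp_ty_ch[OF *(1)] cmp_pr[OF *(2) *(2)]]] show ?thesis by simp
qed

lemma cmp_ch: "cmp \<D> (\<lambda>D. char_fun A) \<Longrightarrow> cmp \<D> f \<Longrightarrow> cmp \<D> g \<Longrightarrow> cmp \<D> (\<lambda>D x. ch A (f D x) (g D x))"
proof -
  assume *: "cmp \<D> (\<lambda>D. char_fun A)" "cmp \<D> f" "cmp \<D> g"
  from cmp_p2[OF cmp_comp[OF cmp_ty_ch[OF *(1)] cmp_pr[OF *(2,3)]]] show ?thesis by simp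
qed

text \<open>Finite derivations in the game in which the second player may only use moves up to \<open>g x\<close> at
  the position \<open>x\<close>.  The number \<open>N\<close> bounds the moves of the first player.\<close>

definition justified :: "nat set \<Rightarrow> (nat \<Rightarrow> nat) \<Rightarrow> nat \<Rightarrow> nat set \<Rightarrow> nat \<Rightarrow> bool" where
  "justified A g N X x \<longleftrightarrow> ty x = 0 \<or> (ty x = 1 \<and> (\<forall>i<Suc (g x). ch A x i \<in> X)) \<or>
     (ty x = 2 \<and> (\<exists>i<N. ch A x i \<in> X))"

fun derivation :: "nat set \<Rightarrow> (nat \<Rightarrow> nat) \<Rightarrow> nat \<Rightarrow> nat list \<Rightarrow> bool" where
  "derivation A g N [] = True"
| "derivation A g N (x # xs) = (justified A g N (set xs) x \<and> derivation A g N xs)"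

lemma justified_mono: "justified A g N X x \<Longrightarrow> N \<le> M \<Longrightarrow> X \<subseteq> Y \<Longrightarrow> justified A g M Y x"
  unfolding justified_def by (meson less_le_trans subset_iff)

lemma derivation_append: "derivation A g N xs \<Longrightarrow> derivation A g M ys \<Longrightarrow> derivation A g (max N M) (xs @ ys)"
proof (induction xs)
  case Nil
  have "derivation A g (max N M) ys" if "derivation A g M ys" for ys
    using that by (induction ys) (auto intro: justified_mono)
  then show ?case using Nil by simp
qed (auto intro: justified_mono)

lemma derivation_nth: "derivation A g N xs \<longleftrightarrow> (\<forall>j<length xs. justified A g N (set (drop (Suc j) xs)) (xs ! j))"
proof (induction xs)
  case (Cons x xs)
  show ?case by (simp add: Cons All_less_Suc2)
qed simp

definition derivable :: "nat set \<Rightarrow> (nat \<Rightarrow> nat) \<Rightarrow> nat \<Rightarrow> bool" where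
  "derivable A g p \<longleftrightarrow> (\<exists>N xs. derivation A g N xs \<and> p \<in> set xs)"

lemma derivable_all:
  fixes n :: nat
  assumes "\<And>i. i < n \<Longrightarrow> derivable A g (f i)"
  shows "\<exists>N xs. derivation A g N xs \<and> (\<forall>i<n. f i \<in> set xs)"
  using assms
proof (induction n)
  case 0
  have "derivation A g 0 []" by simp
  then show ?case by blast
next
  case (Suc n)
  then obtain N xs where 1: "derivation A g N xs" "\<forall>i<n. f i \<in> set xs"
    using less_SucI by blast
  obtain M ys where 2: "derivation A g M ys" "f n \<in> set ys"
    using Suc.prems[of n] unfolding derivable_def by blast
  show ?case
    using derivation_append[OF 1(1) 2(1)] 1(2) 2(2)
    by (intro exI[of _ "max N M"] exI[of _ "xs @ ys"]) (auto simp: less_Suc_eq)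
qed

lemma W_imp_derivable: "W A p \<Longrightarrow> derivable A g p"
proof (induction p rule: W.induct)
  case (W_win p)
  then have "derivation A g 0 [p]" by (simp add: justified_def)
  then show ?case unfolding derivable_def by (meson list.set_intros(1))
next
  case (W_all p)
  obtain N xs where "derivation A g N xs" "\<forall>i<Suc (g p). ch A p i \<in> set xs"
    using derivable_all[of "Suc (g p)" A g "ch A p"] W_all by blast
  then have "derivation A g N (p # xs)" using W_all by (simp add: justified_def)
  then show ?case unfolding derivable_def by (meson list.set_intros(1))
next
  case (W_ex p i)
  then obtain N xs where xs: "derivation A g N xs" "ch A p i \<in> set xs" unfolding derivable_def by blast
  from derivation_append[OF this(1), of "Suc i" "[]"] have "derivation A g (max N (Suc i)) xs" by simp
  moreover have "\<exists>j<max N (Suc i). ch A p j \<in> set xs" using xs(2) by (intro exI[of _ i]) simp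
  ultimately have "derivation A g (max N (Suc i)) (p # xs)" using W_ex by (simp add: justified_def)
  then show ?case unfolding derivable_def by (meson list.set_intros(1))
qed

text \<open>From a lost position of type 1 the second player has a move to a lost position; this is one.
  A function above all these values bounds the moves of a winning strategy for him.\<close>

definition escape :: "nat set \<Rightarrow> nat \<Rightarrow> nat" where
  "escape A p = (SOME i. \<not> W A (ch A p i))"

text \<open>A derivation in the bounded game checks the reply of the second player that would refute it,
  since the bound reaches that reply.  So it cannot prove a lost position.\<close>

lemma derivable_imp_W:
  assumes "\<And>x. escape A x \<le> g x" and "derivable A g p"
  shows "W A p"
proof -
  have "set xs \<subseteq> Collect (W A)" if "derivation A g N xs" for N xs
    using that
  proof (induction xs)
    case (Cons x xs)
    then have xs: "set xs \<subseteq> Collect (W A)" and j: "justified A g N (set xs) x" by auto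
    have "W A x"
    proof (rule ccontr)
      assume x: "\<not> W A x"
      then have "ty x \<noteq> 0" "ty x = 2 \<longrightarrow> \<not> (\<exists>i<N. ch A x i \<in> set xs)"
        using xs W.intros by blast+
      with j have 1: "ty x = 1" "\<forall>i<Suc (g x). ch A x i \<in> set xs"
        unfolding justified_def by auto
      from x have "\<exists>i. \<not> W A (ch A x i)" by (simp add: W_1[OF 1(1)])
      then have "\<not> W A (ch A x (escape A x))" unfolding escape_def by (rule someI_ex)
      moreover have "ch A x (escape A x) \<in> set xs"
        using 1(2) assms(1)[of x] by (simp add: less_Suc_eq_le)
      ultimately show False using xs by blast
    qed
    with xs show ?case by simp
  qed simp
  then show ?thesis using assms(2) unfolding derivable_def by blast
qed

text \<open>Derivations as numbers, in a form in which it is visibly decidable whether a number codes one.\<close>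

definition checks :: "nat set \<Rightarrow> (nat \<Rightarrow> nat) \<Rightarrow> nat \<Rightarrow> nat \<Rightarrow> bool" where
  "checks A g z p \<longleftrightarrow> mem1 p (p2 z) \<and> (\<forall>j<len1 (p2 z).
     (let x = nth1 (p2 z) j; c = drop1 (p2 z) (Suc j) in
       ty x = 0 \<or> (ty x = 1 \<and> (\<forall>i<Suc (g x). mem1 (ch A x i) c)) \<or>
       (ty x = 2 \<and> (\<exists>i<p1 z. mem1 (ch A x i) c))))"

lemma checks: "checks A g z p \<longleftrightarrow> derivation A g (p1 z) (list_decode (p2 z)) \<and> p \<in> set (list_decode (p2 z))"
  unfolding checks_def derivation_nth justified_def Let_def mem1 len1 by (auto simp: nth1 drop1_decode)

lemma derivable_checks: "derivable A g p \<longleftrightarrow> (\<exists>z. checks A g z p)"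
proof
  assume "derivable A g p"
  then obtain N xs where "derivation A g N xs" "p \<in> set xs" unfolding derivable_def by blast
  then have "checks A g (pr N (list_encode xs)) p" by (simp add: checks)
  then show "\<exists>z. checks A g z p" by blast
qed (auto simp: checks derivable_def)

lemma dec_checks:
  assumes A: "cmp \<D> (\<lambda>D. char_fun A)" and g: "cmp \<D> g" and "cmp \<D> a" and "cmp \<D> b"
  shows "dec \<D> (\<lambda>D x. checks A (g D) (a D x) (b D x))"
proof -
  have "dec \<D> (\<lambda>D x. checks A (g D) (p1 x) (p2 x))"
    unfolding checks_def Let_def
    by (intro cmp_intros cmp_ty[OF A] cmp_ch[OF A] cmp_comp[OF g])
  from dec_comp[OF this cmp_pr[OF assms(3,4)]] show ?thesis by simp
qed

text \<open>With a fast growing \<open>g\<close> at hand, winning is witnessed by finite derivations that can be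
  recognized.  One searches for a derivation of membership and for one of non-membership
  simultaneously.\<close>

lemma dec_by_W:
  assumes A: "cmp \<D> (\<lambda>D. char_fun A)" and g: "cmp \<D> g"
    and fast: "\<And>D x. D \<in> \<D> \<Longrightarrow> escape A x \<le> g D x"
    and "\<And>x. P x \<longleftrightarrow> W A (pr a x)" and "\<And>x. \<not> P x \<longleftrightarrow> W A (pr b x)"
  shows "dec \<D> (\<lambda>D. P)"
proof -
  define z where "z D x = (LEAST z. checks A (g D) z (pr a x) \<or> checks A (g D) z (pr b x))" for D x
  have W: "(\<exists>z. checks A (g D) z p) \<longleftrightarrow> W A p" if "D \<in> \<D>" for D p
    unfolding derivable_checks[symmetric] using W_imp_derivable derivable_imp_W[OF fast[OF that]] by (intro iffI)
  have ex: "\<exists>z. checks A (g D) z (pr a x) \<or> checks A (g D) z (pr b x)" if "D \<in> \<D>" for D x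
    using W[OF that, of "pr a x"] W[OF that, of "pr b x"] assms(4,5)[of x] by auto
  have "cmp \<D> z"
    unfolding z_def by (intro cmp_intros dec_checks[OF A g] ex)
  then have "dec \<D> (\<lambda>D x. checks A (g D) (z D x) (pr a x))"
    by (intro dec_checks[OF A g] cmp_intros)
  moreover have "checks A (g D) (z D x) (pr a x) \<longleftrightarrow> P x" if "D \<in> \<D>" for D x
  proof -
    have "checks A (g D) (z D x) (pr a x) \<or> checks A (g D) (z D x) (pr b x)"
      unfolding z_def using ex[OF that] by (rule LeastI_ex)
    then show ?thesis
      using W[OF that, of "pr a x"] W[OF that, of "pr b x"] assms(4,5)[of x] by auto
  qed
  ultimately show ?thesis unfolding dec_def cmp_def by auto
qed

section \<open>The predicates defined by the game\<close>

lemma length_ops: "length (ops A) = 17" and length_hs: "length (hs A) = 11"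
  by (simp_all add: ops_def hs_def)

text \<open>Positions with tag 5 have only one successor, up to repetition, and so perform a computation.\<close>

lemma W_sub:
  assumes "m < 17"
  shows "W A (pr (pr 5 (pr m e)) x) \<longleftrightarrow> W A (pr e ((ops A ! m) x))"
proof -
  have "ty (pr (pr 5 (pr m e)) x) = 1" by (simp add: ty.simps[of "pr (pr 5 _) _"] bty_def)
  from W_1[OF this, of A] show ?thesis
    using assms by (simp add: ch.simps[of A "pr (pr 5 _) _"] bch_def sub_def length_ops)
qed

lemma ops_hs: "k < 11 \<Longrightarrow> (ops A ! k) s = pr ((hs A ! k) (p1 s)) (p2 s)"
  by (simp add: ops_def nth_append length_hs)

lemma ops_stack:
  "(ops A ! 11) x = pr x 0" "(ops A ! 12) x = p1 x" "(ops A ! 13) x = pr (p1 x) x"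
  "(ops A ! 14) x = pr (p1 (p2 x)) (pr (p1 x) (p2 (p2 x)))"
  "(ops A ! 15) x = pr (pr (p1 (p2 (p2 x))) (p1 x)) (pr (p1 (p2 x)) (p2 (p2 (p2 x))))"
  "(ops A ! 16) x = pr (p1 x) (p2 (p2 x))"
  by (simp_all add: ops_def nth_append length_hs)

text \<open>Functions that the game can evaluate.  The value has to be pushed on the stack without losing
  what lies there, for otherwise terms with two arguments could not be built; hence \<open>x\<close>
  and the rest \<open>r\<close> stay below the result.\<close>

definition Tm :: "nat set \<Rightarrow> (nat \<Rightarrow> nat) \<Rightarrow> bool" where
  "Tm A f \<longleftrightarrow> (\<forall>e. \<exists>e'. \<forall>x r. W A (pr e' (pr x r)) \<longleftrightarrow> W A (pr e (pr (f x) (pr x r))))"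

named_theorems tm_intros

lemma Tm_id [tm_intros]: "Tm A (\<lambda>x. x)"
  unfolding Tm_def
proof
  fix e
  show "\<exists>e'. \<forall>x r. W A (pr e' (pr x r)) \<longleftrightarrow> W A (pr e (pr x (pr x r)))"
    by (rule exI[of _ "pr 5 (pr 13 e)"]) (simp add: W_sub ops_stack)
qed

lemma Tm_comp:
  assumes "Tm A g" and "Tm A f"
  shows "Tm A (\<lambda>x. g (f x))"
  unfolding Tm_def
proof
  fix e
  obtain e1 where e1: "\<forall>x r. W A (pr e1 (pr x r)) \<longleftrightarrow> W A (pr (pr 5 (pr 16 e)) (pr (g x) (pr x r)))"
    using assms(1) unfolding Tm_def by blast
  obtain e2 where e2: "\<forall>x r. W A (pr e2 (pr x r)) \<longleftrightarrow> W A (pr e1 (pr (f x) (pr x r)))"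
    using assms(2) unfolding Tm_def by blast
  show "\<exists>e'. \<forall>x r. W A (pr e' (pr x r)) \<longleftrightarrow> W A (pr e (pr (g (f x)) (pr x r)))"
    by (rule exI[of _ e2]) (simp add: e1 e2 W_sub ops_stack)
qed

lemma Tm_nth:
  assumes "k < 11" and "Tm A f"
  shows "Tm A (\<lambda>x. (hs A ! k) (f x))"
  unfolding Tm_def
proof
  fix e
  obtain e' where "\<forall>x r. W A (pr e' (pr x r)) \<longleftrightarrow> W A (pr (pr 5 (pr k e)) (pr (f x) (pr x r)))"
    using assms(2) unfolding Tm_def by blast
  then show "\<exists>e'. \<forall>x r. W A (pr e' (pr x r)) \<longleftrightarrow> W A (pr e (pr ((hs A ! k) (f x)) (pr x r)))"
    using assms(1) by (intro exI[of _ e']) (simp add: W_sub ops_hs)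
qed

lemma Tm_pr [tm_intros]:
  assumes "Tm A f" and "Tm A g"
  shows "Tm A (\<lambda>x. pr (f x) (g x))"
  unfolding Tm_def
proof
  fix e
  obtain e1 where e1: "\<forall>x r. W A (pr e1 (pr x r)) \<longleftrightarrow> W A (pr (pr 5 (pr 15 e)) (pr (g x) (pr x r)))"
    using assms(2) unfolding Tm_def by blast
  obtain e2 where e2: "\<forall>x r. W A (pr e2 (pr x r)) \<longleftrightarrow> W A (pr (pr 5 (pr 14 e1)) (pr (f x) (pr x r)))"
    using assms(1) unfolding Tm_def by blast
  show "\<exists>e'. \<forall>x r. W A (pr e' (pr x r)) \<longleftrightarrow> W A (pr e (pr (pr (f x) (g x)) (pr x r)))"
    by (rule exI[of _ e2]) (simp add: e1 e2 W_sub ops_stack)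
qed

lemma Tm_hs [tm_intros]:
  assumes "Tm A f"
  shows "Tm A (\<lambda>x. p1 (f x))" "Tm A (\<lambda>x. p2 (f x))" "Tm A (\<lambda>x. Suc (f x))"
    "Tm A (\<lambda>x. char_fun A (f x))" "Tm A (\<lambda>x. len1 (f x))"
  using Tm_nth[of 0, OF _ assms] Tm_nth[of 1, OF _ assms] Tm_nth[of 2, OF _ assms]
    Tm_nth[of 4, OF _ assms] Tm_nth[of 8, OF _ assms]
  by (simp_all add: hs_def)

lemma Tm_hs2:
  assumes "Tm A f" and "Tm A g"
  shows "Tm A (\<lambda>x. b2n (f x = g x))" "Tm A (\<lambda>x. b2n (f x < g x))"
    "Tm A (\<lambda>x. nth1 (f x) (g x))" "Tm A (\<lambda>x. orc (f x) (g x))" "Tm A (\<lambda>x. b2n (legal (f x) (g x)))"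
  using Tm_nth[of 5, OF _ Tm_pr[OF assms]] Tm_nth[of 6, OF _ Tm_pr[OF assms]]
    Tm_nth[of 7, OF _ Tm_pr[OF assms]] Tm_nth[of 9, OF _ Tm_pr[OF assms]]
    Tm_nth[of 10, OF _ Tm_pr[OF assms]]
  by (simp_all add: hs_def)

lemmas [tm_intros] = Tm_hs2(3,4)

lemma Tm_const [tm_intros]: "Tm A (\<lambda>x. c)"
proof (induction c)
  case 0
  show ?case using Tm_nth[of 3, OF _ Tm_id] by (simp add: hs_def)
qed (rule Tm_hs(3))

lemma Tm_cons1 [tm_intros]: "Tm A f \<Longrightarrow> Tm A g \<Longrightarrow> Tm A (\<lambda>x. cons1 (f x) (g x))"
  unfolding cons1_def by (intro tm_intros)

text \<open>The pointclass \<open>\<Pi>\<^sup>1\<^sub>1\<close> relative to \<open>A\<close>.  The closure properties below are collected for a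
  syntax-directed proof of membership; two-place predicates are passed to the quantifiers with
  their arguments paired.\<close>

definition Pi :: "nat set \<Rightarrow> (nat \<Rightarrow> bool) \<Rightarrow> bool" where
  "Pi A P \<longleftrightarrow> (\<exists>e. \<forall>x. P x \<longleftrightarrow> W A (pr e x))"

named_theorems pi_intros

lemma PiI: "(\<And>x. P x \<longleftrightarrow> W A (pr e x)) \<Longrightarrow> Pi A P"
  unfolding Pi_def by blast

lemma Pi_subst:
  assumes "Pi A P" and "Tm A f"
  shows "Pi A (\<lambda>x. P (f x))"
proof -
  obtain e where e: "\<And>x. P x \<longleftrightarrow> W A (pr e x)" using assms(1) unfolding Pi_def by blast
  obtain e' where "\<forall>x r. W A (pr e' (pr x r)) \<longleftrightarrow> W A (pr (pr 5 (pr 12 e)) (pr (f x) (pr x r)))"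
    using assms(2) unfolding Tm_def by blast
  then have "P (f x) \<longleftrightarrow> W A (pr (pr 5 (pr 11 e')) x)" for x
    by (simp add: W_sub ops_stack e)
  then show ?thesis by (rule PiI)
qed

lemma Pi_W [pi_intros]:
  assumes "Tm A f"
  shows "Pi A (\<lambda>x. W A (f x))"
proof (rule Pi_subst[where P = "W A", OF PiI assms])
  fix x
  have "ty (pr (pr 9 0) x) = 1" by (simp add: ty.simps[of "pr (pr 9 _) _"] bty_def)
  from W_1[OF this, of A] show "W A x \<longleftrightarrow> W A (pr (pr 9 0) x)"
    by (simp add: ch.simps[of A "pr (pr 9 _) _"] bch_def)
qed

text \<open>This needs an induction on wins because a false atom is a position from which play never
  leaves.\<close>

lemma Pi_neq_0:
  assumes "Tm A f"
  shows "Pi A (\<lambda>x. f x \<noteq> 0)"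
proof (rule Pi_subst[where P = "\<lambda>x. x \<noteq> 0", OF PiI assms])
  fix x
  have t: "ty (pr (pr 0 0) x) = (if x \<noteq> 0 then 0 else 2)"
    and c: "ch A (pr (pr 0 0) x) i = pr (pr 0 0) x" for i
    by (simp_all add: ty.simps[of "pr (pr 0 _) _"] bty_def ch.simps[of A "pr (pr 0 _) _"] bch_def)
  show "x \<noteq> 0 \<longleftrightarrow> W A (pr (pr 0 0) x)"
  proof
    assume "x \<noteq> 0"
    then show "W A (pr (pr 0 0) x)" by (intro W_win) (simp add: t)
  next
    have "W A r \<Longrightarrow> r = pr (pr 0 0) x \<Longrightarrow> x \<noteq> 0" for r
    proof (induction r rule: W.induct)
      case (W_win p)
      then have "ty (pr (pr 0 0) x) = 0" by simp
      then show ?case unfolding t by (simp split: if_splits)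
    next
      case (W_all p)
      then have "ty (pr (pr 0 0) x) = 1" by simp
      then show ?case unfolding t by (simp split: if_splits)
    next
      case (W_ex p i)
      then show ?case using c by simp
    qed
    then show "W A (pr (pr 0 0) x) \<Longrightarrow> x \<noteq> 0" by blast
  qed
qed

lemma Pi_eq [pi_intros]: "Tm A f \<Longrightarrow> Tm A g \<Longrightarrow> Pi A (\<lambda>x. f x = g x)"
  using Pi_neq_0[OF Tm_hs2(1)] by (simp only: b2n_neq_0)

lemma Pi_less [pi_intros]: "Tm A f \<Longrightarrow> Tm A g \<Longrightarrow> Pi A (\<lambda>x. f x < g x)"
  using Pi_neq_0[OF Tm_hs2(2)] by (simp only: b2n_neq_0)

lemma Pi_not_legal [pi_intros]: "Tm A f \<Longrightarrow> Tm A g \<Longrightarrow> Pi A (\<lambda>x. \<not> legal (f x) (g x))"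
proof -
  assume fg: "Tm A f" "Tm A g"
  have "Pi A (\<lambda>x. b2n (legal (f x) (g x)) = 0)" by (intro Pi_eq Tm_hs2 fg Tm_const)
  moreover have "b2n Q = 0 \<longleftrightarrow> \<not> Q" for Q by (simp add: b2n_def)
  ultimately show ?thesis by simp
qed

lemma Pi_binary:
  assumes "t \<in> {1, 2}" and "Pi A P" and "Pi A Q"
  obtains e where "\<And>x. ty (pr e x) = t"
    "\<And>x i. W A (ch A (pr e x) i) \<longleftrightarrow> (if i = 0 then P x else Q x)"
proof -
  obtain a b where ab: "\<And>x. P x \<longleftrightarrow> W A (pr a x)" "\<And>x. Q x \<longleftrightarrow> W A (pr b x)"
    using assms unfolding Pi_def by blast
  show ?thesis
    by (rule that[of "pr t (pr a b)"])
      (use assms(1) in \<open>auto simp: ab ty.simps[of "pr (pr _ _) _"] bty_def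
        ch.simps[of A "pr (pr _ _) _"] bch_def\<close>)
qed

lemma Pi_conj [pi_intros]: "Pi A P \<Longrightarrow> Pi A Q \<Longrightarrow> Pi A (\<lambda>x. P x \<and> Q x)"
proof -
  assume "Pi A P" "Pi A Q"
  then obtain e where e: "\<And>x. ty (pr e x) = 1"
    "\<And>x i. W A (ch A (pr e x) i) \<longleftrightarrow> (if i = 0 then P x else Q x)"
    using Pi_binary[of 1] by blast
  have "P x \<and> Q x \<longleftrightarrow> W A (pr e x)" for x
    unfolding W_1[OF e(1)] e(2) by (metis zero_neq_one)
  then show ?thesis by (rule PiI)
qed

lemma Pi_disj [pi_intros]: "Pi A P \<Longrightarrow> Pi A Q \<Longrightarrow> Pi A (\<lambda>x. P x \<or> Q x)"
proof -
  assume "Pi A P" "Pi A Q"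
  then obtain e where e: "\<And>x. ty (pr e x) = 2"
    "\<And>x i. W A (ch A (pr e x) i) \<longleftrightarrow> (if i = 0 then P x else Q x)"
    using Pi_binary[of 2] by blast
  have "P x \<or> Q x \<longleftrightarrow> W A (pr e x)" for x
    unfolding W_2[OF e(1)] e(2) by (metis zero_neq_one)
  then show ?thesis by (rule PiI)
qed

lemma Pi_ex [pi_intros]:
  assumes "Pi A (\<lambda>z. P (p1 z) (p2 z))"
  shows "Pi A (\<lambda>x. \<exists>y. P x y)"
proof -
  obtain a where a: "\<And>z. P (p1 z) (p2 z) \<longleftrightarrow> W A (pr a z)"
    using assms unfolding Pi_def by blast
  have "ty (pr (pr 3 a) x) = 2" "ch A (pr (pr 3 a) x) y = pr a (pr x y)" for x y
    by (simp_all add: ty.simps[of "pr (pr 3 _) _"] bty_def ch.simps[of A "pr (pr 3 _) _"] bch_def)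
  then have "(\<exists>y. P x y) \<longleftrightarrow> W A (pr (pr 3 a) x)" for x
    using a[of "pr x _"] by (simp add: W_2)
  then show ?thesis by (rule PiI)
qed

lemma Pi_all [pi_intros]:
  assumes "Pi A (\<lambda>z. P (p1 z) (p2 z))"
  shows "Pi A (\<lambda>x. \<forall>y. P x y)"
proof -
  obtain a where a: "\<And>z. P (p1 z) (p2 z) \<longleftrightarrow> W A (pr a z)"
    using assms unfolding Pi_def by blast
  have "ty (pr (pr 4 a) x) = 1" "ch A (pr (pr 4 a) x) y = pr a (pr x y)" for x y
    by (simp_all add: ty.simps[of "pr (pr 4 _) _"] bty_def ch.simps[of A "pr (pr 4 _) _"] bch_def)
  then have "(\<forall>y. P x y) \<longleftrightarrow> W A (pr (pr 4 a) x)" for x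
    using a[of "pr x _"] by (simp add: W_1)
  then show ?thesis by (rule PiI)
qed

lemma Pi_L [pi_intros]: "Tm A f \<Longrightarrow> Tm A g \<Longrightarrow> Pi A (\<lambda>x. L A (f x) (g x))"
  unfolding L_def Lp_def by (intro tm_intros Pi_W)

lemma Pi_S [pi_intros]: "Tm A f \<Longrightarrow> Tm A g \<Longrightarrow> Pi A (\<lambda>x. S A (f x) (g x))"
  unfolding S_def Sp_def by (intro tm_intros Pi_W)

lemma Pi_ball [pi_intros]:
  assumes "Tm A t" and "Pi A (\<lambda>z. P (p1 z) (p2 z))"
  shows "Pi A (\<lambda>x. \<forall>i<t x. P x i)"
proof -
  have "Tm A (\<lambda>z. t (p1 z))"
    by (rule Tm_comp[OF assms(1)]) (intro tm_intros)
  then have "Pi A (\<lambda>x. \<forall>i. t x < Suc i \<or> P x i)"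
    by (intro pi_intros tm_intros assms)
  moreover have "(\<forall>i. t x < Suc i \<or> P x i) \<longleftrightarrow> (\<forall>i<t x. P x i)" for x
    by (metis less_Suc_eq_le not_less)
  ultimately show ?thesis by (simp only:)
qed

lemma Pi_le [pi_intros]: "Tm A f \<Longrightarrow> Tm A g \<Longrightarrow> Pi A (\<lambda>x. f x \<le> g x)"
  using Pi_less[OF _ Tm_hs(3), of A f g] by (simp only: less_Suc_eq_le)

text \<open>Quantification over infinite sequences enters through bars: each sequence that extends \<open>c\<close>
  eventually meets \<open>P\<close>, unless it leaves the tree by meeting \<open>Q\<close> first.\<close>

inductive bar :: "(nat list \<Rightarrow> bool) \<Rightarrow> (nat list \<Rightarrow> bool) \<Rightarrow> nat list \<Rightarrow> bool" for P Q where
  bar_now: "P c \<Longrightarrow> bar P Q c"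
| bar_step: "(\<And>y. Q (y # c) \<or> bar P Q (y # c)) \<Longrightarrow> bar P Q c"

text \<open>The game form of a bar: the first player either claims \<open>P\<close> now (tag 6), or lets the second player
  choose the next entry (tag 7), after which he may claim \<open>Q\<close> or go on (tag 8).\<close>

lemma Pi_bar:
  assumes "Pi A (\<lambda>z. P (p1 z) (list_decode (p2 z)))" and "Pi A (\<lambda>z. Q (p1 z) (list_decode (p2 z)))"
  shows "Pi A (\<lambda>z. bar (P (p1 z)) (Q (p1 z)) (list_decode (p2 z)))"
proof -
  obtain a b where "\<And>z. P (p1 z) (list_decode (p2 z)) \<longleftrightarrow> W A (pr a z)"
    and "\<And>z. Q (p1 z) (list_decode (p2 z)) \<longleftrightarrow> W A (pr b z)"
    using assms unfolding Pi_def by blast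
  from this(1)[of "pr _ (list_encode _)"] this(2)[of "pr _ (list_encode _)"]
  have ab: "\<And>u c. W A (pr a (pr u (list_encode c))) \<longleftrightarrow> P u c"
    "\<And>u c. W A (pr b (pr u (list_encode c))) \<longleftrightarrow> Q u c"
    by simp_all
  define e where "e = pr a b"
  define F where "F t u c = pr (pr t e) (pr u (list_encode c))" for t u c
  have ty: "ty (F 6 u c) = 2" "ty (F 7 u c) = 1" "ty (F 8 u c) = 2" for u c
    by (simp_all add: F_def ty.simps[of "pr (pr _ e) _"] bty_def)
  have ch: "ch A (F 6 u c) i = (if i = 0 then pr a (pr u (list_encode c)) else F 7 u c)"
    "ch A (F 7 u c) i = F 8 u (i # c)"
    "ch A (F 8 u c) i = (if i = 0 then pr b (pr u (list_encode c)) else F 6 u c)" for u c i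
    by (simp_all add: F_def e_def ch.simps[of A "pr (pr _ _) _"] bch_def list_encode_Cons)
  have F_eq: "F t u c = F t' u' c' \<longleftrightarrow> t = t' \<and> u = u' \<and> c = c'" for t u c t' u' c'
    unfolding F_def pr_eq_iff list_encode_eq by blast
  have 1: "W A (F 6 u c)" if "bar (P u) (Q u) c" for u c
    using that
  proof induction
    case (bar_now c)
    then have "W A (ch A (F 6 u c) 0)" by (simp add: ch ab)
    then show ?case by (rule W_ex[OF ty(1)])
  next
    case (bar_step c)
    have "W A (F 8 u (y # c))" for y
    proof (cases "Q u (y # c)")
      case True
      then have "W A (ch A (F 8 u (y # c)) 0)" by (simp add: ch ab)
      then show ?thesis by (rule W_ex[OF ty(3)])
    next
      case False
      then have "W A (ch A (F 8 u (y # c)) 1)" using bar_step by (auto simp: ch)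
      then show ?thesis by (rule W_ex[OF ty(3)])
    qed
    then have "W A (ch A (F 7 u c) y)" for y by (simp add: ch)
    then have "W A (F 7 u c)" by (rule W_all[OF ty(2)])
    then have "W A (ch A (F 6 u c) 1)" by (simp add: ch)
    then show ?case by (rule W_ex[OF ty(1)])
  qed
  \<comment> \<open>The invariant of the induction on wins, with one part for each phase of the bar.\<close>
  define goal where "goal p \<longleftrightarrow> (\<forall>u c. p = F 6 u c \<longrightarrow> bar (P u) (Q u) c) \<and>
      (\<forall>u c. p = F 7 u c \<longrightarrow> (\<forall>y. Q u (y # c) \<or> bar (P u) (Q u) (y # c))) \<and>
      (\<forall>u c. p = F 8 u c \<longrightarrow> Q u c \<or> bar (P u) (Q u) c)" for p
  have 2: "goal p" if "W A p" for p
    using that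
  proof induction
    case (W_win p)
    have "p \<noteq> F 6 u c" "p \<noteq> F 7 u c" "p \<noteq> F 8 u c" for u c
      using W_win ty[of u c] by auto
    then show ?case unfolding goal_def by blast
  next
    case (W_all p)
    have "p \<noteq> F 6 u c" "p \<noteq> F 8 u c" for u c
      using W_all.hyps(1) ty[of u c] by auto
    moreover have "Q u (y # c) \<or> bar (P u) (Q u) (y # c)" if "p = F 7 u c" for u c y
      using W_all.IH[of y] that unfolding goal_def by (simp add: ch F_eq)
    ultimately show ?case unfolding goal_def by blast
  next
    case (W_ex p i)
    have "p \<noteq> F 7 u c" for u c
      using W_ex.hyps(1) ty[of u c] by auto
    moreover have "bar (P u) (Q u) c" if p: "p = F 6 u c" for u c
    proof (cases "i = 0")
      case True
      then show ?thesis using W_ex.hyps(2) p by (simp add: ch ab bar_now)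
    next
      case False
      then have "\<forall>y. Q u (y # c) \<or> bar (P u) (Q u) (y # c)"
        using W_ex.IH p unfolding goal_def by (simp add: ch F_eq)
      then show ?thesis by (intro bar_step) blast
    qed
    moreover have "Q u c \<or> bar (P u) (Q u) c" if p: "p = F 8 u c" for u c
    proof (cases "i = 0")
      case True
      then show ?thesis using W_ex.hyps(2) p by (simp add: ch ab)
    next
      case False
      then show ?thesis using W_ex.IH p unfolding goal_def by (simp add: ch F_eq)
    qed
    ultimately show ?case unfolding goal_def by blast
  qed
  have "bar (P (p1 z)) (Q (p1 z)) (list_decode (p2 z)) \<longleftrightarrow> W A (pr (pr 6 e) z)" for z
    using 1[of "p1 z" "list_decode (p2 z)"] 2[of "pr (pr 6 e) z"]
    unfolding goal_def F_def by (auto simp: pr_p)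
  then show ?thesis by (rule PiI)
qed

section \<open>Evaluation from partial information about the oracle\<close>

text \<open>The evaluation relation with the oracle replaced by an arbitrary relation between queries and
  answers, by recursion on the functional.  It is monotone and continuous in that relation, which is the use principle.\<close>

primrec Ev :: "functional \<Rightarrow> (nat \<Rightarrow> nat \<Rightarrow> bool) \<Rightarrow> nat list \<Rightarrow> nat \<Rightarrow> bool" where
  "Ev Zero Q xs y = (y = 0)"
| "Ev Succ Q xs y = (\<exists>v. xs = [v] \<and> y = Suc v)"
| "Ev (Proj i) Q xs y = (i < length xs \<and> y = xs ! i)"
| "Ev Oracle Q xs y = (\<exists>v. xs = [v] \<and> Q v y)"
| "Ev (Comp f gs) Q xs y = (\<exists>ys. list_all2 (\<lambda>E v. E Q xs v) (map Ev gs) ys \<and> Ev f Q ys y)"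
| "Ev (PrimRec f g) Q xs y = (\<exists>n zs rs. xs = n # zs \<and> length rs = Suc n \<and> Ev f Q zs (rs ! 0) \<and>
     (\<forall>i<n. Ev g Q (i # rs ! i # zs) (rs ! Suc i)) \<and> y = rs ! n)"
| "Ev (Mu f) Q xs y = (Ev f Q (y # xs) 0 \<and> (\<forall>i<y. \<exists>v. v \<noteq> 0 \<and> Ev f Q (i # xs) v))"

definition full :: "nat set \<Rightarrow> nat \<Rightarrow> nat \<Rightarrow> bool" where
  "full D q b \<longleftrightarrow> b = char_fun D q"

lemma eval_imp_Ev: "eval D \<Phi> xs y \<Longrightarrow> Ev \<Phi> (full D) xs y"
proof (induction rule: eval.induct)
  case (Comp xs gs ys f z)
  then have "list_all2 (\<lambda>E v. E (full D) xs v) (map Ev gs) ys"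
    by (simp add: list_all2_conv_all_nth)
  then show ?case using Comp by auto
next
  case (PrimRec_0 f xs y g)
  then show ?case by (auto intro!: exI[of _ "[y]"])
next
  case (PrimRec_Suc f g n xs r y)
  then obtain rs where rs: "length rs = Suc n" "Ev f (full D) xs (rs ! 0)"
    "\<forall>i<n. Ev g (full D) (i # rs ! i # xs) (rs ! Suc i)" "r = rs ! n"
    by auto
  then have "\<forall>i<Suc n. Ev g (full D) (i # (rs @ [y]) ! i # xs) ((rs @ [y]) ! Suc i)"
    using PrimRec_Suc.IH(2) by (auto simp: nth_append less_Suc_eq)
  then show ?case using rs by (auto simp: nth_append intro!: exI[of _ "rs @ [y]"])
next
  case (Mu f n xs)
  then show ?case by auto
qed (auto simp: full_def)

lemma Ev_imp_eval: "Ev \<Phi> (full D) xs y \<Longrightarrow> eval D \<Phi> xs y"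
proof (induction \<Phi> arbitrary: xs y)
  case (Comp f gs)
  then obtain ys where ys: "list_all2 (\<lambda>E v. E (full D) xs v) (map Ev gs) ys" "Ev f (full D) ys y"
    by auto
  then have "list_all2 (\<lambda>g v. eval D g xs v) gs ys"
    using Comp.IH(2) by (auto simp: list_all2_conv_all_nth)
  then show ?case using Comp.IH(1)[OF ys(2)] by (rule eval.Comp)
next
  case (PrimRec f g)
  then obtain n zs rs where rs: "xs = n # zs" "length rs = Suc n" "Ev f (full D) zs (rs ! 0)"
    "\<forall>i<n. Ev g (full D) (i # rs ! i # zs) (rs ! Suc i)" "y = rs ! n" by auto
  have "eval D (PrimRec f g) (i # zs) (rs ! i)" if "i \<le> n" for i
    using that
  proof (induction i)
    case 0
    show ?case using PrimRec.IH(1)[OF rs(3)] by (rule eval.PrimRec_0)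
  next
    case (Suc i)
    then have "Ev g (full D) (i # rs ! i # zs) (rs ! Suc i)" using rs(4) by simp
    from PrimRec.IH(2)[OF this] show ?case using Suc by (intro eval.PrimRec_Suc) auto
  qed
  then show ?case using rs by simp
next
  case (Mu f)
  then show ?case by (auto intro!: eval.Mu) blast
qed (auto simp: full_def intro: eval.intros)

lemma eval_iff_Ev: "eval D \<Phi> xs y \<longleftrightarrow> Ev \<Phi> (full D) xs y"
  using eval_imp_Ev Ev_imp_eval by blast

lemma Ev_mono: "Ev \<Phi> Q xs y \<Longrightarrow> (\<And>q b. Q q b \<Longrightarrow> R q b) \<Longrightarrow> Ev \<Phi> R xs y"
proof (induction \<Phi> arbitrary: xs y)
  case (Comp f gs)
  then obtain ys where ys: "list_all2 (\<lambda>E v. E Q xs v) (map Ev gs) ys" "Ev f Q ys y"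
    by auto
  then have "list_all2 (\<lambda>E v. E R xs v) (map Ev gs) ys"
    using Comp.IH(2) Comp.prems(2) by (auto simp: list_all2_conv_all_nth)
  moreover have "Ev f R ys y" using Comp.IH(1)[OF ys(2)] Comp.prems(2) by blast
  ultimately show ?case by auto
next
  case (PrimRec f g)
  then obtain n zs rs where rs: "xs = n # zs" "length rs = Suc n" "Ev f Q zs (rs ! 0)"
    "\<forall>i<n. Ev g Q (i # rs ! i # zs) (rs ! Suc i)" "y = rs ! n" by auto
  have "Ev f R zs (rs ! 0)" using PrimRec.IH(1)[OF rs(3)] PrimRec.prems(2) by blast
  moreover have "Ev g R (i # rs ! i # zs) (rs ! Suc i)" if "i < n" for i
    using PrimRec.IH(2)[of "i # rs ! i # zs" "rs ! Suc i"] rs(4) that PrimRec.prems(2) by blast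
  ultimately show ?case using rs by auto
next
  case (Mu f)
  then show ?case by simp metis
qed auto

lemma all_less_mono_ex:
  assumes "\<And>i. i < n \<Longrightarrow> \<exists>k::nat. R k i" and mono: "\<And>i k l. R k i \<Longrightarrow> k \<le> l \<Longrightarrow> R l i"
  shows "\<exists>k. \<forall>i<(n::nat). R k i"
proof -
  from assms(1) obtain f where f: "\<And>i. i < n \<Longrightarrow> R (f i) i" by metis
  have "\<forall>i<n. R (Max (f ` {..n})) i"
    using f mono by (auto intro!: mono[OF f] Max_ge)
  then show ?thesis by blast
qed

text \<open>A converging computation asks finitely many questions, so in an increasing union of answers one
  stage suffices.\<close>

lemma Ev_continuous:
  assumes "Ev \<Phi> Q xs y" and mono: "\<And>k l q b. F k q b \<Longrightarrow> k \<le> l \<Longrightarrow> F l q b"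
    and lim: "\<And>q b. Q q b \<Longrightarrow> \<exists>k::nat. F k q b"
  shows "\<exists>k. Ev \<Phi> (F k) xs y"
proof -
  have up: "Ev \<Phi> (F k) xs y \<Longrightarrow> k \<le> l \<Longrightarrow> Ev \<Phi> (F l) xs y" for \<Phi> k l xs y
    using Ev_mono mono by blast
  show ?thesis using assms(1)
  proof (induction \<Phi> arbitrary: xs y)
    case Oracle
    then show ?case using lim by auto
  next
    case (Comp f gs)
    then obtain ys where ys: "list_all2 (\<lambda>E v. E Q xs v) (map Ev gs) ys" "Ev f Q ys y"
      by auto
    have "\<exists>k. Ev (gs ! i) (F k) xs (ys ! i)" if "i < length gs" for i
      using ys(1) that Comp.IH(2)[of "gs ! i"] by (auto simp: list_all2_conv_all_nth)
    then obtain k where k: "\<forall>i<length gs. Ev (gs ! i) (F k) xs (ys ! i)"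
      using all_less_mono_ex[of "length gs" "\<lambda>k i. Ev (gs ! i) (F k) xs (ys ! i)"] up by blast
    obtain l where l: "Ev f (F l) ys y" using Comp.IH(1)[OF ys(2)] by blast
    have "list_all2 (\<lambda>E v. E (F (max k l)) xs v) (map Ev gs) ys"
      using k ys(1) up[of _ k _ _ "max k l"] by (auto simp: list_all2_conv_all_nth)
    moreover have "Ev f (F (max k l)) ys y" using up[OF l] by simp
    ultimately show ?case by auto
  next
    case (PrimRec f g)
    then obtain n zs rs where rs: "xs = n # zs" "length rs = Suc n" "Ev f Q zs (rs ! 0)"
      "\<forall>i<n. Ev g Q (i # rs ! i # zs) (rs ! Suc i)" "y = rs ! n" by auto
    obtain k where k: "Ev f (F k) zs (rs ! 0)" using PrimRec.IH(1)[OF rs(3)] by blast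
    have "\<exists>k. Ev g (F k) (i # rs ! i # zs) (rs ! Suc i)" if "i < n" for i
      using PrimRec.IH(2) rs(4) that by blast
    then obtain l where l: "\<forall>i<n. Ev g (F l) (i # rs ! i # zs) (rs ! Suc i)"
      using all_less_mono_ex[of n "\<lambda>k i. Ev g (F k) (i # rs ! i # zs) (rs ! Suc i)"] up by blast
    have "Ev f (F (max k l)) zs (rs ! 0)" using up[OF k] by simp
    moreover have "\<forall>i<n. Ev g (F (max k l)) (i # rs ! i # zs) (rs ! Suc i)"
      using l up[of g l _ _ "max k l"] by simp
    ultimately show ?case using rs by auto
  next
    case (Mu f)
    then have "Ev f Q (y # xs) 0" and v: "\<forall>i<y. \<exists>v. v \<noteq> 0 \<and> Ev f Q (i # xs) v" by auto
    then obtain k where k: "Ev f (F k) (y # xs) 0" using Mu.IH by blast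
    have "\<exists>k v. v \<noteq> 0 \<and> Ev f (F k) (i # xs) v" if "i < y" for i
      using v that Mu.IH by blast
    then obtain l where l: "\<forall>i<y. \<exists>v. v \<noteq> 0 \<and> Ev f (F l) (i # xs) v"
      using all_less_mono_ex[of y "\<lambda>k i. \<exists>v. v \<noteq> 0 \<and> Ev f (F k) (i # xs) v"] up by blast
    have "Ev f (F (max k l)) (y # xs) 0" using up[OF k] by simp
    moreover have "\<forall>i<y. \<exists>v. v \<noteq> 0 \<and> Ev f (F (max k l)) (i # xs) v"
      using l up[of f l _ _ "max k l"] by (meson max.cobounded2)
    ultimately show ?case by auto
  qed auto
qed

lemma eval_use:
  assumes "eval D \<Phi> xs y"
  shows "\<exists>l. \<forall>D'. (\<forall>x<l. x \<in> D \<longleftrightarrow> x \<in> D') \<longrightarrow> eval D' \<Phi> xs y"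
proof -
  define F where "F k q b \<longleftrightarrow> q < k \<and> b = char_fun D q" for k q b
  have "\<exists>k. F k q b" if "full D q b" for q b
    using that by (auto simp: F_def full_def)
  then obtain k where k: "Ev \<Phi> (F k) xs y"
    using Ev_continuous[of \<Phi> "full D" xs y F] assms by (auto simp: F_def eval_iff_Ev)
  have "eval D' \<Phi> xs y" if "\<forall>x<k. x \<in> D \<longleftrightarrow> x \<in> D'" for D'
    unfolding eval_iff_Ev by (rule Ev_mono[OF k]) (use that in \<open>auto simp: F_def full_def char_fun_def\<close>)
  then show ?thesis by blast
qed

text \<open>What a finite list tells about a set that extends it by larger elements only.\<close>

definition known :: "nat list \<Rightarrow> nat \<Rightarrow> nat \<Rightarrow> bool" where
  "known c q b \<longleftrightarrow> (q \<in> set c \<and> b = 1) \<or> (q \<notin> set c \<and> (\<exists>z\<in>set c. q < z) \<and> b = 0)"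

lemma known_orc: "known (list_decode c) q b \<longleftrightarrow> orc c q = Suc b"
  unfolding known_def orc by auto

lemma list_decode_eq_Nil: "list_decode c = [] \<longleftrightarrow> c = 0"
  by (metis list_encode_inverse list_decode_inverse list_encode.simps(1))

lemma list_decode_eq_Cons: "list_decode c = y # ys \<longleftrightarrow> (\<exists>d. c = cons1 y d \<and> list_decode d = ys)"
  by (metis list_decode_cons1 list_decode_inverse list_encode_inverse list_encode_Cons)

lemma ex_list_decode: "(\<exists>xs. P xs) \<longleftrightarrow> (\<exists>c. P (list_decode c))"
  by (metis list_encode_inverse)

text \<open>The existential quantifiers in the definition of \<open>Ev\<close> range over numbers and finite lists, and the
  universal ones are bounded; so the closure properties of the class suffice, by recursion on
  the functional.\<close>

lemma Pi_Ev:
  "Tm A f \<Longrightarrow> Tm A g \<Longrightarrow> Tm A h \<Longrightarrow> Pi A (\<lambda>x. Ev \<Phi> (known (list_decode (f x))) (list_decode (g x)) (h x))"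
proof (induction \<Phi> arbitrary: f g h)
  case Zero
  have "Pi A (\<lambda>x. h x = 0)" by (intro pi_intros tm_intros Zero)
  then show ?case by simp
next
  case Succ
  have "Pi A (\<lambda>x. \<exists>v. g x = cons1 v 0 \<and> h x = Suc v)"
    by (intro pi_intros tm_intros Succ Tm_comp[OF Succ(2)] Tm_comp[OF Succ(3)])
  then show ?case by (simp add: list_decode_eq_Cons list_decode_eq_Nil)
next
  case (Proj i)
  have "Pi A (\<lambda>x. i < len1 (g x) \<and> h x = nth1 (g x) i)" by (intro pi_intros tm_intros Proj)
  moreover have "(i < len1 (g x) \<and> h x = nth1 (g x) i) \<longleftrightarrow>
      Ev (Proj i) (known (list_decode (f x))) (list_decode (g x)) (h x)" for x
    by (auto simp: len1 nth1)
  ultimately show ?case by (simp only:)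
next
  case Oracle
  have "Pi A (\<lambda>x. \<exists>v. g x = cons1 v 0 \<and> orc (f x) v = Suc (h x))"
    by (intro pi_intros tm_intros Tm_comp[OF Oracle(1)] Tm_comp[OF Oracle(2)] Tm_comp[OF Oracle(3)])
  then show ?case by (simp add: list_decode_eq_Cons list_decode_eq_Nil known_orc)
next
  case (Comp F gs)
  have gs: "Pi A (\<lambda>x. list_all2 (\<lambda>E v. E (known (list_decode (f x))) (list_decode (g x)) v)
      (map Ev gs) (list_decode (k x)))" if "Tm A f" "Tm A g" "Tm A k" for f g k
    using Comp.IH(2) that
  proof (induction gs arbitrary: f g k)
    case Nil
    have "Pi A (\<lambda>x. k x = 0)" by (intro pi_intros tm_intros Nil)
    then show ?case by (simp add: list_decode_eq_Nil)
  next
    case (Cons G gs)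
    have "Pi A (\<lambda>x. \<exists>y ys. k x = cons1 y ys \<and> Ev G (known (list_decode (f x))) (list_decode (g x)) y \<and>
        list_all2 (\<lambda>E v. E (known (list_decode (f x))) (list_decode (g x)) v) (map Ev gs) (list_decode ys))"
      by (intro pi_intros Cons.IH Cons.prems(1) tm_intros list.set_intros
          Tm_comp[OF Cons.prems(2)] Tm_comp[OF Cons.prems(3)] Tm_comp[OF Cons.prems(4)])
        (simp_all add: Cons.prems(1))
    moreover have "(\<exists>y ys. k x = cons1 y ys \<and> Ev G (known (list_decode (f x))) (list_decode (g x)) y \<and>
        list_all2 (\<lambda>E v. E (known (list_decode (f x))) (list_decode (g x)) v) (map Ev gs) (list_decode ys))
      \<longleftrightarrow> list_all2 (\<lambda>E v. E (known (list_decode (f x))) (list_decode (g x)) v)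
        (map Ev (G # gs)) (list_decode (k x))" for x
      unfolding list.map list_all2_Cons1 list_decode_eq_Cons by blast
    ultimately show ?case by (simp only:)
  qed
  have "Pi A (\<lambda>x. \<exists>ys. list_all2 (\<lambda>E v. E (known (list_decode (f x))) (list_decode (g x)) v)
      (map Ev gs) (list_decode ys) \<and> Ev F (known (list_decode (f x))) (list_decode ys) (h x))"
    by (intro pi_intros gs Comp.IH(1) tm_intros Tm_comp[OF Comp.prems(1)] Tm_comp[OF Comp.prems(2)]
        Tm_comp[OF Comp.prems(3)])
  then show ?case by (simp add: ex_list_decode)
next
  case (PrimRec F G)
  have "Pi A (\<lambda>x. \<exists>n zs rs. g x = cons1 n zs \<and> len1 rs = Suc n \<and>
      Ev F (known (list_decode (f x))) (list_decode zs) (nth1 rs 0) \<and>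
      (\<forall>i<n. Ev G (known (list_decode (f x))) (list_decode (cons1 i (cons1 (nth1 rs i) zs))) (nth1 rs (Suc i)))
      \<and> h x = nth1 rs n)"
    by (intro pi_intros PrimRec.IH tm_intros Tm_comp[OF PrimRec.prems(1)] Tm_comp[OF PrimRec.prems(2)]
        Tm_comp[OF PrimRec.prems(3)])
  moreover have "(\<exists>n zs rs. g x = cons1 n zs \<and> len1 rs = Suc n \<and>
      Ev F (known (list_decode (f x))) (list_decode zs) (nth1 rs 0) \<and>
      (\<forall>i<n. Ev G (known (list_decode (f x))) (list_decode (cons1 i (cons1 (nth1 rs i) zs))) (nth1 rs (Suc i)))
      \<and> h x = nth1 rs n) \<longleftrightarrow> Ev (PrimRec F G) (known (list_decode (f x))) (list_decode (g x)) (h x)" (is "?l \<longleftrightarrow> ?r")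
    for x
  proof -
    have "?l \<longleftrightarrow> (\<exists>n zs rs. g x = cons1 n zs \<and> length (list_decode rs) = Suc n \<and>
      Ev F (known (list_decode (f x))) (list_decode zs) (list_decode rs ! 0) \<and>
      (\<forall>i<n. Ev G (known (list_decode (f x))) (i # list_decode rs ! i # list_decode zs) (list_decode rs ! Suc i))
      \<and> h x = list_decode rs ! n)"
      by (intro ex_cong1 conj_cong refl) (simp_all add: len1 nth1)
    also have "\<dots> \<longleftrightarrow> ?r"
      unfolding Ev.simps list_decode_eq_Cons ex_list_decode[of "\<lambda>rs. _ \<and> length rs = _ \<and> _ rs"] by blast
    finally show ?thesis .
  qed
  ultimately show ?case by (simp only:)
next
  case (Mu F)
  have "Pi A (\<lambda>x. Ev F (known (list_decode (f x))) (list_decode (cons1 (h x) (g x))) 0 \<and>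
      (\<forall>i<h x. \<exists>v. 0 < v \<and> Ev F (known (list_decode (f x))) (list_decode (cons1 i (g x))) v))"
    by (intro pi_intros Mu.IH tm_intros Mu.prems Tm_comp[OF Mu.prems(1)] Tm_comp[OF Mu.prems(2)])
  then show ?case by simp
qed

section \<open>Forced computations and reservoirs\<close>

text \<open>The condition with stem \<open>s\<close> and reservoir \<open>Y\<close> forces \<open>\<Phi>\<close> to give the right answer at \<open>m\<close>.\<close>

definition land :: "nat set \<Rightarrow> functional \<Rightarrow> nat \<Rightarrow> nat list \<Rightarrow> nat set \<Rightarrow> bool" where
  "land A \<Phi> m s Y \<longleftrightarrow> (\<forall>D\<subseteq>Y. infinite D \<longrightarrow> (\<forall>d\<in>D. \<forall>z\<in>set s. z < d) \<longrightarrow>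
     eval (set s \<union> D) \<Phi> [m] (char_fun A m))"

lemma land_subset: "land A \<Phi> m s Y \<Longrightarrow> Y' \<subseteq> Y \<Longrightarrow> land A \<Phi> m s Y'"
  unfolding land_def by (meson subset_trans)

text \<open>The newest entry of the list is not a legitimate continuation of the rest by an element of \<open>Y\<close>.\<close>

definition misses :: "nat set \<Rightarrow> nat list \<Rightarrow> bool" where
  "misses Y c \<longleftrightarrow> (\<exists>y d. c = y # d \<and> (y \<notin> Y \<or> \<not> (\<forall>z\<in>set d. z < y)))"

text \<open>Follow the bar along the elements of a given \<open>D\<close> in increasing order.\<close>

lemma bar_imp_land: "bar (\<lambda>c. Ev \<Phi> (known c) [m] (char_fun A m)) (misses Y) c \<Longrightarrow> land A \<Phi> m c Y"
proof (induction rule: bar.induct)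
  case (bar_now c)
  have "eval (set c \<union> D) \<Phi> [m] (char_fun A m)" if D: "\<forall>d\<in>D. \<forall>z\<in>set c. z < d" for D
    unfolding eval_iff_Ev
  proof (rule Ev_mono[OF bar_now])
    fix q b assume "known c q b"
    then consider "q \<in> set c" "b = 1" | z where "q \<notin> set c" "z \<in> set c" "q < z" "b = 0"
      unfolding known_def by blast
    then show "full (set c \<union> D) q b"
    proof cases
      case 1
      then show ?thesis by (simp add: full_def char_fun_def)
    next
      case 2
      have "q \<notin> D" using D 2 by (meson less_asym)
      then show ?thesis using 2 by (simp add: full_def char_fun_def)
    qed
  qed
  then show ?case unfolding land_def by blast
next
  case (bar_step c)
  have "eval (set c \<union> D) \<Phi> [m] (char_fun A m)"
    if D: "D \<subseteq> Y" "infinite D" "\<forall>d\<in>D. \<forall>z\<in>set c. z < d" for D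
  proof -
    define y where "y = (LEAST y. y \<in> D)"
    have y: "y \<in> D" unfolding y_def using D(2) by (metis LeastI_ex finite.emptyI ex_in_conv)
    have le: "y \<le> d" if "d \<in> D" for d unfolding y_def using that by (rule Least_le)
    have "y \<in> Y" "\<forall>z\<in>set c. z < y" using y D(1,3) by blast+
    then have "\<not> misses Y (y # c)" by (simp add: misses_def)
    then have "land A \<Phi> m (y # c) Y" using bar_step.IH[of y] by blast
    moreover have "D - {y} \<subseteq> Y" "infinite (D - {y})" using D by auto
    moreover have "z < d" if "d \<in> D - {y}" "z \<in> set (y # c)" for d z
    proof (cases "z = y")
      case True
      then show ?thesis using le[of d] that by (simp add: order_less_le)
    next
      case False
      then show ?thesis using D(3) that by simp
    qed
    ultimately have "eval (set (y # c) \<union> (D - {y})) \<Phi> [m] (char_fun A m)"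
      unfolding land_def by blast
    moreover have "set (y # c) \<union> (D - {y}) = set c \<union> D" using y by auto
    ultimately show ?thesis by simp
  qed
  then show ?case unfolding land_def by blast
qed

text \<open>Without a bar there is an infinite increasing sequence in \<open>Y\<close> none of whose initial segments
  makes \<open>\<Phi>\<close> converge to the right value.  By the use principle, neither does the set of its entries.\<close>

lemma land_imp_bar:
  assumes "land A \<Phi> m s Y"
  shows "bar (\<lambda>c. Ev \<Phi> (known c) [m] (char_fun A m)) (misses Y) s" (is "?B s")
proof (rule ccontr)
  assume s: "\<not> ?B s"
  have "\<exists>y. \<not> misses Y (y # c) \<and> \<not> ?B (y # c)" if "\<not> ?B c" for c
    using bar_step that by blast
  then obtain nxt where nxt: "\<And>c. \<not> ?B c \<Longrightarrow> \<not> misses Y (nxt c # c) \<and> \<not> ?B (nxt c # c)"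
    by metis
  define c where "c = rec_nat s (\<lambda>_ d. nxt d # d)"
  define y where "y k = nxt (c k)" for k
  have c: "c 0 = s" "c (Suc k) = y k # c k" for k by (simp_all add: c_def y_def)
  have nB: "\<not> ?B (c k)" for k by (induction k) (use s nxt in \<open>auto simp: c y_def\<close>)
  have y: "y k \<in> Y" "\<forall>z\<in>set (c k). z < y k" for k
    using nxt[OF nB[of k]] by (auto simp: misses_def y_def)
  have set_c: "set (c k) = set s \<union> y ` {..<k}" for k
    by (induction k) (auto simp: c lessThan_Suc)
  have smono: "strict_mono y"
    unfolding strict_mono_Suc_iff using y(2) by (simp add: set_c lessThan_Suc)
  then have inf: "infinite (range y)"
    using finite_imageD strict_mono_imp_inj_on by blast
  have new: "z < y k" if "z \<in> set s" for z k using that y(2)[of k] by (simp add: set_c)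
  have "eval (set s \<union> range y) \<Phi> [m] (char_fun A m)"
    by (rule assms[unfolded land_def, rule_format]) (use inf new y(1) in auto)
  then have ev: "Ev \<Phi> (full (set s \<union> range y)) [m] (char_fun A m)" by (simp add: eval_iff_Ev)
  have "\<exists>k. Ev \<Phi> (known (c k)) [m] (char_fun A m)"
  proof (rule Ev_continuous[OF ev])
    fix k l :: nat and q b
    assume kn: "known (c k) q b" and kl: "k \<le> l"
    have sub: "set (c k) \<subseteq> set (c l)" using kl by (auto simp: set_c)
    have "q \<in> set (c k)" if q: "q \<in> set (c l)" and z: "z \<in> set (c k)" "q < z" for z
    proof (rule ccontr)
      assume nq: "q \<notin> set (c k)"
      with q obtain i where i: "q = y i" by (auto simp: set_c)
      with nq have "k \<le> i" by (force simp: set_c)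
      then have "z < y i" using z(1) y(2)[of i] by (auto simp: set_c)
      then show False using i z(2) by simp
    qed
    then show "known (c l) q b" using kn sub unfolding known_def by blast
  next
    fix q b assume f: "full (set s \<union> range y) q b"
    show "\<exists>k. known (c k) q b"
    proof (cases "q \<in> set s \<union> range y")
      case True
      then obtain k where "q \<in> set (c k)" by (auto simp: set_c)
      then show ?thesis using True f by (auto simp: known_def full_def char_fun_def)
    next
      case False
      have "q < y (Suc q)" using strict_mono_imp_increasing[OF smono, of "Suc q"] by simp
      then have "\<exists>z\<in>set (c (Suc (Suc q))). q < z" by (auto simp: set_c)
      moreover have "q \<notin> set (c (Suc (Suc q)))" using False by (auto simp: set_c)
      ultimately show ?thesis using False f by (auto simp: known_def full_def char_fun_def)
    qed
  qed
  then obtain k where k: "Ev \<Phi> (known (c k)) [m] (char_fun A m)" ..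
  have "?B (c k)" by (rule bar_now) (rule k)
  then show False using nB[of k] by contradiction
qed

text \<open>An index is a pair of codes, one for a predicate in the class and one for its complement.  That
  two given codes are complementary is not a statement of the class, only that at least one of
  the two predicates holds at each argument.  Comparing the times at which they are won turns this into a
  genuine pair of complementary predicates: a number is in the set if the first
  component wins no later than the second.\<close>

definition in_index :: "nat set \<Rightarrow> nat \<Rightarrow> nat \<Rightarrow> bool" where
  "in_index A e x \<longleftrightarrow> L A (pr (p1 e) x) (pr (p2 e) x)"
definition out_index :: "nat set \<Rightarrow> nat \<Rightarrow> nat \<Rightarrow> bool" where
  "out_index A e x \<longleftrightarrow> S A (pr (p2 e) x) (pr (p1 e) x)"
definition valid :: "nat set \<Rightarrow> nat \<Rightarrow> bool" where
  "valid A e \<longleftrightarrow> (\<forall>x. W A (pr (p1 e) x) \<or> W A (pr (p2 e) x))"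
definition set_of :: "nat set \<Rightarrow> nat \<Rightarrow> nat set" where
  "set_of A e = {x. in_index A e x}"

lemma valid_out_index: "valid A e \<Longrightarrow> out_index A e x \<longleftrightarrow> x \<notin> set_of A e"
  unfolding valid_def out_index_def set_of_def in_index_def mem_Collect_eq using L_or_S not_L_S by blast

definition Delta :: "nat set \<Rightarrow> nat set \<Rightarrow> bool" where
  "Delta A Y \<longleftrightarrow> Pi A (\<lambda>x. x \<in> Y) \<and> Pi A (\<lambda>x. x \<notin> Y)"

lemma Delta_set_of:
  assumes "valid A e"
  shows "Delta A (set_of A e)"
proof -
  have "Pi A (in_index A e)" "Pi A (out_index A e)"
    unfolding in_index_def out_index_def by (intro pi_intros tm_intros)+
  moreover have "in_index A e = (\<lambda>x. x \<in> set_of A e)" by (simp add: set_of_def)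
  moreover have "out_index A e = (\<lambda>x. x \<notin> set_of A e)" using valid_out_index[OF assms] by blast
  ultimately show ?thesis unfolding Delta_def by simp
qed

lemma Delta_index:
  assumes "Delta A Y"
  obtains e where "valid A e" "set_of A e = Y"
proof -
  obtain a b where ab: "\<And>x. x \<in> Y \<longleftrightarrow> W A (pr a x)" "\<And>x. x \<notin> Y \<longleftrightarrow> W A (pr b x)"
    using assms unfolding Delta_def Pi_def by blast
  have "valid A (pr a b)" unfolding valid_def p1_pr p2_pr using ab by blast
  moreover have "set_of A (pr a b) = Y"
  proof -
    have "in_index A (pr a b) x \<longleftrightarrow> x \<in> Y" for x
    proof
      assume "in_index A (pr a b) x"
      then show "x \<in> Y" unfolding ab in_index_def by (simp add: L_W)
    next
      assume "x \<in> Y"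
      then have "W A (pr a x)" "\<not> W A (pr b x)" using ab by blast+
      then show "in_index A (pr a b) x" unfolding in_index_def by (simp add: W_before)
    qed
    then show ?thesis unfolding set_of_def by blast
  qed
  ultimately show ?thesis by (rule that)
qed

definition land_index :: "nat set \<Rightarrow> functional \<Rightarrow> nat \<Rightarrow> nat list \<Rightarrow> nat \<Rightarrow> bool" where
  "land_index A \<Phi> m s e \<longleftrightarrow> bar (\<lambda>c. Ev \<Phi> (known c) [m] (char_fun A m))
     (\<lambda>c. \<exists>y d. c = y # d \<and> (out_index A e y \<or> \<not> (\<forall>z\<in>set d. z < y))) s"

lemma land_index: "valid A e \<Longrightarrow> land_index A \<Phi> m s e \<longleftrightarrow> land A \<Phi> m s (set_of A e)"
proof -
  assume "valid A e"
  then have "(\<lambda>c. \<exists>y d. c = y # d \<and> (out_index A e y \<or> \<not> (\<forall>z\<in>set d. z < y))) = misses (set_of A e)"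
    unfolding misses_def by (simp only: valid_out_index)
  then show ?thesis unfolding land_index_def using bar_imp_land land_imp_bar by metis
qed

text \<open>The reservoir enters the bar only through non-membership of entries, which the index provides
  in the class.\<close>

lemma Pi_land_index:
  assumes "Tm A f" "Tm A g" "Tm A h"
  shows "Pi A (\<lambda>x. land_index A \<Phi> (f x) (list_decode (g x)) (h x))"
proof -
  define P where "P u c \<longleftrightarrow> Ev \<Phi> (known c) [p1 u] (char_fun A (p1 u))" for u c
  define Q where "Q u c \<longleftrightarrow> (\<exists>y d. c = y # d \<and> (out_index A (p2 u) y \<or> \<not> (\<forall>z\<in>set d. z < y)))"
    for u c
  have 1: "Pi A (\<lambda>z. P (p1 z) (list_decode (p2 z)))"
  proof -
    have "Pi A (\<lambda>z. Ev \<Phi> (known (list_decode (p2 z))) (list_decode (cons1 (p1 (p1 z)) 0))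
        (char_fun A (p1 (p1 z))))"
      by (intro Pi_Ev tm_intros)
    then show ?thesis by (simp add: P_def)
  qed
  have 2: "Pi A (\<lambda>z. Q (p1 z) (list_decode (p2 z)))"
  proof -
    have "Pi A (\<lambda>z. \<exists>y d. p2 z = cons1 y d \<and> (out_index A (p2 (p1 z)) y \<or> \<not> legal y d))"
      unfolding out_index_def by (intro pi_intros tm_intros)
    moreover have "(\<exists>y d. p2 z = cons1 y d \<and> (out_index A (p2 (p1 z)) y \<or> \<not> legal y d))
        \<longleftrightarrow> Q (p1 z) (list_decode (p2 z))" for z
      unfolding Q_def list_decode_eq_Cons legal by blast
    ultimately show ?thesis by (simp only:)
  qed
  have "Pi A (\<lambda>z. bar (P (p1 z)) (Q (p1 z)) (list_decode (p2 z)))"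
    by (rule Pi_bar[OF 1 2])
  then have "Pi A (\<lambda>x. (\<lambda>z. bar (P (p1 z)) (Q (p1 z)) (list_decode (p2 z)))
      (pr (pr (f x) (h x)) (g x)))"
    by (rule Pi_subst) (intro tm_intros assms)
  then show ?thesis unfolding land_index_def P_def Q_def by (simp only: p1_pr p2_pr)
qed

text \<open>Reservoirs are hyperarithmetic in \<open>A\<close>; this is what makes a choice among them definable.\<close>

definition reservoir :: "nat set \<Rightarrow> nat set \<Rightarrow> bool" where
  "reservoir A Y \<longleftrightarrow> Y \<subseteq> A \<and> infinite Y \<and> Delta A Y"

lemma reservoir_self: "infinite A \<Longrightarrow> reservoir A A"
proof -
  have "Pi A (\<lambda>x. char_fun A x = 1)" "Pi A (\<lambda>x. char_fun A x = 0)"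
    by (intro pi_intros tm_intros)+
  then have "Delta A A" unfolding Delta_def char_fun_def by (simp add: if_split_eq1 cong: if_cong)
  then show "infinite A \<Longrightarrow> reservoir A A" by (simp add: reservoir_def)
qed

lemma reservoir_above:
  assumes "reservoir A Y"
  shows "reservoir A (Y \<inter> {l<..})"
proof -
  have "Pi A (\<lambda>x. x \<in> Y \<and> l < x)" "Pi A (\<lambda>x. x \<notin> Y \<or> x \<le> l)"
    using assms unfolding reservoir_def Delta_def by (intro pi_intros tm_intros; simp)+
  then have "Delta A (Y \<inter> {l<..})" unfolding Delta_def by (simp add: not_less)
  moreover have "infinite (Y \<inter> {l<..})"
  proof -
    have "Y - {..l} = Y \<inter> {l<..}" by auto
    then show ?thesis using assms unfolding reservoir_def by (metis Diff_infinite_finite finite_atMost)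
  qed
  ultimately show ?thesis using assms by (auto simp: reservoir_def)
qed

section \<open>Dependent choice inside the class of reservoirs\<close>

text \<open>Among all \<open>f s\<close> one that is won first, and the least such \<open>s\<close>: this choice is definable by
  comparisons alone.\<close>

lemma best_exists:
  fixes f :: "nat \<Rightarrow> nat"
  assumes "W A (f t)"
  obtains s where "W A (f s)" "\<And>s'. L A (f s) (f s')" "\<And>s'. s' < s \<Longrightarrow> S A (f s) (f s')"
proof -
  define M where "M s \<longleftrightarrow> (\<forall>s'. L A (f s) (f s'))" for s :: nat
  obtain m where m: "m \<in> range f" "\<forall>q\<in>range f. L A m q"
    using L_minimal[OF assms, of "range f"] by blast
  then have "\<exists>s. M s" unfolding M_def by blast
  then have M: "M (LEAST s. M s)" by (rule LeastI_ex)
  define s where "s = (LEAST s. M s)"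
  have s: "L A (f s) (f s')" for s' using M unfolding s_def M_def by blast
  have "S A (f s) (f s')" if "s' < s" for s'
  proof -
    have "\<not> M s'" using that unfolding s_def by (rule not_less_Least)
    then obtain r where r: "\<not> L A (f s') (f r)" unfolding M_def by blast
    have "\<not> L A (f s') (f s)" using L_trans[of A "f s'" "f s" "f r"] s[of r] r by blast
    then show ?thesis using L_or_S[of A "f s'" "f s"] L_W[OF s[of s]] by blast
  qed
  then show ?thesis using that[of s] s L_W[OF s[of s]] by blast
qed

lemma best_unique:
  fixes f :: "nat \<Rightarrow> nat"
  assumes "\<And>s. L A (f a) (f s)" "\<And>s. s < a \<Longrightarrow> S A (f a) (f s)"
    and "\<And>s. L A (f b) (f s)" "\<And>s. s < b \<Longrightarrow> S A (f b) (f s)"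
  shows "a = b"
proof (rule linorder_cases[of a b])
  assume "a < b"
  then have "S A (f b) (f a)" by (rule assms(4))
  then show ?thesis using not_L_S[OF assms(1)[of b]] by blast
next
  assume "b < a"
  then have "S A (f a) (f b)" by (rule assms(2))
  then show ?thesis using not_L_S[OF assms(3)[of a]] by blast
qed

lemma Pi_uniformization:
  assumes "Pi A (\<lambda>z. G (p1 z) (p2 z))"
  obtains B where "Pi A (\<lambda>z. B (p1 z) (p2 z))" "\<And>x y. B x y \<Longrightarrow> G x y"
    "\<And>x y. G x y \<Longrightarrow> \<exists>y. B x y" "\<And>x y y'. B x y \<Longrightarrow> B x y' \<Longrightarrow> y = y'"
proof -
  obtain e where "\<And>z. G (p1 z) (p2 z) \<longleftrightarrow> W A (pr e z)"
    using assms unfolding Pi_def by blast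
  then have e: "G x y \<longleftrightarrow> W A (pr e (pr x y))" for x y by (metis p1_pr p2_pr)
  define B where "B x y \<longleftrightarrow> (\<forall>y'. L A (pr e (pr x y)) (pr e (pr x y')) \<and>
      (y \<le> y' \<or> S A (pr e (pr x y)) (pr e (pr x y'))))" for x y
  show ?thesis
  proof (rule that[of B])
    show "Pi A (\<lambda>z. B (p1 z) (p2 z))" unfolding B_def by (intro pi_intros tm_intros)
    show "G x y" if "B x y" for x y
      using that L_W unfolding B_def e by blast
    show "\<exists>y. B x y" if "G x y" for x y
    proof -
      have "W A ((\<lambda>y. pr e (pr x y)) y)" using that unfolding e .
      then obtain s where "\<And>s'. L A (pr e (pr x s)) (pr e (pr x s'))"
        "\<And>s'. s' < s \<Longrightarrow> S A (pr e (pr x s)) (pr e (pr x s'))"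
        by (rule best_exists) blast
      then have "B x s" unfolding B_def by (meson not_less)
      then show ?thesis ..
    qed
    show "y = y'" if "B x y" "B x y'" for x y y'
      by (rule best_unique[of A "\<lambda>y. pr e (pr x y)"]) (use that in \<open>auto simp: B_def not_le[symmetric]\<close>)
  qed
qed

text \<open>Diagonalization inside the class.  A state consists of the last element chosen and an index of the
  current reservoir.  That a state is a legitimate successor of another is in the class, and
  uniformization makes the successor unique.  Then the whole run is determined, membership in
  its range means that some finite run produces the number, and
  non-membership that some finite run passes it without producing it.\<close>

lemma dependent_choice:
  assumes \<rho>: "Pi A (\<lambda>x. \<rho> (p1 x) (p1 (p2 x)) (p2 (p2 x)))"
    and req: "\<And>n z e. valid A e \<Longrightarrow> \<rho> n z e \<longleftrightarrow> Req n z (set_of A e)"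
    and anti: "\<And>n z Y Y'. Req n z Y \<Longrightarrow> Y' \<subseteq> Y \<Longrightarrow> Req n z Y'"
    and Y0: "reservoir A Y0"
    and step: "\<And>n l Y. reservoir A Y \<Longrightarrow> Y \<subseteq> Y0 \<Longrightarrow>
      \<exists>z\<in>Y. l < z \<and> (\<exists>Y'\<subseteq>Y. reservoir A Y' \<and> Req n z Y')"
  obtains z where "strict_mono z" "range z \<subseteq> Y0" "reservoir A (range z)"
    "\<And>n. Req n (z n) (z ` {n<..})"
proof -
  \<comment> \<open>\<open>t\<close> holds a new element and an index of a smaller reservoir.  Inclusion is expressed as a disjunction since the complement of the one is in the class.\<close>
  define Good where "Good n s t \<longleftrightarrow> valid A (p2 t) \<and> (\<forall>l. \<exists>x. l < x \<and> in_index A (p2 t) x) \<and>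
      (\<forall>x. out_index A (p2 t) x \<or> in_index A (p2 s) x) \<and> in_index A (p2 s) (p1 t) \<and> p1 s < p1 t \<and>
      \<rho> n (p1 t) (p2 t)" for n s t
  have "Pi A (\<lambda>x. (\<lambda>x. \<rho> (p1 x) (p1 (p2 x)) (p2 (p2 x))) (pr (p1 (p1 x)) (p2 x)))"
    by (rule Pi_subst[OF \<rho>]) (intro tm_intros)
  then have \<rho>': "Pi A (\<lambda>x. \<rho> (p1 (p1 x)) (p1 (p2 x)) (p2 (p2 x)))" by simp
  have "Pi A (\<lambda>x. Good (p1 (p1 x)) (p2 (p1 x)) (p2 x))"
    unfolding Good_def valid_def in_index_def out_index_def by (intro pi_intros tm_intros \<rho>')
  then obtain B where B: "Pi A (\<lambda>x. B (p1 x) (p2 x))"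
    and B_Good: "\<And>x t. B x t \<Longrightarrow> Good (p1 x) (p2 x) t"
    and B_ex: "\<And>x t. Good (p1 x) (p2 x) t \<Longrightarrow> \<exists>t. B x t"
    and B_unique: "\<And>x t t'. B x t \<Longrightarrow> B x t' \<Longrightarrow> t = t'"
    by (rule Pi_uniformization[of A "\<lambda>x t. Good (p1 x) (p2 x) t"]) blast
  define Inv where "Inv s \<longleftrightarrow> valid A (p2 s) \<and> set_of A (p2 s) \<subseteq> Y0 \<and> infinite (set_of A (p2 s))" for s
  have Good_YS: "Good n s t \<longleftrightarrow> valid A (p2 t) \<and> infinite (set_of A (p2 t)) \<and> set_of A (p2 t) \<subseteq> set_of A (p2 s) \<and>
      p1 t \<in> set_of A (p2 s) \<and> p1 s < p1 t \<and> Req n (p1 t) (set_of A (p2 t))" for n s t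
  proof (cases "valid A (p2 t)")
    case True
    have "(\<forall>x. out_index A (p2 t) x \<or> in_index A (p2 s) x) \<longleftrightarrow> set_of A (p2 t) \<subseteq> set_of A (p2 s)"
      unfolding valid_out_index[OF True] by (auto simp: set_of_def[of A "p2 s"])
    then show ?thesis using True unfolding Good_def infinite_nat_iff_unbounded req[OF True]
      by (simp add: set_of_def)
  qed (simp add: Good_def)
  have next_ex: "\<exists>t. Inv t \<and> B (pr n s) t" if "Inv s" for n s
  proof -
    have Y: "reservoir A (set_of A (p2 s))" "set_of A (p2 s) \<subseteq> Y0"
      using that Y0 Delta_set_of unfolding Inv_def reservoir_def by blast+
    obtain z Y' where z: "z \<in> set_of A (p2 s)" "p1 s < z" "Y' \<subseteq> set_of A (p2 s)" "reservoir A Y'" "Req n z Y'"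
      using step[OF Y, of "p1 s" n] by blast
    obtain e where "valid A e" "set_of A e = Y'"
      using Delta_index[of A Y'] z(4) unfolding reservoir_def by blast
    then have "Good n s (pr z e)" unfolding Good_YS using z by (simp add: reservoir_def)
    then obtain t where t: "B (pr n s) t" using B_ex[of "pr n s"] by auto
    then have "Good n s t" using B_Good[of "pr n s" t] by simp
    then have "Inv t" using that unfolding Inv_def Good_YS by blast
    then show ?thesis using t by blast
  qed
  obtain e0 where e0: "valid A e0" "set_of A e0 = Y0"
    using Delta_index[of A Y0] Y0 unfolding reservoir_def by blast
  define s0 where "s0 = pr 0 e0"
  have s0: "Inv s0" using e0 Y0 by (simp add: Inv_def s0_def reservoir_def)
  define nx where "nx n s = (SOME t. Inv t \<and> B (pr n s) t)" for n s
  have nx: "Inv (nx n s) \<and> B (pr n s) (nx n s)" if "Inv s" for n s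
    unfolding nx_def using next_ex[OF that] by (rule someI_ex)
  define st where "st = rec_nat s0 nx"
  have st: "st 0 = s0" "st (Suc n) = nx n (st n)" for n by (simp_all add: st_def)
  have inv: "Inv (st n)" for n by (induction n) (simp_all add: st s0 nx)
  have run: "B (pr n (st n)) (st (Suc n))" for n using nx[OF inv] by (simp add: st)
  have good: "Good n (st n) (st (Suc n))" for n using B_Good[OF run[of n]] by simp
  define z where "z n = p1 (st (Suc n))" for n
  have Y: "set_of A (p2 (st (Suc n))) \<subseteq> set_of A (p2 (st n))" "z n \<in> set_of A (p2 (st n))"
    "p1 (st n) < z n" "Req n (z n) (set_of A (p2 (st (Suc n))))" for n
    using good[of n] unfolding Good_YS z_def by blast+
  have anti_Y: "set_of A (p2 (st l)) \<subseteq> set_of A (p2 (st k))" if "k \<le> l" for k l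
    using that by (rule lift_Suc_antimono_le[of "\<lambda>n. set_of A (p2 (st n))", OF Y(1)])
  have mono: "strict_mono z"
    unfolding strict_mono_Suc_iff using Y(3)[of "Suc _"] by (simp add: z_def)
  have zY: "z ` {n<..} \<subseteq> set_of A (p2 (st (Suc n)))" for n
    using Y(2) anti_Y[of "Suc n"] by (auto simp: Suc_le_eq)
  have "range z \<subseteq> set_of A (p2 (st 0))" using Y(2) anti_Y[of 0] by blast
  then have zY0: "range z \<subseteq> Y0" by (simp add: st s0_def e0)
  \<comment> \<open>The number \<open>\<sigma>\<close> codes a run of length at least \<open>N\<close>.\<close>
  define Run where "Run \<sigma> N \<longleftrightarrow> nth1 \<sigma> 0 = s0 \<and> N < len1 \<sigma> \<and>
      (\<forall>i<N. B (pr i (nth1 \<sigma> i)) (nth1 \<sigma> (Suc i)))" for \<sigma> N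
  have Run_st: "nth1 \<sigma> i = st i" if "Run \<sigma> N" "i \<le> N" for \<sigma> N i
    using that(2)
  proof (induction i)
    case 0
    then show ?case using that(1) by (simp add: Run_def st)
  next
    case (Suc i)
    then have "B (pr i (st i)) (nth1 \<sigma> (Suc i))" using that(1) by (simp add: Run_def Suc_le_eq) metis
    then show ?case using run B_unique by blast
  qed
  have Run_ex: "\<exists>\<sigma>. Run \<sigma> N" for N
  proof
    show "Run (list_encode (map st [0..<Suc N])) N"
      using run by (simp add: Run_def nth1 len1 st nth_append del: upt_Suc)
  qed
  have Pi_Run: "Pi A (\<lambda>x. Run (f x) (g x))" if "Tm A f" "Tm A g" for f g
  proof -
    have B': "Pi A (\<lambda>x. B (h x) (k x))" if "Tm A h" "Tm A k" for h k
      using Pi_subst[OF B Tm_pr[OF that]] by simp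
    show ?thesis unfolding Run_def
      by (intro pi_intros tm_intros B' that Tm_comp[OF that(1)])
  qed
  have "Pi A (\<lambda>x. \<exists>\<sigma> N. Run \<sigma> (Suc N) \<and> p1 (nth1 \<sigma> (Suc N)) = x)"
    by (intro pi_intros tm_intros Pi_Run)
  moreover have "(\<exists>\<sigma> N. Run \<sigma> (Suc N) \<and> p1 (nth1 \<sigma> (Suc N)) = x) \<longleftrightarrow> x \<in> range z" for x
  proof
    assume "\<exists>\<sigma> N. Run \<sigma> (Suc N) \<and> p1 (nth1 \<sigma> (Suc N)) = x"
    then obtain \<sigma> N where "Run \<sigma> (Suc N)" "p1 (nth1 \<sigma> (Suc N)) = x" by blast
    then have "x = z N" using Run_st[of \<sigma> "Suc N" "Suc N"] by (simp add: z_def)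
    then show "x \<in> range z" by blast
  next
    assume "x \<in> range z"
    then obtain N where N: "x = z N" by blast
    obtain \<sigma> where "Run \<sigma> (Suc N)" using Run_ex by blast
    then show "\<exists>\<sigma> N. Run \<sigma> (Suc N) \<and> p1 (nth1 \<sigma> (Suc N)) = x"
      using Run_st[of \<sigma> "Suc N" "Suc N"] N by (intro exI[of _ \<sigma>] exI[of _ N]) (simp add: z_def)
  qed
  ultimately have "Pi A (\<lambda>x. x \<in> range z)" by (simp only:)
  moreover have "Pi A (\<lambda>x. \<exists>\<sigma> N. Run \<sigma> (Suc N) \<and> x < p1 (nth1 \<sigma> (Suc N)) \<and>
      (\<forall>i<N. p1 (nth1 \<sigma> (Suc i)) < x \<or> x < p1 (nth1 \<sigma> (Suc i))))"
    by (intro pi_intros tm_intros Pi_Run)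
  moreover have "(\<exists>\<sigma> N. Run \<sigma> (Suc N) \<and> x < p1 (nth1 \<sigma> (Suc N)) \<and>
      (\<forall>i<N. p1 (nth1 \<sigma> (Suc i)) < x \<or> x < p1 (nth1 \<sigma> (Suc i)))) \<longleftrightarrow> x \<notin> range z" for x
  proof
    assume "\<exists>\<sigma> N. Run \<sigma> (Suc N) \<and> x < p1 (nth1 \<sigma> (Suc N)) \<and>
      (\<forall>i<N. p1 (nth1 \<sigma> (Suc i)) < x \<or> x < p1 (nth1 \<sigma> (Suc i)))"
    then obtain \<sigma> N where r: "Run \<sigma> (Suc N)" and x: "x < p1 (nth1 \<sigma> (Suc N))"
      "\<forall>i<N. p1 (nth1 \<sigma> (Suc i)) < x \<or> x < p1 (nth1 \<sigma> (Suc i))" by blast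
    have "x < z N" using x(1) Run_st[OF r] by (simp add: z_def)
    moreover have "z i \<noteq> x" if "i < N" for i
      using x(2) that Run_st[OF r, of "Suc i"] by (force simp: z_def)
    ultimately show "x \<notin> range z"
      using strict_mono_less[OF mono] by (metis imageE)
  next
    assume x: "x \<notin> range z"
    obtain \<sigma> where r: "Run \<sigma> (Suc (Suc x))" using Run_ex by blast
    have "x < z (Suc x)" using strict_mono_imp_increasing[OF mono, of "Suc x"] by simp
    moreover have "z i < x \<or> x < z i" for i using x by (metis nat_neq_iff rangeI)
    ultimately show "\<exists>\<sigma> N. Run \<sigma> (Suc N) \<and> x < p1 (nth1 \<sigma> (Suc N)) \<and>
      (\<forall>i<N. p1 (nth1 \<sigma> (Suc i)) < x \<or> x < p1 (nth1 \<sigma> (Suc i)))"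
      using r Run_st[OF r] by (intro exI[of _ \<sigma>] exI[of _ "Suc x"]) (simp add: z_def)
  qed
  ultimately have "Delta A (range z)" unfolding Delta_def by (simp only:)
  moreover have "infinite (range z)"
    using mono finite_imageD strict_mono_imp_inj_on by blast
  ultimately have "reservoir A (range z)" using zY0 Y0 by (auto simp: reservoir_def)
  with mono zY0 show ?thesis
    by (rule that) (rule anti[OF Y(4) zY])
qed

section \<open>Landing and rejecting: the Mathias argument\<close>

text \<open>No stronger condition with the same stem forces the right answer at \<open>m\<close>.\<close>

definition reject :: "nat set \<Rightarrow> functional \<Rightarrow> nat \<Rightarrow> nat list \<Rightarrow> nat set \<Rightarrow> bool" where
  "reject A \<Phi> m s Y \<longleftrightarrow> (\<forall>Y'. Y' \<subseteq> Y \<longrightarrow> reservoir A Y' \<longrightarrow> \<not> land A \<Phi> m s Y')"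

lemma reject_subset: "reject A \<Phi> m s Y \<Longrightarrow> Y' \<subseteq> Y \<Longrightarrow> reject A \<Phi> m s Y'"
  unfolding reject_def by (meson subset_trans)

lemma reservoir_above_list:
  assumes "reservoir A Y"
  obtains Y' where "reservoir A Y'" "Y' \<subseteq> Y" "\<And>y z. y \<in> Y' \<Longrightarrow> z \<in> set s \<Longrightarrow> z < y"
proof (rule that[of "Y \<inter> {Max (insert 0 (set s))<..}"])
  show "z < y" if "y \<in> Y \<inter> {Max (insert 0 (set s))<..}" "z \<in> set s" for y z
    using that Max_ge[of "insert 0 (set s)" z] by simp
qed (use reservoir_above[OF assms] in auto)

text \<open>The least element of \<open>D\<close> is some \<open>z n\<close>, and the hypothesis for \<open>n\<close> applies to the rest of \<open>D\<close>.\<close>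

lemma land_from_extensions:
  fixes z :: "nat \<Rightarrow> nat"
  assumes "strict_mono z" "\<And>n. land A \<Phi> m (z n # s) (z ` {n<..})"
  shows "land A \<Phi> m s (range z)"
  unfolding land_def
proof (intro allI impI)
  fix D assume D: "D \<subseteq> range z" "infinite D" "\<forall>d\<in>D. \<forall>y\<in>set s. y < d"
  define n where "n = (LEAST n. z n \<in> D)"
  have "\<exists>n. z n \<in> D" using D(1,2) by (metis finite.emptyI image_iff subsetD ex_in_conv)
  then have n: "z n \<in> D" unfolding n_def by (rule LeastI_ex[of "\<lambda>n. z n \<in> D"])
  have le: "n \<le> k" if "z k \<in> D" for k unfolding n_def using that by (rule Least_le)
  have sub: "D - {z n} \<subseteq> z ` {n<..}"
  proof
    fix d assume d: "d \<in> D - {z n}"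
    then obtain k where k: "d = z k" using D(1) by blast
    then have "n < k" using le[of k] d by (metis DiffE le_neq_implies_less singletonI)
    then show "d \<in> z ` {n<..}" using k by simp
  qed
  have "eval (set (z n # s) \<union> (D - {z n})) \<Phi> [m] (char_fun A m)"
  proof (rule assms(2)[of n, unfolded land_def, rule_format, OF sub])
    show "infinite (D - {z n})" using D(2) by simp
    fix d y assume d: "d \<in> D - {z n}" and y: "y \<in> set (z n # s)"
    obtain k where k: "d = z k" "n < k" using d sub by auto
    show "y < d"
    proof (cases "y = z n")
      case True
      then show ?thesis using k assms(1) by (simp add: strict_mono_less)
    next
      case False
      then show ?thesis using D(3) d y by simp
    qed
  qed
  moreover have "set (z n # s) \<union> (D - {z n}) = set s \<union> D" using n by auto
  ultimately show "eval (set s \<union> D) \<Phi> [m] (char_fun A m)" by simp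
qed

text \<open>Rejection is preserved when the stem grows, on a smaller reservoir.  Otherwise every smaller
  reservoir contains, arbitrarily far out, an element \<open>y\<close> such that \<open>y # s\<close> can be made to land.
  Choosing such elements successively, each time with the reservoir for the rest, gives a
  reservoir on which \<open>s\<close> itself lands.\<close>

lemma reject_extend:
  assumes "reservoir A Y" and rej: "reject A \<Phi> m s Y"
  shows "\<exists>Y'\<subseteq>Y. reservoir A Y' \<and> (\<forall>y\<in>Y'. reject A \<Phi> m (y # s) Y')"
proof (rule ccontr)
  assume no: "\<not> ?thesis"
  have "Pi A (\<lambda>x. land_index A \<Phi> m (list_decode (cons1 (p1 (p2 x)) (list_encode s))) (p2 (p2 x)))"
    by (intro Pi_land_index tm_intros)
  then have Pi: "Pi A (\<lambda>x. (\<lambda>n z e. land_index A \<Phi> m (z # s) e) (p1 x) (p1 (p2 x)) (p2 (p2 x)))"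
    by simp
  obtain z :: "nat \<Rightarrow> nat" where z: "strict_mono z" "range z \<subseteq> Y" "reservoir A (range z)"
    "\<And>n. land A \<Phi> m (z n # s) (z ` {n<..})"
  proof (rule dependent_choice[OF Pi])
    fix n l X assume X: "reservoir A X" "X \<subseteq> Y"
    have "reservoir A (X \<inter> {l<..})" "X \<inter> {l<..} \<subseteq> Y" using reservoir_above[OF X(1)] X(2) by auto
    then obtain y where "y \<in> X \<inter> {l<..}" "\<not> reject A \<Phi> m (y # s) (X \<inter> {l<..})"
      using no by blast
    then show "\<exists>z\<in>X. l < z \<and> (\<exists>Y'\<subseteq>X. reservoir A Y' \<and> land A \<Phi> m (z # s) Y')"
      unfolding reject_def by auto
  qed (use assms(1) land_index land_subset in auto)
  then show False using land_from_extensions[OF z(1,4)] rej unfolding reject_def by blast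
qed

lemma reject_extend_all:
  assumes "reservoir A Y" and "\<forall>(\<Phi>, m)\<in>set rs. reject A \<Phi> m s Y"
  shows "\<exists>Y'\<subseteq>Y. reservoir A Y' \<and> (\<forall>(\<Phi>, m)\<in>set rs. \<forall>y\<in>Y'. reject A \<Phi> m (y # s) Y')"
  using assms(2)
proof (induction rs)
  case Nil
  then show ?case using assms(1) by auto
next
  case (Cons r rs)
  obtain \<Phi> m where r: "r = (\<Phi>, m)" by (cases r)
  obtain Y1 where Y1: "Y1 \<subseteq> Y" "reservoir A Y1"
    "\<forall>(\<Phi>, m)\<in>set rs. \<forall>y\<in>Y1. reject A \<Phi> m (y # s) Y1"
    using Cons by auto
  have "reject A \<Phi> m s Y" using Cons.prems r by simp
  then have "reject A \<Phi> m s Y1" using Y1(1) by (rule reject_subset)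
  from reject_extend[OF Y1(2) this]
  obtain Y2 where Y2: "Y2 \<subseteq> Y1" "reservoir A Y2" "\<forall>y\<in>Y2. reject A \<Phi> m (y # s) Y2" by blast
  have "reject A \<Psi> k (y # s) Y2" if "(\<Psi>, k) \<in> set rs" "y \<in> Y2" for \<Psi> k y
  proof (rule reject_subset[OF _ Y2(1)])
    show "reject A \<Psi> k (y # s) Y1" using Y1(3) that Y2(1) by blast
  qed
  then have "\<forall>(\<Phi>, m)\<in>set (r # rs). \<forall>y\<in>Y2. reject A \<Phi> m (y # s) Y2"
    using Y2(3) r by auto
  moreover have "Y2 \<subseteq> Y" using Y1(1) Y2(1) by (rule subset_trans[rotated])
  ultimately show ?case using Y2(2) by (intro exI[of _ Y2] conjI)
qed

text \<open>The \<open>n\<close>-th choice only has to shrink the reservoir to one that lands at \<open>n\<close>; the element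
  chosen is arbitrary, since the stem stays the same.\<close>

lemma success_if_never_rejected:
  assumes "reservoir A Y" and no: "\<And>m Y'. reservoir A Y' \<Longrightarrow> Y' \<subseteq> Y \<Longrightarrow> \<not> reject A \<Phi> m s Y'"
  obtains z :: "nat \<Rightarrow> nat" where "strict_mono z" "reservoir A (range z)" "\<And>k y. y \<in> set s \<Longrightarrow> y < z k"
    "\<And>n. land A \<Phi> n s (z ` {n<..})"
proof -
  obtain Y1 where Y1: "reservoir A Y1" "Y1 \<subseteq> Y" "\<And>y z. y \<in> Y1 \<Longrightarrow> z \<in> set s \<Longrightarrow> z < y"
    using reservoir_above_list[OF assms(1)] by metis
  have "Pi A (\<lambda>x. land_index A \<Phi> (p1 x) (list_decode (list_encode s)) (p2 (p2 x)))"
    by (intro Pi_land_index tm_intros)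
  then have Pi: "Pi A (\<lambda>x. (\<lambda>n z e. land_index A \<Phi> n s e) (p1 x) (p1 (p2 x)) (p2 (p2 x)))"
    by simp
  obtain z :: "nat \<Rightarrow> nat" where z: "strict_mono z" "range z \<subseteq> Y1" "reservoir A (range z)"
    "\<And>n. land A \<Phi> n s (z ` {n<..})"
  proof (rule dependent_choice[OF Pi])
    fix n l X assume X: "reservoir A X" "X \<subseteq> Y1"
    have r: "reservoir A (X \<inter> {l<..})" using reservoir_above[OF X(1)] .
    then have "\<not> reject A \<Phi> n s (X \<inter> {l<..})" using X(2) Y1(2) by (intro no) auto
    moreover obtain z where "z \<in> X \<inter> {l<..}"
      using r unfolding reservoir_def by (metis ex_in_conv finite.emptyI)
    ultimately show "\<exists>z\<in>X. l < z \<and> (\<exists>Y'\<subseteq>X. reservoir A Y' \<and> land A \<Phi> n s Y')"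
      unfolding reject_def by auto
  qed (use Y1(1) land_index land_subset in auto)
  have "y < z k" if "y \<in> set s" for k y using Y1(3) z(2) that by blast
  then show ?thesis using that[OF z(1,3) _ z(4)] by blast
qed

instance functional :: countable
  by countable_datatype

text \<open>If every condition had, for every functional, a smaller reservoir that rejects some argument, then
  a construction in stages could reject all functionals one after the other while the stem
  grows.  A functional that computes \<open>A\<close> from the union of the stems uses only a finite part of it, so it lands
  at a later stage, where the chosen argument is still rejected.\<close>

lemma success_exists:
  assumes A: "infinite A" "introreducible A"
  obtains \<Phi> s and z :: "nat \<Rightarrow> nat" where "strict_mono z" "reservoir A (range z)" "\<And>k y. y \<in> set s \<Longrightarrow> y < z k"
    "\<And>n. land A \<Phi> n s (z ` {n<..})"
proof (rule ccontr)
  assume "\<not> thesis"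
  with that have "\<exists>m Y'. reservoir A Y' \<and> Y' \<subseteq> Y \<and> reject A \<Phi> m s Y'" if "reservoir A Y" for \<Phi> s Y
    using success_if_never_rejected[OF \<open>reservoir A Y\<close>, of \<Phi> s] by metis
  note rejected = this
  \<comment> \<open>A state consists of the stem, the reservoir and the list of pairs, a functional and an argument, rejected so far.\<close>
  define good where "good s Y rs \<longleftrightarrow> reservoir A Y \<and> (\<forall>y\<in>Y. \<forall>x\<in>set s. x < y) \<and>
      (\<forall>(\<Phi>, m)\<in>set rs. reject A \<Phi> m s Y)" for s Y rs
  have "\<exists>f. \<forall>i. (\<lambda>i (s, Y, rs). good s Y rs \<and> (i = 0 \<longrightarrow> s = [])) i (f i) \<and>
      (\<lambda>i (s, Y, rs) (s', Y', rs'). \<exists>y m. y \<in> Y \<and> s' = y # s \<and> rs' = (from_nat i, m) # rs \<and> Y' \<subseteq> Y)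
        i (f i) (f (Suc i))"
  proof (rule dependent_nat_choice)
    show "\<exists>x. (\<lambda>(s, Y, rs). good s Y rs \<and> ((0 :: nat) = 0 \<longrightarrow> s = [])) x"
      using reservoir_self[OF A(1)] by (intro exI[of _ "([], A, [])"]) (simp add: good_def)
  next
    fix x and i :: nat assume "(\<lambda>(s, Y, rs). good s Y rs \<and> (i = 0 \<longrightarrow> s = [])) x"
    then obtain s Y rs where x: "x = (s, Y, rs)" and g: "good s Y rs" by (cases x) auto
    have "reservoir A Y" using g by (simp add: good_def)
    from rejected[OF this, where \<Phi> = "from_nat i" and s = s]
    obtain m Y1 where Y1: "reservoir A Y1" "Y1 \<subseteq> Y" "reject A (from_nat i) m s Y1" by blast
    have "reject A \<Phi> m s Y1" if "(\<Phi>, m) \<in> set rs" for \<Phi> m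
      by (rule reject_subset[OF _ Y1(2)]) (use g that in \<open>auto simp: good_def\<close>)
    then have "\<forall>(\<Phi>, m)\<in>set ((from_nat i, m) # rs). reject A \<Phi> m s Y1"
      using Y1(3) by auto
    from reject_extend_all[OF Y1(1) this]
    obtain Y2 where Y2: "Y2 \<subseteq> Y1" "reservoir A Y2"
      "\<forall>(\<Phi>, m)\<in>set ((from_nat i, m) # rs). \<forall>y\<in>Y2. reject A \<Phi> m (y # s) Y2" by blast
    obtain y where y: "y \<in> Y2" using Y2(2) unfolding reservoir_def by (metis ex_in_conv finite.emptyI)
    have "good (y # s) (Y2 \<inter> {y<..}) ((from_nat i, m) # rs)"
      unfolding good_def
    proof (intro conjI)
      show "reservoir A (Y2 \<inter> {y<..})" by (rule reservoir_above[OF Y2(2)])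
      show "\<forall>y'\<in>Y2 \<inter> {y<..}. \<forall>x\<in>set (y # s). x < y'"
      proof (intro ballI)
        fix y' x assume y': "y' \<in> Y2 \<inter> {y<..}" and x: "x \<in> set (y # s)"
        show "x < y'"
        proof (cases "x = y")
          case False
          then show ?thesis using g Y1(2) Y2(1) y' x unfolding good_def by auto
        qed (use y' in simp)
      qed
      have "Y2 \<inter> {y<..} \<subseteq> Y2" by blast
      then have "reject A \<Phi> k (y # s) (Y2 \<inter> {y<..})"
        if "(\<Phi>, k) \<in> set ((from_nat i, m) # rs)" for \<Phi> k
        using reject_subset[of A \<Phi> k "y # s" Y2] Y2(3) y that by blast
      then show "\<forall>(\<Phi>, m)\<in>set ((from_nat i, m) # rs). reject A \<Phi> m (y # s) (Y2 \<inter> {y<..})"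
        by blast
    qed
    moreover have "y \<in> Y" "Y2 \<inter> {y<..} \<subseteq> Y" using y Y1(2) Y2(1) by auto
    ultimately show "\<exists>x'. (\<lambda>(s, Y, rs). good s Y rs \<and> (Suc i = 0 \<longrightarrow> s = [])) x' \<and>
        (\<lambda>(s, Y, rs) (s', Y', rs'). \<exists>y m. y \<in> Y \<and> s' = y # s \<and> rs' = (from_nat i, m) # rs \<and> Y' \<subseteq> Y) x x'"
      unfolding x by (intro exI[of _ "(y # s, Y2 \<inter> {y<..}, (from_nat i, m) # rs)"]) auto
  qed
  then obtain f where f0: "\<forall>i. (\<lambda>(s, Y, rs). good s Y rs \<and> (i = 0 \<longrightarrow> s = [])) (f i) \<and>
      (\<lambda>(s, Y, rs) (s', Y', rs'). \<exists>y m. y \<in> Y \<and> s' = y # s \<and> rs' = (from_nat i, m) # rs \<and> Y' \<subseteq> Y)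
        (f i) (f (Suc i))" by (rule exE)
  note f = spec[OF f0]
  define s where "s i = fst (f i)" for i
  define Y where "Y i = fst (snd (f i))" for i
  define rs where "rs i = snd (snd (f i))" for i
  have good: "good (s i) (Y i) (rs i)" and s0: "s 0 = []" for i
    using f[THEN conjunct1, of i] f[THEN conjunct1, of 0] by (simp_all add: s_def Y_def rs_def split: prod.splits)
  have "\<exists>y m. y \<in> Y i \<and> s (Suc i) = y # s i \<and> rs (Suc i) = (from_nat i, m) # rs i \<and> Y (Suc i) \<subseteq> Y i" for i
    using f[THEN conjunct2, of i] by (simp add: s_def Y_def rs_def split: prod.splits)
  then obtain y m where st: "\<And>i. y i \<in> Y i" "\<And>i. s (Suc i) = y i # s i"
    "\<And>i. rs (Suc i) = (from_nat i, m i) # rs i" "\<And>i. Y (Suc i) \<subseteq> Y i" by metis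
  have set_s: "set (s j) = set (s i) \<union> y ` {i..<j}" if "i \<le> j" for i j
    using that by (induction j rule: dec_induct) (auto simp: st(2) atLeastLessThanSuc)
  have below: "x < d" if "x \<in> set (s i)" "d \<in> Y i" for x d i
    using good[of i] that unfolding good_def by blast
  have mono: "strict_mono y"
    unfolding strict_mono_Suc_iff using below[OF _ st(1)[of "Suc _"]] by (simp add: st(2))
  define D where "D = range y"
  have "infinite D" unfolding D_def using mono finite_imageD strict_mono_imp_inj_on by blast
  moreover have "D \<subseteq> A" using st(1) good unfolding D_def good_def reservoir_def by blast
  ultimately obtain \<Phi> where \<Phi>: "computes \<Phi> D A"
    using A(2) unfolding introreducible_def inf_subsets_def turing_le_def by blast
  obtain i where i: "from_nat i = \<Phi>" using surj_from_nat by (metis surjD)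
  obtain l where l: "\<And>D'. \<forall>x<l. x \<in> D \<longleftrightarrow> x \<in> D' \<Longrightarrow> eval D' \<Phi> [m i] (char_fun A (m i))"
    using eval_use[of D \<Phi> "[m i]"] \<Phi> unfolding computes_def by blast
  \<comment> \<open>By then the functional has been treated, and the stem has passed the part of the oracle that was used.\<close>
  define k where "k = Suc (max i l)"
  have k: "Suc i \<le> k" "Suc l \<le> k" by (simp_all add: k_def)
  have "(\<Phi>, m i) \<in> set (rs k)" using k(1)
    by (induction k rule: dec_induct) (auto simp: st(3) i)
  then have "reject A \<Phi> (m i) (s k) (Y k)" "reservoir A (Y k)" using good[of k] unfolding good_def by auto
  moreover have "land A \<Phi> (m i) (s k) (Y k)"
    unfolding land_def
  proof (intro allI impI, rule l, intro allI impI)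
    fix D' x assume D': "D' \<subseteq> Y k" and x: "x < l"
    have "y l \<in> set (s k)" using set_s[of "Suc l" k] k(2) by (simp add: st(2))
    then have "y l < d" if "d \<in> D'" for d using below D' that by blast
    moreover have l_le: "j \<le> y j" for j using strict_mono_imp_increasing[OF mono] .
    ultimately have "x \<notin> D'" using x by (meson le_less_trans less_asym)
    moreover have "x \<in> set (s k) \<longleftrightarrow> x \<in> D"
    proof
      assume "x \<in> D"
      then obtain j where "x = y j" unfolding D_def by blast
      then have "x = y j" "j < k" using l_le[of j] x k(2) by auto
      then show "x \<in> set (s k)" using set_s[of 0 k] by auto
    next
      assume "x \<in> set (s k)"
      then have "x \<in> set (s 0) \<or> x \<in> D" using set_s[of 0 k] unfolding D_def by auto
      then show "x \<in> D" by (simp add: s0)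
    qed
    ultimately show "x \<in> D \<longleftrightarrow> x \<in> set (s k) \<union> D'" by blast
  qed
  ultimately show False unfolding reject_def by blast
qed

section \<open>A uniformly introreducible subset\<close>

text \<open>The functional \<open>add_param h \<Phi> k\<close> runs \<open>\<Phi>\<close> on \<open>k\<close> arguments with a simulated oracle that depends
  on a parameter.  The parameter is carried along as an additional last argument, so that the
  positions of the other arguments do not change, and \<open>h\<close> answers the queries.  As terms carry no
  arities, the number of arguments has to be supplied.\<close>

primrec add_param :: "functional \<Rightarrow> functional \<Rightarrow> nat \<Rightarrow> functional" where
  "add_param h Zero k = Zero"
| "add_param h Succ k = Comp Succ [Proj 0]"
| "add_param h (Proj i) k = Proj i"
| "add_param h Oracle k = h"
| "add_param h (Comp f gs) k = Comp (add_param h f (length gs)) (map (\<lambda>F. F k) (map (add_param h) gs) @ [Proj k])"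
| "add_param h (PrimRec f g) k = PrimRec (add_param h f (k - 1)) (add_param h g (Suc k))"
| "add_param h (Mu f) k = Mu (add_param h f (Suc k))"

lemma eval_add_param:
  assumes h: "\<And>q. eval D h [q, n] (char_fun E q)"
  shows "eval E \<Phi> xs y \<Longrightarrow> eval D (add_param h \<Phi> (length xs)) (xs @ [n]) y"
proof (induction rule: eval.induct)
  case (Succ x)
  show ?case using eval_Comp1[OF eval_Proj0 eval.Succ] by simp
next
  case (Proj i xs)
  then have "i < length (xs @ [n])" "(xs @ [n]) ! i = xs ! i" by (simp_all add: nth_append)
  then show ?case using eval.Proj[of i "xs @ [n]" D] by simp
next
  case (Oracle x)
  show ?case using h by simp
next
  case (Comp xs gs ys f z)
  have len: "length gs = length ys" using Comp.IH(1) by (rule list_all2_lengthD)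
  have "eval D (Proj (length xs)) (xs @ [n]) n"
    using eval.Proj[of "length xs" "xs @ [n]" D] by simp
  moreover have "list_all2 (\<lambda>g y. eval D g (xs @ [n]) y) (map (\<lambda>F. F (length xs)) (map (add_param h) gs)) ys"
    using Comp.IH(1) by (auto simp: list_all2_conv_all_nth)
  ultimately have "list_all2 (\<lambda>g y. eval D g (xs @ [n]) y)
      (map (\<lambda>F. F (length xs)) (map (add_param h) gs) @ [Proj (length xs)]) (ys @ [n])"
    by (intro list_all2_appendI) auto
  then show ?case unfolding add_param.simps len by (rule eval.Comp[OF _ Comp.IH(2)])
next
  case (PrimRec_0 f xs y g)
  then show ?case by (simp add: eval.PrimRec_0)
next
  case (PrimRec_Suc f g m xs r y)
  then show ?case by (simp add: eval.PrimRec_Suc)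
next
  case (Mu f m xs)
  have "eval D (add_param h f (Suc (length xs))) (m # (xs @ [n])) 0" using Mu.IH(1) by simp
  moreover have "\<forall>i<m. \<exists>y. y \<noteq> 0 \<and> eval D (add_param h f (Suc (length xs))) (i # (xs @ [n])) y"
    using Mu.IH(2) by auto
  ultimately show ?case unfolding add_param.simps by (rule eval.Mu)
qed (simp add: eval.Zero)

lemma cmp_with_computed_oracle:
  assumes "cmp2 \<D> (\<lambda>D q n. char_fun (E D n) q)"
    and "\<And>D n. D \<in> \<D> \<Longrightarrow> eval (E D n) \<Phi> [n] (f D n)"
  shows "cmp \<D> f"
proof -
  obtain h where h: "\<And>D q n. D \<in> \<D> \<Longrightarrow> eval D h [q, n] (char_fun (E D n) q)"
    using assms(1) unfolding cmp2_def by blast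
  have "eval D (Comp (add_param h \<Phi> (Suc 0)) [Proj 0, Proj 0]) [n] (f D n)" if "D \<in> \<D>" for D n
    using eval_add_param[OF h[OF that] assms(2)[OF that], of n]
    by (intro eval_Comp2[OF eval_Proj0 eval_Proj0]) simp
  then show ?thesis unfolding cmp_def by blast
qed

text \<open>An element \<open>z k\<close> of \<open>D\<close> has at most \<open>k\<close> predecessors in \<open>D\<close>; so elements with more than \<open>n\<close> of them have
  an index above \<open>n\<close>, and this can be recognized from \<open>D\<close> alone.\<close>

lemma drop_inf_subset:
  fixes z :: "nat \<Rightarrow> nat" and n :: nat
  assumes z: "strict_mono z" and D: "D \<subseteq> range z" "infinite D"
  defines "D' \<equiv> {d \<in> D. n < card {i. i < d \<and> i \<in> D}}"
  shows "D' \<subseteq> z ` {n<..}" and "infinite D'"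
proof -
  show "D' \<subseteq> z ` {n<..}"
  proof
    fix d assume d: "d \<in> D'"
    then obtain k where k: "d = z k" using D(1) unfolding D'_def by blast
    have "{i. i < d \<and> i \<in> D} \<subseteq> z ` {..<k}"
      using D(1) k z by (auto simp: strict_mono_less)
    then have "card {i. i < d \<and> i \<in> D} \<le> card (z ` {..<k})" by (intro card_mono) auto
    also have "\<dots> \<le> k" using card_image_le[of "{..<k}" z] by simp
    finally have "n < k" using d unfolding D'_def by simp
    then show "d \<in> z ` {n<..}" using k by simp
  qed
  have inj: "inj_on (\<lambda>d. card {i. i < d \<and> i \<in> D}) D"
  proof (rule linorder_inj_onI)
    fix x y assume "x < y" "x \<in> D"
    then have "{i. i < x \<and> i \<in> D} \<subset> {i. i < y \<and> i \<in> D}" by auto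
    then have "card {i. i < x \<and> i \<in> D} < card {i. i < y \<and> i \<in> D}" by (intro psubset_card_mono) auto
    then show "card {i. i < x \<and> i \<in> D} \<noteq> card {i. i < y \<and> i \<in> D}" by simp
  qed auto
  have "finite (D - D')"
  proof (rule finite_imageD)
    show "inj_on (\<lambda>d. card {i. i < d \<and> i \<in> D}) (D - D')" using inj by (rule inj_on_subset) blast
    show "finite ((\<lambda>d. card {i. i < d \<and> i \<in> D}) ` (D - D'))"
      by (rule finite_subset[of _ "{..n}"]) (auto simp: D'_def)
  qed
  moreover have "D' \<subseteq> D" unfolding D'_def by blast
  ultimately show "infinite D'" using D(2) by (metis Diff_infinite_finite double_diff subset_refl)
qed

text \<open>To find \<open>A n\<close>, apply \<open>\<Phi>\<close> to the stem together with what is left of \<open>D\<close> when its first \<open>n + 1\<close>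
  elements are dropped.  The oracle depends on the input, hence the detour through \<open>add_param\<close>.\<close>

lemma computes_uniformly:
  fixes z :: "nat \<Rightarrow> nat"
  assumes z: "strict_mono z" and s: "\<And>k y. y \<in> set s \<Longrightarrow> y < z k"
    and land: "\<And>n. land A \<Phi> n s (z ` {n<..})"
  shows "cmp (inf_subsets (range z)) (\<lambda>D. char_fun A)"
proof -
  define E where "E D n = set s \<union> {d \<in> D. n < card {i. i < d \<and> i \<in> D}}" for D n
  have "dec \<D> (\<lambda>D x. mem1 (p1 x) (list_encode s) \<or>
      (p1 x \<in> D \<and> p2 x < card {i. i < p1 x \<and> i \<in> D}))" for \<D>
    by (intro cmp_intros)
  moreover have "(mem1 (p1 x) (list_encode s) \<or> (p1 x \<in> D \<and> p2 x < card {i. i < p1 x \<and> i \<in> D}))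
      \<longleftrightarrow> p1 x \<in> E D (p2 x)" for D x
    unfolding E_def mem1 by simp
  ultimately have "cmp \<D> (\<lambda>D x. char_fun (E D (p2 x)) (p1 x))" for \<D>
    unfolding dec_def char_fun_def by (simp only:)
  from cmp2_comp[OF this cmp2_pr] have "cmp2 \<D> (\<lambda>D q n. char_fun (E D n) q)" for \<D> by simp
  then show ?thesis
  proof (rule cmp_with_computed_oracle)
    fix D n assume "D \<in> inf_subsets (range z)"
    then have D: "D \<subseteq> range z" "infinite D" unfolding inf_subsets_def by auto
    note D' = drop_inf_subset[OF z D, of n]
    show "eval (E D n) \<Phi> [n] (char_fun A n)"
      unfolding E_def
      by (rule land[of n, unfolded land_def, rule_format, OF D']) (use D(1) s in blast)
  qed
qed

text \<open>The number of elements of \<open>range z\<close> below \<open>z j\<close> is \<open>j\<close>.  So \<open>z (pr c j)\<close> reveals \<open>c\<close> to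
  anyone who can count the range, while \<open>j\<close> is free to make the element as large as desired.\<close>

lemma sparse_subset:
  fixes z :: "nat \<Rightarrow> nat" and h :: "nat \<Rightarrow> nat"
  assumes z: "strict_mono z"
  shows "\<exists>r :: nat \<Rightarrow> nat. strict_mono r \<and> range r \<subseteq> range z \<and>
    (\<forall>k x. x \<le> r k \<longrightarrow> h x \<le> r (Suc k)) \<and>
    (\<forall>k. set (list_decode (p1 (card {i. i < r k \<and> i \<in> range z}))) = r ` {..<k})"
proof -
  \<comment> \<open>The sum of the list stands in for its maximum, in both places.\<close>
  define b where "b c = sum_list c + (\<Sum>x\<le>sum_list c. h x)" for c
  define nx where "nx c = z (pr (list_encode c) (Suc (b c)))" for c
  define c where "c = rec_nat [] (\<lambda>_ c. nx c # c)"
  have c: "c 0 = []" "c (Suc k) = nx (c k) # c k" for k by (simp_all add: c_def)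
  define r where "r k = nx (c k)" for k
  have set_c: "set (c k) = r ` {..<k}" for k
    by (induction k) (auto simp: c r_def lessThan_Suc)
  have b: "b (c k) < r k" for k
    using strict_mono_imp_increasing[OF z, of "pr (list_encode (c k)) (Suc (b (c k)))"]
      le_pr2[of "Suc (b (c k))" "list_encode (c k)"] unfolding r_def nx_def by linarith
  have sum: "r k \<le> sum_list (c (Suc k))" for k by (simp add: c r_def)
  have mono: "strict_mono r"
    unfolding strict_mono_Suc_iff
  proof
    fix k
    have "r k \<le> b (c (Suc k))" using sum[of k] by (simp add: b_def)
    then show "r k < r (Suc k)" using b[of "Suc k"] by simp
  qed
  have "h x \<le> r (Suc k)" if "x \<le> r k" for k x
  proof -
    have "x \<le> sum_list (c (Suc k))" using that sum[of k] by simp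
    then have "h x \<le> (\<Sum>x\<le>sum_list (c (Suc k)). h x)" by (intro member_le_sum) auto
    then show ?thesis using b[of "Suc k"] by (simp add: b_def)
  qed
  moreover have "set (list_decode (p1 (card {i. i < r k \<and> i \<in> range z}))) = r ` {..<k}" for k
  proof -
    have "{i. i < z j \<and> i \<in> range z} = z ` {..<j}" for j
      using z by (auto simp: strict_mono_less)
    then have "card {i. i < z j \<and> i \<in> range z} = j" for j
      using z by (simp add: card_image strict_mono_imp_inj_on inj_on_subset[of z UNIV])
    then have "p1 (card {i. i < r k \<and> i \<in> range z}) = list_encode (c k)"
      by (simp add: r_def nx_def)
    then show ?thesis by (simp add: set_c)
  qed
  moreover have "range r \<subseteq> range z" by (auto simp: r_def nx_def)
  ultimately show ?thesis using mono by blast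
qed

theorem corollary6p2:
  fixes A :: "nat set"
  assumes "infinite A" and "introreducible A"
  shows "\<exists>R. R \<subseteq> A \<and> infinite R \<and> uniformly_introreducible R"
proof -
  obtain \<Phi> s and z :: "nat \<Rightarrow> nat" where z: "strict_mono z" "reservoir A (range z)"
    "\<And>k y. y \<in> set s \<Longrightarrow> y < z k" "\<And>n. land A \<Phi> n s (z ` {n<..})"
    using success_exists[OF assms] by metis
  obtain r :: "nat \<Rightarrow> nat" where r: "strict_mono r" "range r \<subseteq> range z"
    "\<And>k x. x \<le> r k \<Longrightarrow> escape A x \<le> r (Suc k)"
    "\<And>k. set (list_decode (p1 (card {i. i < r k \<and> i \<in> range z}))) = r ` {..<k}"
    using sparse_subset[OF z(1), of "escape A"] by blast
  define \<D> where "\<D> = inf_subsets (range r)"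
  have "\<D> \<subseteq> inf_subsets (range z)" using r(2) unfolding \<D>_def inf_subsets_def by blast
  then have A: "cmp \<D> (\<lambda>D. char_fun A)"
    using computes_uniformly[OF z(1,3,4)] unfolding cmp_def by blast
  have \<D>: "D \<subseteq> range r" "\<exists>d>l. d \<in> D" if "D \<in> \<D>" for D l
    using that unfolding \<D>_def inf_subsets_def infinite_nat_iff_unbounded by blast+
  \<comment> \<open>Between \<open>x\<close> and this value there is another element of \<open>D\<close>, so a whole gap of the sparse set.\<close>
  define g where "g D x = (LEAST d. d \<in> D \<and> (\<exists>d'<d. d' \<in> D \<and> x \<le> d'))"
    for D :: "nat set" and x
  have g_ex: "\<exists>d. d \<in> D \<and> (\<exists>d'<d. d' \<in> D \<and> x \<le> d')" if "D \<in> \<D>" for D x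
    using \<D>(2)[OF that] by (meson less_imp_le)
  have g: "cmp \<D> g" unfolding g_def by (intro cmp_intros g_ex)
  have fast: "escape A x \<le> g D x" if D: "D \<in> \<D>" for D x
  proof -
    have "g D x \<in> D \<and> (\<exists>d'<g D x. d' \<in> D \<and> x \<le> d')"
      unfolding g_def by (rule LeastI_ex) (rule g_ex[OF D])
    then obtain d' where d: "g D x \<in> D" "d' < g D x" "d' \<in> D" "x \<le> d'" by blast
    obtain i j where ij: "g D x = r j" "d' = r i" using d(1,3) \<D>(1)[OF D] by blast
    then have "Suc i \<le> j" using d(2) r(1) by (simp add: strict_mono_less Suc_le_eq)
    then have "r (Suc i) \<le> r j" using r(1) by (simp add: strict_mono_less_eq)
    then show ?thesis using r(3)[of x i] d(4) ij by simp
  qed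
  obtain a b where ab: "\<And>x. x \<in> range z \<longleftrightarrow> W A (pr a x)" "\<And>x. x \<notin> range z \<longleftrightarrow> W A (pr b x)"
    using z(2) unfolding reservoir_def Delta_def Pi_def by blast
  have Z: "dec \<D> (\<lambda>D x. x \<in> range z)"
    by (rule dec_by_W[where P = "\<lambda>x. x \<in> range z", OF A g fast ab])
  \<comment> \<open>The first element of the oracle above \<open>x\<close> carries the list of all smaller members of the sparse set.\<close>
  define d where "d D x = (LEAST d. d \<in> D \<and> x < d)" for D :: "nat set" and x
  have d_ex: "\<exists>d. d \<in> D \<and> x < d" if "D \<in> \<D>" for D x
    using \<D>(2)[OF that] by blast
  have d: "cmp \<D> d" unfolding d_def by (intro cmp_intros d_ex)
  have "dec \<D> (\<lambda>D x. mem1 x (p1 (card {i. i < d D x \<and> i \<in> range z})))"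
    by (intro cmp_intros d dec_comp[OF Z])
  moreover have "mem1 x (p1 (card {i. i < d D x \<and> i \<in> range z})) \<longleftrightarrow> x \<in> range r" if D: "D \<in> \<D>" for D x
  proof -
    have "d D x \<in> D \<and> x < d D x" unfolding d_def by (rule LeastI_ex) (rule d_ex[OF D])
    then obtain k where k: "d D x = r k" "x < r k" using \<D>(1)[OF D] by auto
    have "x \<in> range r \<longleftrightarrow> x \<in> r ` {..<k}"
      using k(2) r(1) by (auto simp: strict_mono_less)
    then show ?thesis unfolding mem1 k(1) r(4) by blast
  qed
  ultimately have "\<exists>\<Psi>. \<forall>D\<in>\<D>. \<forall>x. eval D \<Psi> [x] (char_fun (range r) x)"
    unfolding dec_def cmp_def char_fun_def by auto
  then have "\<exists>\<Psi>. \<forall>D\<in>inf_subsets (range r). computes \<Psi> D (range r)"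
    unfolding computes_def \<D>_def .
  moreover have "infinite (range r)"
    using r(1) finite_imageD strict_mono_imp_inj_on by blast
  moreover have "range r \<subseteq> A" using r(2) z(2) unfolding reservoir_def by blast
  ultimately show ?thesis unfolding uniformly_introreducible_def by blast
qed

end
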